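(* Let $\xi$ be a Lévy process with $\psi(u)=\log\mathbb E e^{u\xi(1)}<\infty$ for all $u\in\mathbb R$, $\xi(1)$ not a.s. constant, and let $\xi_i$, $i\in\mathbb N$, be independent copies of $\xi$. Let $\lambda_2=2\psi'(2)-\psi(2)$ and suppose $(s_N)$ is a non-negative sequence with $s_N\to\infty$ such that for some $\vartheta\in\mathbb R$, \[ \log N=\lambda_2 s_N+2\vartheta\sqrt{\psi''(2)s_N}+o(\sqrt{s_N}),\qquad N\to\infty. \] Let $Z_N(t)=\sum_{i=1}^N e^{\xi_i(s_N+t)}$. Then the finite-dimensional distributions of \[ \frac{Z_N(\cdot)-\mathbb E Z_N(\cdot)}{\sqrt{\operatorname{Var}Z_N(\cdot)}} \] converge weakly, as $N\to\infty$, to those of $\sqrt{\Phi(\vartheta)}\,\mathcal X(\cdot)$, where $\Phi$ is the standard normal distribution function and $\{\mathcal X(t),t\in\mathbb R\}$ is a zero-mean Gaussian process with covariance $\operatorname{Cov}(\mathcal X(t_1),\mathcal X(t_2))=e^{(\psi(1)-\psi(2)/2)|t_2-t_1|}$.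
   Context: A Lévy process is a process with stationary independent increments and càdlàg sample paths, started at $0$. *)

theory Defs
  imports "HOL-Probability.Probability" "HOL-Library.Landau_Symbols"
begin

text \<open>Levy process on a probability space M, time index [0,oo) (values at negative
times are irrelevant): measurable, started at 0, cadlag paths, independent and
stationary increments.\<close>
definition levy_process :: "'a measure \<Rightarrow> (real \<Rightarrow> 'a \<Rightarrow> real) \<Rightarrow> bool" where
  "levy_process M X \<longleftrightarrow>
     prob_space M \<and>
     (\<forall>t\<ge>0. X t \<in> borel_measurable M) \<and>
     (\<forall>\<omega>\<in>space M. X 0 \<omega> = 0) \<and>
     (\<forall>\<omega>\<in>space M. \<forall>t\<ge>0. continuous (at_right t) (\<lambda>s. X s \<omega>)) \<and>
     (\<forall>\<omega>\<in>space M. \<forall>t>0. \<exists>l. ((\<lambda>s. X s \<omega>) \<longlongrightarrow> l) (at_left t)) \<and>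
     (\<forall>n (t::nat \<Rightarrow> real). 0 \<le> t 0 \<and> (\<forall>k<n. t k < t (Suc k)) \<longrightarrow>
        prob_space.indep_vars M (\<lambda>_. borel) (\<lambda>k \<omega>. X (t (Suc k)) \<omega> - X (t k) \<omega>) {..<n}) \<and>
     (\<forall>s\<ge>0. \<forall>h\<ge>0. distr M borel (\<lambda>\<omega>. X (s + h) \<omega> - X s \<omega>) = distr M borel (X h))"

definition path_space :: "(real \<Rightarrow> real) measure" where
  "path_space = Pi\<^sub>M {0..} (\<lambda>_. borel)"

definition path_of :: "(real \<Rightarrow> 'a \<Rightarrow> real) \<Rightarrow> 'a \<Rightarrow> (real \<Rightarrow> real)" where
  "path_of X \<omega> = (\<lambda>t\<in>{0..}. X t \<omega>)"

definition weak_conv_metric :: "(nat \<Rightarrow> 'b::metric_space measure) \<Rightarrow> 'b measure \<Rightarrow> bool" where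
  "weak_conv_metric Ms G \<longleftrightarrow>
     (\<forall>f :: 'b \<Rightarrow> real. continuous_on UNIV f \<and> bounded (range f) \<longrightarrow>
        (\<lambda>n. integral\<^sup>L (Ms n) f) \<longlonglongrightarrow> integral\<^sup>L G f)"

definition centered_gaussian :: "(real^'n) measure \<Rightarrow> ('n \<Rightarrow> 'n \<Rightarrow> real) \<Rightarrow> bool" where
  "centered_gaussian G C \<longleftrightarrow>
     sets G = sets borel \<and> prob_space G \<and>
     (\<forall>u :: real^'n. let v = (\<Sum>i\<in>UNIV. \<Sum>j\<in>UNIV. u$i * C i j * u$j) in
        distr G borel (\<lambda>x. u \<bullet> x) =
          (if v = 0 then return borel 0 else density lborel (normal_density 0 (sqrt v))))"

definition std_normal_cdf :: "real \<Rightarrow> real" where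
  "std_normal_cdf x = measure (density lborel std_normal_density) {..x}"

end

theory Submission
  imports Defs
begin

text \<open>
  The characteristic function of the normalised vector tested against \<open>u\<close> is the \<open>N\<close>-th power of the
  characteristic function of one centred summand, so one needs the limit of
  \<open>N (E e\<^sup>i\<^sup>Y - 1)\<close>, where \<open>Y\<close> is, up to a negligible error, \<open>X R\<close> with \<open>X\<close> the normalised value
  \<open>e^\<xi>(a) / sqrt (N e^(\<psi>(2) a))\<close> at the earliest of the observation times and \<open>R\<close> an independent
  combination of later growth factors. Since \<open>N X\<^sup>2\<close> is the density of the law tilted by \<open>e^(2 \<xi>(a))\<close>, this is the
  tilted mean of a bounded function of \<open>X\<close> that tends to \<open>- E R\<^sup>2 / 2\<close> as \<open>X \<rightarrow> 0\<close> and to \<open>0\<close> as \<open>X \<rightarrow> \<infinity>\<close>.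
  Under the tilt \<open>\<xi>(a)\<close> has mean \<open>\<psi>'(2) a\<close> and variance \<open>\<psi>''(2) a\<close>, so by the central limit theorem and the choice
  of \<open>N\<close> the first alternative has limiting probability \<open>\<Phi>(\<theta>)\<close> and the second \<open>1 - \<Phi>(\<theta>)\<close>. Passing from characteristic
  functions to weak convergence on \<open>real^'n\<close> uses Chebyshev's inequality for tightness and the
  Stone-Weierstrass theorem.
\<close>

section \<open>Weak convergence from characteristic functions\<close>

text \<open>Lindeberg's condition fails here: rare copies with \<open>X\<close> far above
  \<open>1\<close> carry the share \<open>1 - \<Phi>(\<theta>)\<close> of the variance, yet they
  contribute nothing to the limit law. The two regimes are separated by the centred remainder
  \<open>e^(iy) - 1 - iy\<close>, whose linear term is free because the summands have mean zero:
  divided by \<open>y^2\<close> it tends to \<open>-1/2\<close> at \<open>0\<close> and vanishes at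
  infinity, where it grows only linearly. The threshold \<open>X = 1\<close> is
  \<open>\<xi>(a) = (log N + \<psi>(2) a) / 2\<close>; with
  \<open>\<lambda>_2 = 2 \<psi>'(2) - \<psi>(2)\<close> this equals
  \<open>\<psi>'(2) a + \<theta> sqrt (\<psi>''(2) a)\<close> up to \<open>o(sqrt a)\<close>, whence
  the \<open>2 \<theta>\<close> in the hypothesis. A constant factor in \<open>X\<close> moves the
  threshold by a constant, invisible at scale \<open>sqrt a\<close>, so no tilted mass stays at
  intermediate sizes. The correlations come from \<open>R\<close> alone: the mixed second moments of
  the growth factors are \<open>e^(-\<kappa> |t_2 - t_1|)\<close> with
  \<open>\<kappa> = \<psi>(2)/2 - \<psi>(1) > 0\<close>, and the same \<open>\<kappa>\<close> makes
  the centring and the exact variance negligible corrections.\<close>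

inductive trig_poly :: "('a::euclidean_space \<Rightarrow> real) \<Rightarrow> bool" where
  trig_poly_cos: "trig_poly (\<lambda>x. c * cos (u \<bullet> x + b))"
| trig_poly_add: "trig_poly f \<Longrightarrow> trig_poly g \<Longrightarrow> trig_poly (\<lambda>x. f x + g x)"

lemma trig_poly_const: "trig_poly (\<lambda>x. c)"
  using trig_poly_cos[of c 0 0] by simp

text \<open>This is what the phase in the base case is for: a single kind of generator covers sines
  too, and closure under products then needs only one product formula.\<close>

lemma trig_poly_sin: "trig_poly (\<lambda>x. c * sin (u \<bullet> x))"
proof -
  have "c * sin (u \<bullet> x) = c * cos (u \<bullet> x + - (pi/2))" for x
    using cos_add[of "u \<bullet> x" "- (pi/2)"] by simp
  then show ?thesis using trig_poly_cos[of c u "- (pi/2)"] by presburger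
qed

lemma trig_poly_sum:
  "finite S \<Longrightarrow> (\<And>i. i \<in> S \<Longrightarrow> trig_poly (f i)) \<Longrightarrow> trig_poly (\<lambda>x. \<Sum>i\<in>S. f i x)"
  by (induction S rule: finite_induct) (auto intro: trig_poly_const trig_poly_add)

text \<open>A product of two cosines is half the sum of the cosines at the difference and the sum of
  the arguments; bilinearity does the rest.\<close>

lemma trig_poly_mult:
  assumes "trig_poly f" "trig_poly g"
  shows "trig_poly (\<lambda>x. f x * g x)"
  using assms
proof (induction rule: trig_poly.induct)
  case (trig_poly_cos c u b)
  from \<open>trig_poly g\<close> show ?case
  proof (induction rule: trig_poly.induct)
    case (trig_poly_cos c' u' b')
    have "c * cos (u \<bullet> x + b) * (c' * cos (u' \<bullet> x + b')) =
       (c * c' / 2) * cos ((u - u') \<bullet> x + (b - b')) + (c * c' / 2) * cos ((u + u') \<bullet> x + (b + b'))" for x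
    proof -
      have "c * cos (u \<bullet> x + b) * (c' * cos (u' \<bullet> x + b')) =
        c * c' * (cos (u \<bullet> x + b) * cos (u' \<bullet> x + b'))" by simp
      also have "\<dots> = c * c' * ((cos ((u \<bullet> x + b) - (u' \<bullet> x + b')) + cos ((u \<bullet> x + b) + (u' \<bullet> x + b'))) / 2)"
        by (simp only: cos_times_cos)
      also have "(u \<bullet> x + b) - (u' \<bullet> x + b') = (u - u') \<bullet> x + (b - b')"
        by (simp add: inner_diff_left)
      also have "(u \<bullet> x + b) + (u' \<bullet> x + b') = (u + u') \<bullet> x + (b + b')"
        by (simp add: inner_add_left)
      finally show ?thesis by (simp add: field_simps)
    qed
    then show ?case
      by (simp only:) (intro trig_poly.intros)
  next
    case (trig_poly_add f g)
    then show ?case by (auto simp: distrib_left intro: trig_poly.intros)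
  qed
next
  case (trig_poly_add f g)
  then show ?case by (auto simp: distrib_right intro: trig_poly.intros)
qed

text \<open>Coordinatewise sines lie in the algebra of trigonometric polynomials, so substituting
  them turns polynomial approximation on a cube into trigonometric approximation.\<close>

lemma trig_poly_polynomial_sin:
  fixes P :: "'a::euclidean_space \<Rightarrow> real"
  assumes "real_polynomial_function P"
  shows "trig_poly (\<lambda>x. P (\<Sum>b\<in>Basis. sin ((x \<bullet> b) / L) *\<^sub>R b))"
  using assms
proof (induction rule: real_polynomial_function.induct)
  case (linear f)
  have "f (\<Sum>b\<in>Basis. sin ((x \<bullet> b) / L) *\<^sub>R b) = (\<Sum>b\<in>Basis. f b * sin ((b /\<^sub>R L) \<bullet> x))" for x
  proof -
    interpret bounded_linear f by fact
    show ?thesis by (simp add: sum scale inner_commute divide_inverse mult_ac)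
  qed
  then show ?case
    by (simp only:) (intro trig_poly_sum trig_poly_sin finite_Basis)
qed (auto intro: trig_poly_const trig_poly_add trig_poly_mult)

lemma trig_poly_continuous: "trig_poly f \<Longrightarrow> continuous_on UNIV f"
  by (induction rule: trig_poly.induct) (auto intro!: continuous_intros)

lemma trig_poly_bounded: "trig_poly f \<Longrightarrow> \<exists>B. \<forall>x. \<bar>f x\<bar> \<le> B"
proof (induction rule: trig_poly.induct)
  case (trig_poly_cos c u b)
  have "\<bar>c * cos (u \<bullet> x + b)\<bar> \<le> \<bar>c\<bar>" for x
    using mult_left_le[of "\<bar>cos (u \<bullet> x + b)\<bar>" "\<bar>c\<bar>"] by (simp add: abs_mult)
  then show ?case by blast
next
  case (trig_poly_add f g)
  then obtain B C where "\<forall>x. \<bar>f x\<bar> \<le> B" "\<forall>x. \<bar>g x\<bar> \<le> C" by blast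
  then have "\<bar>f x + g x\<bar> \<le> B + C" for x
    using abs_triangle_ineq[of "f x" "g x"] by (meson add_mono order_trans)
  then show ?case by blast
qed

lemma integrable_continuous_bounded:
  fixes f :: "'a::euclidean_space \<Rightarrow> real"
  assumes "prob_space \<mu>" "sets \<mu> = sets borel" "continuous_on UNIV f" "\<And>x. \<bar>f x\<bar> \<le> B"
  shows "integrable \<mu> f"
proof -
  interpret prob_space \<mu> by fact
  show ?thesis
    by (rule integrable_const_bound[of _ B])
       (use assms borel_measurable_continuous_onI[of f] in \<open>auto simp: measurable_cong_sets[OF assms(2) refl]\<close>)
qed

text \<open>The composition with the coordinatewise sine keeps \<open>p\<close> bounded on the whole space, not
only on the box where it approximates \<open>f\<close>.\<close>

lemma trig_poly_approx:
  fixes f :: "'a::euclidean_space \<Rightarrow> real"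
  assumes "continuous_on UNIV f" "\<And>x. \<bar>f x\<bar> \<le> C" "e > 0" "L > 0"
  obtains p where "trig_poly p" "\<And>x. norm x \<le> L \<Longrightarrow> \<bar>f x - p x\<bar> \<le> e" "\<And>x. \<bar>p x\<bar> \<le> C + e"
proof -
  let ?S = "cbox (- \<Sum>Basis) (\<Sum>Basis) :: 'a set"
  \<comment> \<open>\<open>F\<close> is \<open>f\<close> read in the coordinates
    \<open>y_b = sin (x_b / L)\<close>. It is continuous on the whole cube, and
    \<open>arcsin\<close> undoes \<open>sin\<close> on the ball of radius \<open>L\<close> because
    there the arguments have modulus at most \<open>1 < pi/2\<close>.\<close>
  define F where "F y = f (\<Sum>b\<in>Basis. (L * arcsin (y \<bullet> b)) *\<^sub>R b)" for y
  have S: "y \<in> ?S \<longleftrightarrow> (\<forall>b\<in>Basis. -1 \<le> y \<bullet> b \<and> y \<bullet> b \<le> 1)" for y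
    by (simp add: mem_box)
  have "continuous_on ?S F"
    unfolding F_def
    by (intro continuous_on_compose2[OF assms(1)] continuous_intros) (auto simp: S)
  then obtain P where P: "real_polynomial_function P" "\<And>y. y \<in> ?S \<Longrightarrow> \<bar>F y - P y\<bar> < e"
    using Stone_Weierstrass_real_polynomial_function[of ?S F e] assms(3) compact_cbox by blast
  define p where "p x = P (\<Sum>b\<in>Basis. sin ((x \<bullet> b) / L) *\<^sub>R b)" for x
  have F: "\<bar>F (\<Sum>b\<in>Basis. sin ((x \<bullet> b) / L) *\<^sub>R b) - p x\<bar> < e" for x
    unfolding p_def by (rule P(2)) (auto simp: S)
  show ?thesis
  proof (rule that[of p])
    show "trig_poly p" unfolding p_def using P(1) by (rule trig_poly_polynomial_sin)
    show "\<bar>f x - p x\<bar> \<le> e" if "norm x \<le> L" for x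
    proof -
      have "L * arcsin (sin (x \<bullet> b / L)) = x \<bullet> b" if "b \<in> Basis" for b
      proof -
        have "\<bar>x \<bullet> b\<bar> \<le> L" using Basis_le_norm[OF that, of x] \<open>norm x \<le> L\<close> by linarith
        then have "\<bar>x \<bullet> b / L\<bar> \<le> 1" using \<open>L > 0\<close> by simp
        then have "- (pi/2) \<le> x \<bullet> b / L" "x \<bullet> b / L \<le> pi/2" using pi_gt3 by linarith+
        then show ?thesis using \<open>L > 0\<close> by (simp add: arcsin_sin)
      qed
      then have "F (\<Sum>b\<in>Basis. sin ((x \<bullet> b) / L) *\<^sub>R b) = f x"
        unfolding F_def by (simp add: euclidean_representation cong: sum.cong)
      with F[of x] show ?thesis by simp
    qed
    show "\<bar>p x\<bar> \<le> C + e" for x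
    proof -
      have "\<bar>F (\<Sum>b\<in>Basis. sin ((x \<bullet> b) / L) *\<^sub>R b)\<bar> \<le> C"
        unfolding F_def by (rule assms(2))
      with F[of x] show ?thesis by linarith
    qed
  qed
qed

text \<open>The test function is replaced by a trigonometric polynomial that is close to it on a
  large ball and no larger than about \<open>C\<close> outside; tightness pays for the outside. The
  conditions on \<open>\<mu>\<close> are only eventual because for small \<open>N\<close> the
  observation times may be negative, where the process is not known to be measurable.\<close>

lemma weak_conv_metric_charI:
  fixes \<mu> :: "nat \<Rightarrow> 'a::euclidean_space measure"
  assumes \<mu>: "\<forall>\<^sub>F N in sequentially. prob_space (\<mu> N) \<and> sets (\<mu> N) = sets borel"
    and G: "prob_space G" "sets G = sets borel"
    and conv: "\<And>u b. (\<lambda>N. \<integral>x. cos (u \<bullet> x + b) \<partial>\<mu> N) \<longlonglongrightarrow> (\<integral>x. cos (u \<bullet> x + b) \<partial>G)"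
    and tight: "\<And>e. e > 0 \<Longrightarrow> \<exists>L>0. \<forall>\<^sub>F N in sequentially. measure (\<mu> N) {x. norm x > L} \<le> e"
  shows "weak_conv_metric \<mu> G"
  unfolding weak_conv_metric_def
proof (intro allI impI, elim conjE)
  fix f :: "'a \<Rightarrow> real" assume f: "continuous_on UNIV f" "bounded (range f)"
  obtain C where C: "C > 0" "\<And>x. \<bar>f x\<bar> \<le> C"
    using f(2) by (auto simp: bounded_pos)
  interpret G: prob_space G by fact
  have trig: "(\<lambda>N. \<integral>x. p x \<partial>\<mu> N) \<longlonglongrightarrow> (\<integral>x. p x \<partial>G)" if "trig_poly p" for p
    using that
  proof (induction rule: trig_poly.induct)
    case (trig_poly_cos c u b)
    show ?case using tendsto_mult_left[OF conv[of u b], of c] by simp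
  next
    case (trig_poly_add f g)
    obtain B where B: "\<And>x. \<bar>f x\<bar> \<le> B" using trig_poly_bounded[OF trig_poly_add(1)] by blast
    obtain B' where B': "\<And>x. \<bar>g x\<bar> \<le> B'" using trig_poly_bounded[OF trig_poly_add(2)] by blast
    note int = integrable_continuous_bounded[OF _ _ trig_poly_continuous[OF trig_poly_add(1)] B]
      integrable_continuous_bounded[OF _ _ trig_poly_continuous[OF trig_poly_add(2)] B']
    have "\<forall>\<^sub>F N in sequentially. (\<integral>x. f x \<partial>\<mu> N) + (\<integral>x. g x \<partial>\<mu> N) = (\<integral>x. f x + g x \<partial>\<mu> N)"
      using \<mu> by eventually_elim (simp add: int)
    moreover have "(\<integral>x. f x + g x \<partial>G) = (\<integral>x. f x \<partial>G) + (\<integral>x. g x \<partial>G)"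
      by (simp add: int G)
    ultimately show ?case
      using tendsto_add[OF trig_poly_add(3,4)] by (simp add: filterlim_cong[OF refl refl])
  qed
  have bound: "\<bar>(\<integral>x. f x \<partial>\<nu>) - (\<integral>x. p x \<partial>\<nu>)\<bar> \<le> e + (2 * C + e) * measure \<nu> {x. norm x > L}"
    if \<nu>: "prob_space \<nu>" "sets \<nu> = sets borel" and p: "trig_poly p" "\<And>x. norm x \<le> L \<Longrightarrow> \<bar>f x - p x\<bar> \<le> e"
      "\<And>x. \<bar>p x\<bar> \<le> C + e" and "e > 0"
    for \<nu> p e L
  proof -
    interpret \<nu>: prob_space \<nu> by fact
    have [measurable]: "{x. norm x > L} \<in> sets \<nu>" unfolding \<nu>(2) by simp
    have int: "integrable \<nu> f" "integrable \<nu> p"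
      using integrable_continuous_bounded[OF \<nu> f(1) C(2)]
        integrable_continuous_bounded[OF \<nu> trig_poly_continuous[OF p(1)] p(3)] by auto
    have "\<bar>(\<integral>x. f x \<partial>\<nu>) - (\<integral>x. p x \<partial>\<nu>)\<bar> = \<bar>\<integral>x. f x - p x \<partial>\<nu>\<bar>"
      using int by simp
    also have "\<dots> \<le> (\<integral>x. e + (2 * C + e) * indicator {x. norm x > L} x \<partial>\<nu>)"
    proof (rule integral_abs_bound_integral)
      show "\<bar>f x - p x\<bar> \<le> e + (2 * C + e) * indicat_real {x. L < norm x} x" if "x \<in> space \<nu>" for x
        using p(2)[of x] p(3)[of x] C(2)[of x] \<open>e > 0\<close> \<open>C > 0\<close>
        by (cases "norm x \<le> L") (auto simp: indicator_def)
    qed (use int in \<open>auto simp: less_top[symmetric]\<close>)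
    also have "\<dots> = e + (2 * C + e) * measure \<nu> {x. norm x > L}"
      by (simp add: \<nu>.prob_space less_top[symmetric])
    finally show ?thesis .
  qed
  show "(\<lambda>N. integral\<^sup>L (\<mu> N) f) \<longlonglongrightarrow> integral\<^sup>L G f"
  proof (rule tendstoI)
    fix r :: real assume "r > 0"
    \<comment> \<open>Replacing \<open>f\<close> by \<open>p\<close> costs
      \<open>e + (2 * C + 1) * e\<close> under each of the two measures and comparing the integrals
      of \<open>p\<close> costs \<open>e\<close>: in total \<open>e * (4 * C + 5)\<close>, which the
      denominator covers with room to spare. The cap \<open>e \<le> 1\<close> turns
      \<open>2 * C + e\<close> into \<open>2 * C + 1\<close>.\<close>
    define e where "e = min 1 (r / (8 * C + 20))"
    have e: "e > 0" "e \<le> 1" "e * (8 * C + 20) \<le> r"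
      using \<open>r > 0\<close> \<open>C > 0\<close> pos_le_divide_eq[of "8 * C + 20" e r] by (auto simp: e_def)
    \<comment> \<open>A single probability measure is tight: the complements of growing balls
      decrease to the empty set.\<close>
    have "(\<lambda>n. measure G {x. norm x > real n}) \<longlonglongrightarrow> measure G (\<Inter>n. {x. norm x > real n})"
      by (rule G.finite_Lim_measure_decseq) (auto simp: G(2) decseq_def)
    also have "(\<Inter>n. {x::'a. norm x > real n}) = {}"
      by (auto simp: not_less) (meson not_less real_arch_simple)
    finally have "\<forall>\<^sub>F n in sequentially. measure G {x. norm x > real n} < e"
      using e(1) by (simp add: order_tendstoD)
    then obtain n where n: "measure G {x. norm x > real n} < e"
      by (auto simp: eventually_sequentially)
    obtain L0 where L0: "L0 > 0" "\<forall>\<^sub>F N in sequentially. measure (\<mu> N) {x. norm x > L0} \<le> e"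
      using tight[OF e(1)] by blast
    define L where "L = max L0 n"
    have "L > 0" using L0 by (simp add: L_def)
    obtain p where p: "trig_poly p" "\<And>x. norm x \<le> L \<Longrightarrow> \<bar>f x - p x\<bar> \<le> e" "\<And>x. \<bar>p x\<bar> \<le> C + e"
      using trig_poly_approx[OF f(1) C(2) e(1) \<open>L > 0\<close>] by blast
    have "measure G {x. norm x > L} \<le> measure G {x. norm x > real n}"
      by (rule G.finite_measure_mono) (auto simp: L_def G)
    with n have GL: "measure G {x. norm x > L} \<le> e" by simp
    have fact2: "(2 * C + e) * e \<le> (2 * C + 1) * e"
      using e C by (intro mult_right_mono) auto
    have small: "x \<le> e \<Longrightarrow> e + (2 * C + e) * x \<le> e + (2 * C + 1) * e" for x
      using mult_left_mono[of x e "2 * C + e"] fact2 e C by linarith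
    have G_est: "\<bar>(\<integral>x. f x \<partial>G) - (\<integral>x. p x \<partial>G)\<bar> \<le> e + (2 * C + 1) * e"
      using bound[OF G p(1,2,3) e(1)] small[OF GL] by fastforce
    have "\<forall>\<^sub>F N in sequentially. \<bar>(\<integral>x. p x \<partial>\<mu> N) - (\<integral>x. p x \<partial>G)\<bar> < e"
      using tendstoD[OF trig[OF p(1)] e(1)] by (simp add: dist_real_def)
    with \<mu> L0(2) show "\<forall>\<^sub>F N in sequentially. dist (integral\<^sup>L (\<mu> N) f) (integral\<^sup>L G f) < r"
    proof eventually_elim
      case (elim N)
      interpret N: prob_space "\<mu> N" using elim by simp
      have "measure (\<mu> N) {x. norm x > L} \<le> measure (\<mu> N) {x. norm x > L0}"
        by (rule N.finite_measure_mono) (auto simp: L_def elim)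
      then have "\<bar>(\<integral>x. f x \<partial>\<mu> N) - (\<integral>x. p x \<partial>\<mu> N)\<bar> \<le> e + (2 * C + 1) * e"
        using bound[of "\<mu> N", OF _ _ p(1,2,3) e(1)] small[of "measure (\<mu> N) {x. norm x > L}"] elim by fastforce
      with elim(3) G_est have "\<bar>(\<integral>x. f x \<partial>\<mu> N) - (\<integral>x. f x \<partial>G)\<bar> < 2 * (e + (2 * C + 1) * e) + e"
        unfolding abs_le_iff abs_less_iff by simp
      also have "\<dots> = e * (4 * C + 5)" by (simp add: algebra_simps)
      also have "\<dots> \<le> r"
        using e C mult_left_mono[of "4 * C + 5" "8 * C + 20" e] by linarith
      finally show ?case by (simp add: dist_real_def)
    qed
  qed
qed

text \<open>A shifted cosine is the real part of a rotated character, so pointwise convergence of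
  characteristic functions gives convergence on all generators.\<close>

lemma weak_conv_metric_iexpI:
  fixes \<mu> :: "nat \<Rightarrow> 'a::euclidean_space measure"
  assumes \<mu>: "\<forall>\<^sub>F N in sequentially. prob_space (\<mu> N) \<and> sets (\<mu> N) = sets borel"
    and G: "prob_space G" "sets G = sets borel"
    and conv: "\<And>u. (\<lambda>N. \<integral>x. iexp (u \<bullet> x) \<partial>\<mu> N) \<longlonglongrightarrow> (\<integral>x. iexp (u \<bullet> x) \<partial>G)"
    and tight: "\<And>e. e > 0 \<Longrightarrow> \<exists>L>0. \<forall>\<^sub>F N in sequentially. measure (\<mu> N) {x. norm x > L} \<le> e"
  shows "weak_conv_metric \<mu> G"
proof (rule weak_conv_metric_charI[OF \<mu> G _ tight])
  fix u :: 'a and b :: real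
  have cos: "(\<integral>x. cos (u \<bullet> x + b) \<partial>\<nu>) = Re (iexp b * (\<integral>x. iexp (u \<bullet> x) \<partial>\<nu>))"
    if \<nu>: "prob_space \<nu>" "sets \<nu> = sets borel" for \<nu>
  proof -
    interpret prob_space \<nu> by fact
    have [measurable_cong]: "sets \<nu> = sets borel" by fact
    have int: "integrable \<nu> (\<lambda>x. iexp (u \<bullet> x))"
      by (rule integrable_iexp) auto
    have "Re (iexp b * (\<integral>x. iexp (u \<bullet> x) \<partial>\<nu>)) = (\<integral>x. Re (iexp b * iexp (u \<bullet> x)) \<partial>\<nu>)"
      using int by (subst integral_mult_right_zero[symmetric]) (rule integral_Re[symmetric], simp)
    also have "\<dots> = (\<integral>x. cos (u \<bullet> x + b) \<partial>\<nu>)"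
      by (intro Bochner_Integration.integral_cong refl) (simp add: exp_add[symmetric] Re_exp algebra_simps)
    finally show ?thesis ..
  qed
  have "(\<lambda>N. Re (iexp b * (\<integral>x. iexp (u \<bullet> x) \<partial>\<mu> N))) \<longlonglongrightarrow> Re (iexp b * (\<integral>x. iexp (u \<bullet> x) \<partial>G))"
    by (intro tendsto_intros conv)
  moreover have "\<forall>\<^sub>F N in sequentially. Re (iexp b * (\<integral>x. iexp (u \<bullet> x) \<partial>\<mu> N)) = (\<integral>x. cos (u \<bullet> x + b) \<partial>\<mu> N)"
    using \<mu> by eventually_elim (simp add: cos)
  ultimately show "(\<lambda>N. \<integral>x. cos (u \<bullet> x + b) \<partial>\<mu> N) \<longlonglongrightarrow> (\<integral>x. cos (u \<bullet> x + b) \<partial>G)"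
    unfolding cos[OF G] by (rule Lim_transform_eventually)
qed auto

section \<open>Gaussian vectors with Ornstein-Uhlenbeck covariance\<close>

lemma borel_measurable_vec_lambda:
  fixes f :: "'n::finite \<Rightarrow> 'a \<Rightarrow> real"
  assumes "\<And>k. f k \<in> borel_measurable M"
  shows "(\<lambda>\<omega>. \<chi> k. f k \<omega>) \<in> borel_measurable M"
  unfolding borel_measurable_euclidean_space[of "\<lambda>\<omega>. \<chi> k. f k \<omega>"]
  using assms by (auto simp: Basis_vec_def inner_axis)

text \<open>The weights are the increments of \<open>F\<close> along the sorted points, the smallest
  point receiving the value of \<open>F\<close> itself; monotonicity and \<open>F \<ge> 0\<close>
  make them non-negative. Adding a new maximum in the induction leaves the earlier partial sums
  untouched.\<close>

lemma exists_weights_mono: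
  fixes F :: "real \<Rightarrow> real"
  assumes "finite D" "mono F" "\<And>x. 0 \<le> F x"
  shows "\<exists>w. (\<forall>x. 0 \<le> w x) \<and> (\<forall>t\<in>D. (\<Sum>x\<in>{x\<in>D. x \<le> t}. w x) = F t)"
  using assms(1)
proof (induction D rule: finite_linorder_max_induct)
  case empty
  then show ?case by (auto intro: exI[of _ "\<lambda>_. 0"])
next
  case (insert b A)
  then obtain w where w: "\<And>x. 0 \<le> w x" "\<And>t. t \<in> A \<Longrightarrow> (\<Sum>x\<in>{x\<in>A. x \<le> t}. w x) = F t" by blast
  have le: "(\<Sum>x\<in>A. w x) \<le> F b"
  proof (cases "A = {}")
    case True then show ?thesis using assms(3) by simp
  next
    case False
    then have "{x\<in>A. x \<le> Max A} = A" using insert by auto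
    with w(2)[of "Max A"] False insert have "(\<Sum>x\<in>A. w x) = F (Max A)" by simp
    also have "\<dots> \<le> F b" using insert False by (intro monoD[OF assms(2)] less_imp_le) auto
    finally show ?thesis .
  qed
  define w' where "w' = w(b := F b - (\<Sum>x\<in>A. w x))"
  have b: "b \<notin> A" using insert by auto
  have "(\<Sum>x\<in>{x\<in>insert b A. x \<le> t}. w' x) = F t" if "t \<in> insert b A" for t
  proof (cases "t = b")
    case True
    then have "{x\<in>insert b A. x \<le> t} = insert b A" using insert by (auto intro: less_imp_le)
    moreover have "(\<Sum>x\<in>A. w' x) = (\<Sum>x\<in>A. w x)"
      using b by (intro sum.cong) (auto simp: w'_def)
    ultimately show ?thesis using True b insert by (simp add: w'_def)
  next
    case False
    then have "{x\<in>insert b A. x \<le> t} = {x\<in>A. x \<le> t}" using insert that by auto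
    moreover have "(\<Sum>x\<in>{x\<in>A. x \<le> t}. w' x) = (\<Sum>x\<in>{x\<in>A. x \<le> t}. w x)"
      using b by (intro sum.cong) (auto simp: w'_def)
    ultimately show ?thesis using w(2)[of t] that False by simp
  qed
  moreover have "0 \<le> w' x" for x using w(1) le by (simp add: w'_def)
  ultimately show ?case by blast
qed

section \<open>Normal laws on the line, with the point mass at zero as the case of variance
  zero\<close>

lemma real_distribution_normal_var:
  "real_distribution (if v = 0 then return borel 0 else density lborel (normal_density 0 (sqrt v)))"
  if "v \<ge> 0"
proof (cases "v = 0")
  case True
  interpret prob_space "return borel (0::real)" by (rule prob_space_return) simp
  show ?thesis using True by (simp, unfold_locales) auto
next
  case False
  interpret prob_space "density lborel (normal_density 0 (sqrt v))"
    using False that by (intro prob_space_normal_density) auto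
  show ?thesis using False by (simp, unfold_locales) auto
qed

lemma char_normal_var:
  assumes "v \<ge> 0"
  shows "char (if v = 0 then return borel 0 else density lborel (normal_density 0 (sqrt v))) s
    = of_real (exp (- (s\<^sup>2 * v) / 2))"
proof (cases "v = 0")
  case True
  then show ?thesis by (simp add: char_def integral_return)
next
  case False
  let ?M = "density lborel (normal_density 0 (sqrt v))"
  have v: "sqrt v > 0" using assms False by simp
  interpret prob_space ?M using v by (intro prob_space_normal_density)
  have "distributed ?M lborel (\<lambda>x. x) (normal_density 0 (sqrt v))"
    by (auto simp: distributed_def distr_id2)
  then have "distributed ?M lborel (\<lambda>x. (x - 0) / sqrt v) std_normal_density"
    by (subst (asm) normal_standard_normal_convert[OF v])
  then have *: "distr ?M lborel (\<lambda>x. x / sqrt v) = std_normal_distribution"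
    by (simp add: distributed_def)
  have "char ?M s = (\<integral>x. iexp ((s * sqrt v) * (x / sqrt v)) \<partial>?M)"
    unfolding char_def using v by simp
  also have "\<dots> = char (distr ?M lborel (\<lambda>x. x / sqrt v)) (s * sqrt v)"
    unfolding char_def by (subst integral_distr) auto
  also have "\<dots> = of_real (exp (- (s\<^sup>2 * v) / 2))"
    using assms unfolding * char_std_normal_distribution by (simp add: power_mult_distrib)
  finally show ?thesis using False by simp
qed

lemma centered_gaussian_char:
  fixes G :: "(real^'n) measure"
  assumes "centered_gaussian G C" "(\<Sum>i\<in>UNIV. \<Sum>j\<in>UNIV. u$i * C i j * u$j) \<ge> 0"
  shows "(\<integral>x. iexp (u \<bullet> x) \<partial>G) = of_real (exp (- (\<Sum>i\<in>UNIV. \<Sum>j\<in>UNIV. u$i * C i j * u$j) / 2))"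
proof -
  have [measurable_cong]: "sets G = sets borel" using assms by (simp add: centered_gaussian_def)
  have "(\<integral>x. iexp (u \<bullet> x) \<partial>G) = char (distr G borel (\<lambda>x. u \<bullet> x)) 1"
    unfolding char_def by (subst integral_distr) auto
  also have "\<dots> = of_real (exp (- (\<Sum>i\<in>UNIV. \<Sum>j\<in>UNIV. u$i * C i j * u$j) / 2))"
    using assms char_normal_var[OF assms(2), of 1]
    by (simp add: centered_gaussian_def Let_def)
  finally show ?thesis .
qed

text \<open>A covariance given as a Gram matrix turns its quadratic form into a sum of squares,
  which is visibly non-negative and is the variance of a linear combination of independent standard
  normals.\<close>

lemma gram_quadratic_form:
  fixes B :: "'d \<Rightarrow> 'n::finite \<Rightarrow> real" and u :: "real^'n"
  shows "(\<Sum>i\<in>UNIV. \<Sum>j\<in>UNIV. u$i * (\<Sum>d\<in>D. B d i * B d j) * u$j) = (\<Sum>d\<in>D. (\<Sum>k\<in>UNIV. u$k * B d k)\<^sup>2)"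
proof -
  have "(\<Sum>d\<in>D. (\<Sum>k\<in>UNIV. u$k * B d k)\<^sup>2) = (\<Sum>d\<in>D. \<Sum>i\<in>UNIV. \<Sum>j\<in>UNIV. (u$i * B d i) * (u$j * B d j))"
    unfolding power2_eq_square sum_product ..
  also have "\<dots> = (\<Sum>i\<in>UNIV. \<Sum>j\<in>UNIV. \<Sum>d\<in>D. (u$i * B d i) * (u$j * B d j))"
    by (subst sum.swap, intro sum.cong refl, subst sum.swap) simp
  also have "\<dots> = (\<Sum>i\<in>UNIV. \<Sum>j\<in>UNIV. u$i * (\<Sum>d\<in>D. B d i * B d j) * u$j)"
    unfolding sum_distrib_left sum_distrib_right by (intro sum.cong refl) (simp add: mult_ac)
  finally show ?thesis ..
qed

text \<open>The vector is the image of independent standard normals indexed by \<open>D\<close>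
  under the matrix \<open>B\<close>. Its linear functionals are identified through their
  characteristic functions, which factor over \<open>D\<close>; this treats zero variance along with
  the rest.\<close>

lemma exists_centered_gaussian_gram:
  fixes B :: "'d \<Rightarrow> 'n::finite \<Rightarrow> real"
  assumes "finite D"
  shows "\<exists>G. centered_gaussian G (\<lambda>i j. \<Sum>d\<in>D. B d i * B d j)"
proof -
  let ?C = "\<lambda>i j. \<Sum>d\<in>D. B d i * B d j"
  interpret std: prob_space std_normal_distribution by (rule prob_space_normal_density) simp
  interpret product_sigma_finite "\<lambda>_::'d. std_normal_distribution"
    by unfold_locales
  interpret P: prob_space "Pi\<^sub>M D (\<lambda>_. std_normal_distribution)"
    by (intro prob_space_PiM) unfold_locales
  let ?P = "Pi\<^sub>M D (\<lambda>_. std_normal_distribution)"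
  define X :: "('d \<Rightarrow> real) \<Rightarrow> real^'n" where "X z = (\<chi> k. \<Sum>d\<in>D. B d k * z d)" for z
  have X[measurable]: "X \<in> borel_measurable ?P"
    unfolding X_def by (intro borel_measurable_vec_lambda) measurable
  define G where "G = distr ?P borel X"
  have "distr G borel (\<lambda>x. u \<bullet> x) =
     (if v = 0 then return borel 0 else density lborel (normal_density 0 (sqrt v)))"
    if v: "v = (\<Sum>i\<in>UNIV. \<Sum>j\<in>UNIV. u$i * ?C i j * u$j)" for u :: "real^'n" and v
  proof (rule Levy_uniqueness)
    define b where "b d = (\<Sum>k\<in>UNIV. u$k * B d k)" for d
    have vb: "v = (\<Sum>d\<in>D. (b d)\<^sup>2)"
      unfolding v b_def by (rule gram_quadratic_form)
    then have v0: "v \<ge> 0" by (simp add: sum_nonneg)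
    have uX: "u \<bullet> X z = (\<Sum>d\<in>D. b d * z d)" for z
      unfolding X_def inner_vec_def b_def
      by (simp add: sum_distrib_left sum_distrib_right mult_ac) (rule sum.swap)
    show "real_distribution (if v = 0 then return borel 0 else density lborel (normal_density 0 (sqrt v)))"
      by (rule real_distribution_normal_var[OF v0])
    have D: "distr G borel (\<lambda>x. u \<bullet> x) = distr ?P borel (\<lambda>z. \<Sum>d\<in>D. b d * z d)"
      unfolding G_def by (subst distr_distr) (auto simp: o_def uX)
    show "real_distribution (distr G borel (\<lambda>x. u \<bullet> x))"
      unfolding D by (rule P.real_distribution_distr) measurable
    show "char (distr G borel (\<lambda>x. u \<bullet> x)) =
      char (if v = 0 then return borel 0 else density lborel (normal_density 0 (sqrt v)))"
    proof
      fix s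
      have "char (distr G borel (\<lambda>x. u \<bullet> x)) s = (\<integral>z. iexp (s * (\<Sum>d\<in>D. b d * z d)) \<partial>?P)"
        unfolding D char_def by (subst integral_distr) auto
      also have "\<dots> = (\<integral>z. (\<Prod>d\<in>D. iexp (s * b d * z d)) \<partial>?P)"
        using assms by (simp add: exp_sum[symmetric] sum_distrib_left mult_ac)
      also have "\<dots> = (\<Prod>d\<in>D. \<integral>x. iexp (s * b d * x) \<partial>std_normal_distribution)"
        using assms by (intro product_integral_prod std.integrable_iexp) auto
      also have "\<dots> = (\<Prod>d\<in>D. char std_normal_distribution (s * b d))"
        by (simp add: char_def)
      also have "\<dots> = of_real (\<Prod>d\<in>D. exp (- ((s * b d)\<^sup>2) / 2))"
        unfolding char_std_normal_distribution by simp
      also have "(\<Prod>d\<in>D. exp (- ((s * b d)\<^sup>2) / 2)) = exp (- (s\<^sup>2 * v) / 2)"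
        using assms unfolding vb
        by (simp add: exp_sum[symmetric] sum_distrib_left sum_divide_distrib sum_negf power_mult_distrib)
      also have "of_real \<dots> = char (if v = 0 then return borel 0 else density lborel (normal_density 0 (sqrt v))) s"
        by (rule char_normal_var[OF v0, symmetric])
      finally show "char (distr G borel (\<lambda>x. u \<bullet> x)) s =
        char (if v = 0 then return borel 0 else density lborel (normal_density 0 (sqrt v))) s" .
    qed
  qed
  moreover have "prob_space G" unfolding G_def by (rule P.prob_space_distr) simp
  ultimately have "centered_gaussian G ?C"
    unfolding centered_gaussian_def Let_def by (auto simp: G_def)
  then show ?thesis by blast
qed

text \<open>The covariance is that of \<open>sqrt c * exp (- \<kappa> t) * W (exp (2 \<kappa> t))\<close> with \<open>W\<close> a Brownian motion; the weights are
the variances of the increments of \<open>W\<close>.\<close>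

lemma ornstein_uhlenbeck_gram:
  fixes ts :: "'n::finite \<Rightarrow> real"
  assumes "c \<ge> 0" "\<kappa> \<ge> 0"
  shows "\<exists>(D :: real set) B. finite D \<and> (\<forall>i j. c * exp (- \<kappa> * \<bar>ts j - ts i\<bar>) = (\<Sum>d\<in>D. B d i * B d j))"
proof -
  let ?D = "range ts"
  obtain w where w: "\<And>x. 0 \<le> w x" "\<And>t. t \<in> ?D \<Longrightarrow> (\<Sum>x\<in>{x\<in>?D. x \<le> t}. w x) = exp (2 * \<kappa> * t)"
    using exists_weights_mono[of ?D "\<lambda>t. exp (2 * \<kappa> * t)"] assms(2)
    by (auto simp: mono_def mult_left_mono)
  \<comment> \<open>\<open>B d i\<close> is the coefficient of the increment at \<open>d\<close> in
    the value at time \<open>ts i\<close>; later increments do not enter. Two times therefore share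
    the increments up to their minimum, and \<open>2 * min x y - x - y = - \<bar>x - y\<bar>\<close>
    yields the exponent.\<close>
  define B where "B d i = (if d \<le> ts i then sqrt (c * w d) * exp (- \<kappa> * ts i) else 0)" for d i
  have "(\<Sum>d\<in>?D. B d i * B d j) = c * exp (- \<kappa> * \<bar>ts j - ts i\<bar>)" for i j
  proof -
    let ?m = "min (ts i) (ts j)"
    have "(\<Sum>d\<in>?D. B d i * B d j) = (\<Sum>d\<in>{x\<in>?D. x \<le> ?m}. B d i * B d j)"
      by (rule sum.mono_neutral_right) (auto simp: B_def)
    also have "\<dots> = (\<Sum>d\<in>{x\<in>?D. x \<le> ?m}. c * exp (- \<kappa> * (ts i + ts j)) * w d)"
    proof (intro sum.cong refl)
      fix d assume "d \<in> {x\<in>?D. x \<le> ?m}"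
      then have "B d i * B d j = (sqrt (c * w d) * sqrt (c * w d)) * (exp (- \<kappa> * ts i) * exp (- \<kappa> * ts j))"
        by (simp add: B_def)
      also have "sqrt (c * w d) * sqrt (c * w d) = c * w d" using assms w(1) by simp
      also have "exp (- \<kappa> * ts i) * exp (- \<kappa> * ts j) = exp (- \<kappa> * (ts i + ts j))"
        by (simp add: exp_add[symmetric] algebra_simps)
      finally show "B d i * B d j = c * exp (- \<kappa> * (ts i + ts j)) * w d" by simp
    qed
    also have "\<dots> = c * exp (- \<kappa> * (ts i + ts j)) * exp (2 * \<kappa> * ?m)"
      by (subst sum_distrib_left[symmetric], subst w(2)) (auto simp: min_def)
    also have "\<dots> = c * exp (- \<kappa> * (ts i + ts j) + 2 * \<kappa> * ?m)"
      by (simp only: exp_add mult.assoc)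
    also have "- \<kappa> * (ts i + ts j) + 2 * \<kappa> * ?m = - \<kappa> * \<bar>ts j - ts i\<bar>"
      by (simp add: min_def abs_if algebra_simps)
    finally show ?thesis .
  qed
  then show ?thesis by (intro exI[of _ ?D] exI[of _ B]) simp
qed

section \<open>Exponential moments of Levy processes\<close>

text \<open>Lower boundedness near \<open>0\<close> replaces measurability in Cauchy's functional equation.\<close>

lemma additive_linear_of_bounded_below:
  fixes L :: "real \<Rightarrow> real"
  assumes add: "\<And>s t. 0 \<le> s \<Longrightarrow> 0 \<le> t \<Longrightarrow> L (s + t) = L s + L t"
    and "\<delta> > 0" and bnd: "\<And>t. 0 \<le> t \<Longrightarrow> t \<le> \<delta> \<Longrightarrow> - B \<le> L t"
    and "0 \<le> t"
  shows "L t = t * L 1"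
proof -
  define f where "f t = L t - t * L 1" for t
  have fadd: "f (s + t) = f s + f t" if "0 \<le> s" "0 \<le> t" for s t
    using add[OF that] by (simp add: f_def algebra_simps)
  have f0: "f 0 = 0" using fadd[of 0 0] by simp
  have fmult: "f (real n * s) = real n * f s" if "0 \<le> s" for n s
    by (induction n) (use that in \<open>auto simp: f0 fadd algebra_simps\<close>)
  obtain q :: nat where q: "q > 0" "1 / real q < \<delta>"
    using reals_Archimedean[OF \<open>\<delta> > 0\<close>] by (metis inverse_eq_divide zero_less_Suc)
  have fq: "f (1 / q) = 0"
    using fmult[of "1/q" q] q(1) by (simp add: f_def)
  \<comment> \<open>Since \<open>f\<close> vanishes at \<open>1 / q\<close>, it has period
    \<open>1 / q\<close> on the half-line, so the lower bound near \<open>0\<close> spreads to all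
    times.\<close>
  have low: "f s \<ge> - (B + \<bar>L 1\<bar> * \<delta>)" if "0 \<le> s" for s
  proof -
    define k where "k = nat \<lfloor>real q * s\<rfloor>"
    define r where "r = s - real k * (1 / real q)"
    have k: "real k \<le> real q * s" "real q * s < real k + 1"
      using that by (auto simp: k_def)
    have r: "0 \<le> r" "r \<le> \<delta>"
    proof -
      show "0 \<le> r" using k(1) q(1) by (simp add: r_def field_simps)
      have "s \<le> (real k + 1) / real q" using k(2) q(1) by (simp add: pos_le_divide_eq mult.commute)
      then have "r \<le> 1 / real q" by (simp add: r_def add_divide_distrib)
      then show "r \<le> \<delta>" using q(2) by simp
    qed
    have "f s = f (real k * (1 / real q) + r)" by (simp add: r_def)
    also have "\<dots> = f r" using fadd[of "real k * (1 / real q)" r] fmult[of "1/q" k] fq r by simp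
    also have "\<dots> \<ge> - B - r * L 1" using bnd[OF r] by (simp add: f_def)
    moreover have "r * L 1 \<le> \<delta> * \<bar>L 1\<bar>" 
      using mult_left_mono[OF abs_ge_self[of "L 1"] r(1)] mult_right_mono[OF r(2) abs_ge_zero[of "L 1"]] by linarith
    ultimately show ?thesis by (simp add: mult.commute)
  qed
  \<comment> \<open>A negative value of \<open>f\<close> could be multiplied by arbitrarily large
    integers, breaking the global lower bound.\<close>
  have nonneg: "f s \<ge> 0" if "0 \<le> s" for s
  proof (rule ccontr)
    assume "\<not> f s \<ge> 0"
    then have neg: "- f s > 0" by simp
    obtain n :: nat where "B + \<bar>L 1\<bar> * \<delta> < real n * (- f s)"
      using ex_less_of_nat_mult[OF neg] by blast
    then show False using low[of "real n * s"] fmult[OF that, of n] that by simp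
  qed
  \<comment> \<open>Integers are zeros of \<open>f\<close>, so \<open>f t\<close> and
    \<open>f (n - t)\<close> are two non-negative numbers with sum zero.\<close>
  obtain n :: nat where n: "t \<le> real n" using real_arch_simple by blast
  have "f t + f (real n - t) = f (real n * 1)" using fadd[of t "real n - t"] n \<open>0 \<le> t\<close> by simp
  also have "\<dots> = 0" using fmult[of 1 n] by (simp add: f_def)
  finally have "f t = 0" using nonneg[of t] nonneg[of "real n - t"] n \<open>0 \<le> t\<close> by linarith
  then show ?thesis by (simp add: f_def)
qed

text \<open>Exponential moments are assumed at time \<open>1\<close> only, where \<open>psi\<close>
  is read off; finiteness and the exact form at all other times are derived from the
  increments.\<close>

locale levy_mgf =
  fixes M :: "'a measure" and X :: "real \<Rightarrow> 'a \<Rightarrow> real"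
  assumes levy: "levy_process M X"
    and mgf_finite: "\<And>u. integrable M (\<lambda>\<omega>. exp (u * X 1 \<omega>))"
begin

sublocale prob_space M
  using levy by (simp add: levy_process_def)

lemma X_meas [measurable (raw)]: "0 \<le> t \<Longrightarrow> X t \<in> borel_measurable M"
  using levy by (simp add: levy_process_def)

lemma X_0: "\<omega> \<in> space M \<Longrightarrow> X 0 \<omega> = 0"
  using levy by (simp add: levy_process_def)

section \<open>Expectations over consecutive increments\<close>

lemma increment_distr:
  "0 \<le> s \<Longrightarrow> 0 \<le> h \<Longrightarrow> distr M borel (\<lambda>\<omega>. X (s + h) \<omega> - X s \<omega>) = distr M borel (X h)"
  using levy by (simp add: levy_process_def)

lemma increment_integral:
  fixes g :: "real \<Rightarrow> 'b::{banach, second_countable_topology}"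
  assumes "0 \<le> s" "0 \<le> h" and [measurable]: "g \<in> borel_measurable borel"
  shows "(\<integral>\<omega>. g (X (s + h) \<omega> - X s \<omega>) \<partial>M) = (\<integral>\<omega>. g (X h \<omega>) \<partial>M)"
    and "integrable M (\<lambda>\<omega>. g (X (s + h) \<omega> - X s \<omega>)) \<longleftrightarrow> integrable M (\<lambda>\<omega>. g (X h \<omega>))"
proof -
  have [measurable]: "X s \<in> borel_measurable M" "X h \<in> borel_measurable M" "X (s + h) \<in> borel_measurable M"
    using assms by (auto intro: X_meas)
  note d = increment_distr[OF assms(1,2)]
  have "(\<integral>\<omega>. g (X (s + h) \<omega> - X s \<omega>) \<partial>M) = (\<integral>x. g x \<partial>distr M borel (\<lambda>\<omega>. X (s + h) \<omega> - X s \<omega>))"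
    by (subst integral_distr) auto
  also have "\<dots> = (\<integral>\<omega>. g (X h \<omega>) \<partial>M)"
    unfolding d by (subst integral_distr) auto
  finally show "(\<integral>\<omega>. g (X (s + h) \<omega> - X s \<omega>) \<partial>M) = (\<integral>\<omega>. g (X h \<omega>) \<partial>M)" .
  have "integrable M (\<lambda>\<omega>. g (X (s + h) \<omega> - X s \<omega>)) \<longleftrightarrow> integrable (distr M borel (\<lambda>\<omega>. X (s + h) \<omega> - X s \<omega>)) g"
    by (subst integrable_distr_eq) auto
  also have "\<dots> \<longleftrightarrow> integrable M (\<lambda>\<omega>. g (X h \<omega>))"
    unfolding d by (subst integrable_distr_eq) auto
  finally show "integrable M (\<lambda>\<omega>. g (X (s + h) \<omega> - X s \<omega>)) \<longleftrightarrow> integrable M (\<lambda>\<omega>. g (X h \<omega>))" .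
qed

lemma increments_indep:
  "0 \<le> t 0 \<Longrightarrow> (\<And>k. k < n \<Longrightarrow> t k < t (Suc k)) \<Longrightarrow>
    indep_vars (\<lambda>_. borel) (\<lambda>k \<omega>. X (t (Suc k)) \<omega> - X (t k) \<omega>) {..<n}"
  for t :: "nat \<Rightarrow> real"
  using levy by (simp add: levy_process_def)

text \<open>Independence is available for strictly increasing time grids, so vanishing gaps are
  treated separately: the corresponding factor is then constant. The value type is general so that
  real moments and complex characters are both covered.\<close>

lemma increments_integral_prod2:
  fixes f g :: "real \<Rightarrow> 'b::{real_normed_field, banach, second_countable_topology}"
  assumes r: "0 \<le> r" and h: "0 \<le> h"
    and [measurable]: "f \<in> borel_measurable borel" "g \<in> borel_measurable borel"
    and int: "integrable M (\<lambda>\<omega>. f (X r \<omega>))" "integrable M (\<lambda>\<omega>. g (X h \<omega>))"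
  shows "integrable M (\<lambda>\<omega>. f (X r \<omega>) * g (X (r + h) \<omega> - X r \<omega>))" (is ?I)
    and "(\<integral>\<omega>. f (X r \<omega>) * g (X (r + h) \<omega> - X r \<omega>) \<partial>M) = (\<integral>\<omega>. f (X r \<omega>) \<partial>M) * (\<integral>\<omega>. g (X h \<omega>) \<partial>M)" (is ?E)
proof -
  consider "r = 0" | "h = 0" | "r > 0" "h > 0" using r h by linarith
  then have "?I \<and> ?E"
  proof cases
    case 1
    have "?I \<longleftrightarrow> integrable M (\<lambda>\<omega>. f 0 * g (X h \<omega>))"
      using 1 by (intro Bochner_Integration.integrable_cong) (auto simp: X_0)
    moreover have "(\<integral>\<omega>. f (X r \<omega>) * g (X (r + h) \<omega> - X r \<omega>) \<partial>M) = (\<integral>\<omega>. f 0 * g (X h \<omega>) \<partial>M)"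
      using 1 by (intro Bochner_Integration.integral_cong) (auto simp: X_0)
    moreover have "(\<integral>\<omega>. f (X r \<omega>) \<partial>M) = (\<integral>\<omega>. f 0 \<partial>M)"
      using 1 by (intro Bochner_Integration.integral_cong) (auto simp: X_0)
    ultimately show ?thesis using int by (simp add: prob_space)
  next
    case 2
    have "(\<integral>\<omega>. g (X h \<omega>) \<partial>M) = (\<integral>\<omega>. g 0 \<partial>M)"
      using 2 by (intro Bochner_Integration.integral_cong) (auto simp: X_0)
    then show ?thesis using 2 int by (simp add: prob_space)
  next
    case 3
    define t :: "nat \<Rightarrow> real" where "t k = (if k = 0 then 0 else if k = 1 then r else r + h)" for k
    define Y where "Y k = (if k = 0 then f else g)" for k :: nat
    have "indep_vars (\<lambda>_. borel) (\<lambda>k \<omega>. X (t (Suc k)) \<omega> - X (t k) \<omega>) {..<2}"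
      using 3 by (intro increments_indep) (auto simp: t_def)
    then have ind: "indep_vars (\<lambda>_. borel) (\<lambda>k \<omega>. Y k (X (t (Suc k)) \<omega> - X (t k) \<omega>)) {..<2}"
      by (rule indep_vars_compose2) (auto simp: Y_def)
    have [simp]: "(\<integral>\<omega>. f (X r \<omega> - X 0 \<omega>) \<partial>M) = (\<integral>\<omega>. f (X r \<omega>) \<partial>M)"
      "integrable M (\<lambda>\<omega>. f (X r \<omega> - X 0 \<omega>)) \<longleftrightarrow> integrable M (\<lambda>\<omega>. f (X r \<omega>))"
      using increment_integral[of 0 r f] r by auto
    note incr = increment_integral[OF r h, of g]
    have i: "integrable M (\<lambda>\<omega>. Y k (X (t (Suc k)) \<omega> - X (t k) \<omega>))" if "k \<in> {..<2}" for k
      using that int incr by (auto simp: Y_def t_def less_2_cases_iff)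
    have "integrable M (\<lambda>\<omega>. f (X r \<omega> - X 0 \<omega>) * g (X (r + h) \<omega> - X r \<omega>))"
      using indep_vars_integrable[OF _ ind i] by (simp add: numeral_2_eq_2 lessThan_Suc Y_def t_def mult.commute)
    then have ?I
      by (rule Bochner_Integration.integrable_cong[THEN iffD1, rotated -1]) (auto simp: X_0)
    have "(\<integral>\<omega>. f (X r \<omega>) * g (X (r + h) \<omega> - X r \<omega>) \<partial>M) = (\<integral>\<omega>. f (X r \<omega> - X 0 \<omega>) * g (X (r + h) \<omega> - X r \<omega>) \<partial>M)"
      by (intro Bochner_Integration.integral_cong) (auto simp: X_0)
    also have "\<dots> = (\<integral>\<omega>. f (X r \<omega>) \<partial>M) * (\<integral>\<omega>. g (X h \<omega>) \<partial>M)"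
      using indep_vars_lebesgue_integral[OF _ ind i] incr
      by (simp add: numeral_2_eq_2 lessThan_Suc Y_def t_def mult.commute)
    finally show ?thesis using \<open>?I\<close> by blast
  qed
  then show ?I ?E by auto
qed

text \<open>Three factors are what a mixed moment at two observation times requires: the value at
  the earliest time, the growth up to the first of the two, and the growth from there to the second.
  A vanishing gap reduces to two factors.\<close>

lemma increments_integral_prod3:
  fixes f g k :: "real \<Rightarrow> 'b::{real_normed_field, banach, second_countable_topology}"
  assumes r: "0 \<le> r" and h: "0 \<le> h" and l: "0 \<le> l"
    and [measurable]: "f \<in> borel_measurable borel" "g \<in> borel_measurable borel" "k \<in> borel_measurable borel"
    and int: "integrable M (\<lambda>\<omega>. f (X r \<omega>))" "integrable M (\<lambda>\<omega>. g (X h \<omega>))" "integrable M (\<lambda>\<omega>. k (X l \<omega>))"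
  shows "integrable M (\<lambda>\<omega>. f (X r \<omega>) * g (X (r + h) \<omega> - X r \<omega>) * k (X (r + h + l) \<omega> - X (r + h) \<omega>))" (is ?I)
    and "(\<integral>\<omega>. f (X r \<omega>) * g (X (r + h) \<omega> - X r \<omega>) * k (X (r + h + l) \<omega> - X (r + h) \<omega>) \<partial>M) =
      (\<integral>\<omega>. f (X r \<omega>) \<partial>M) * (\<integral>\<omega>. g (X h \<omega>) \<partial>M) * (\<integral>\<omega>. k (X l \<omega>) \<partial>M)" (is ?E)
proof -
  consider "r = 0" | "h = 0" | "l = 0" | "r > 0" "h > 0" "l > 0" using r h l by linarith
  then have "?I \<and> ?E"
  proof cases
    case 1
    note p2 = increments_integral_prod2[OF h l, of g k]
    have eq: "f (X r \<omega>) * g (X (r + h) \<omega> - X r \<omega>) * k (X (r + h + l) \<omega> - X (r + h) \<omega>) =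
        f 0 * (g (X h \<omega>) * k (X (h + l) \<omega> - X h \<omega>))" if "\<omega> \<in> space M" for \<omega>
      using 1 that by (simp add: X_0)
    have "?I \<longleftrightarrow> integrable M (\<lambda>\<omega>. f 0 * (g (X h \<omega>) * k (X (h + l) \<omega> - X h \<omega>)))"
      by (intro Bochner_Integration.integrable_cong refl eq)
    moreover have "(\<integral>\<omega>. f (X r \<omega>) * g (X (r + h) \<omega> - X r \<omega>) * k (X (r + h + l) \<omega> - X (r + h) \<omega>) \<partial>M)
      = (\<integral>\<omega>. f 0 * (g (X h \<omega>) * k (X (h + l) \<omega> - X h \<omega>)) \<partial>M)"
      by (intro Bochner_Integration.integral_cong refl eq)
    moreover have "(\<integral>\<omega>. f (X r \<omega>) \<partial>M) = (\<integral>\<omega>. f 0 \<partial>M)"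
      using 1 by (intro Bochner_Integration.integral_cong) (auto simp: X_0)
    ultimately show ?thesis using int p2 by (simp add: prob_space)
  next
    case 2
    have "(\<integral>\<omega>. g (X h \<omega>) \<partial>M) = (\<integral>\<omega>. g 0 \<partial>M)"
      using 2 by (intro Bochner_Integration.integral_cong) (auto simp: X_0)
    moreover note increments_integral_prod2[OF r l, of f k]
    moreover have "(\<lambda>\<omega>. f (X r \<omega>) * g (X (r + h) \<omega> - X r \<omega>) * k (X (r + h + l) \<omega> - X (r + h) \<omega>)) =
        (\<lambda>\<omega>. g 0 * (f (X r \<omega>) * k (X (r + l) \<omega> - X r \<omega>)))"
      using 2 by (simp add: mult_ac)
    ultimately show ?thesis using int by (simp add: prob_space mult_ac)
  next
    case 3
    have "(\<integral>\<omega>. k (X l \<omega>) \<partial>M) = (\<integral>\<omega>. k 0 \<partial>M)"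
      using 3 by (intro Bochner_Integration.integral_cong) (auto simp: X_0)
    moreover note increments_integral_prod2[OF r h, of f g]
    ultimately show ?thesis using 3 int by (simp add: prob_space)
  next
    case 4
    define t :: "nat \<Rightarrow> real" where "t k = (if k = 0 then 0 else if k = 1 then r else if k = 2 then r + h else r + h + l)" for k
    define Y where "Y i = (if i = 0 then f else if i = 1 then g else k)" for i :: nat
    have "indep_vars (\<lambda>_. borel) (\<lambda>k \<omega>. X (t (Suc k)) \<omega> - X (t k) \<omega>) {..<3}"
      using 4 by (intro increments_indep) (auto simp: t_def)
    then have ind: "indep_vars (\<lambda>_. borel) (\<lambda>k \<omega>. Y k (X (t (Suc k)) \<omega> - X (t k) \<omega>)) {..<3}"
      by (rule indep_vars_compose2) (auto simp: Y_def)
    have [simp]: "(\<integral>\<omega>. f (X r \<omega> - X 0 \<omega>) \<partial>M) = (\<integral>\<omega>. f (X r \<omega>) \<partial>M)"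
      "integrable M (\<lambda>\<omega>. f (X r \<omega> - X 0 \<omega>)) \<longleftrightarrow> integrable M (\<lambda>\<omega>. f (X r \<omega>))"
      using increment_integral[of 0 r f] r by auto
    note incr = increment_integral[OF r h, of g] increment_integral[of "r + h" l k]
    have three: "i \<in> {..<3} \<longleftrightarrow> i = 0 \<or> i = 1 \<or> i = 2" for i :: nat by auto
    have i: "integrable M (\<lambda>\<omega>. Y i (X (t (Suc i)) \<omega> - X (t i) \<omega>))" if "i \<in> {..<3}" for i
      using that int incr r h l unfolding three by (auto simp: Y_def t_def)
    have prod3: "(\<Prod>i<3. F i) = F 0 * F 1 * F 2" for F :: "nat \<Rightarrow> 'b"
      by (simp add: numeral_3_eq_3 lessThan_Suc mult_ac numeral_2_eq_2)
    have "integrable M (\<lambda>\<omega>. f (X r \<omega> - X 0 \<omega>) * g (X (r + h) \<omega> - X r \<omega>) * k (X (r + h + l) \<omega> - X (r + h) \<omega>))"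
      using indep_vars_integrable[OF _ ind i] unfolding prod3 by (simp add: Y_def t_def)
    then have ?I
      by (rule Bochner_Integration.integrable_cong[THEN iffD1, rotated -1]) (auto simp: X_0)
    have "(\<integral>\<omega>. f (X r \<omega>) * g (X (r + h) \<omega> - X r \<omega>) * k (X (r + h + l) \<omega> - X (r + h) \<omega>) \<partial>M) =
       (\<integral>\<omega>. f (X r \<omega> - X 0 \<omega>) * g (X (r + h) \<omega> - X r \<omega>) * k (X (r + h + l) \<omega> - X (r + h) \<omega>) \<partial>M)"
      by (intro Bochner_Integration.integral_cong) (auto simp: X_0)
    also have "\<dots> = (\<integral>\<omega>. f (X r \<omega>) \<partial>M) * (\<integral>\<omega>. g (X h \<omega>) \<partial>M) * (\<integral>\<omega>. k (X l \<omega>) \<partial>M)"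
      using indep_vars_lebesgue_integral[OF _ ind i] incr r h l
      unfolding prod3 by (simp add: Y_def t_def)
    finally show ?thesis using \<open>?I\<close> by blast
  qed
  then show ?I ?E by auto
qed

text \<open>Independence factors the moment at time \<open>1\<close> into those of the increments
  over \<open>[0, t]\<close> and \<open>[t, 1]\<close>. Working in \<open>[0, \<infinity>]\<close>
  allows this before integrability is known: a finite product with a nonzero second factor has a
  finite first factor.\<close>

lemma integrable_exp_unit:
  assumes t: "0 < t" "t < 1"
  shows "integrable M (\<lambda>\<omega>. exp (u * X t \<omega>))"
proof -
  define T :: "nat \<Rightarrow> real" where "T k = (if k = 0 then 0 else if k = 1 then t else 1)" for k
  have [measurable]: "X t \<in> borel_measurable M" "X 1 \<in> borel_measurable M" "X 0 \<in> borel_measurable M"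
    using t by (auto intro: X_meas)
  have "indep_vars (\<lambda>_. borel) (\<lambda>k \<omega>. X (T (Suc k)) \<omega> - X (T k) \<omega>) {..<2}"
    using t by (intro increments_indep) (auto simp: T_def)
  then have ind: "indep_vars (\<lambda>_. borel) (\<lambda>k \<omega>. ennreal (exp (u * (X (T (Suc k)) \<omega> - X (T k) \<omega>)))) {..<2}"
    by (rule indep_vars_compose2) auto
  let ?I = "\<lambda>Y. \<integral>\<^sup>+\<omega>. ennreal (exp (u * Y \<omega>)) \<partial>M"
  have pos: "?I Y \<noteq> 0" if [measurable]: "Y \<in> borel_measurable M" for Y
  proof
    assume "?I Y = 0"
    then have "AE \<omega> in M. False" by (subst (asm) nn_integral_0_iff_AE) auto
    then show False by (simp add: AE_False emeasure_space_1)
  qed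
  have "?I (\<lambda>\<omega>. X t \<omega> - X 0 \<omega>) * ?I (\<lambda>\<omega>. X 1 \<omega> - X t \<omega>) =
     (\<integral>\<^sup>+\<omega>. ennreal (exp (u * (X t \<omega> - X 0 \<omega>))) * ennreal (exp (u * (X 1 \<omega> - X t \<omega>))) \<partial>M)"
    using indep_vars_nn_integral[OF _ ind] by (simp add: numeral_2_eq_2 lessThan_Suc T_def mult.commute)
  also have "\<dots> = ?I (X 1)"
    by (intro nn_integral_cong) (auto simp: X_0 ennreal_mult'[symmetric] exp_add[symmetric] algebra_simps)
  also have "\<dots> < \<infinity>"
    using mgf_finite[of u] by (auto simp: integrable_iff_bounded)
  finally have "?I (\<lambda>\<omega>. X t \<omega> - X 0 \<omega>) * ?I (\<lambda>\<omega>. X 1 \<omega> - X t \<omega>) < \<infinity>" .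
  moreover have posX: "?I (\<lambda>\<omega>. X 1 \<omega> - X t \<omega>) \<noteq> 0" by (rule pos) measurable
  ultimately have "?I (\<lambda>\<omega>. X t \<omega> - X 0 \<omega>) < \<infinity>"
    using posX
    by (metis ennreal_mult_eq_top_iff infinity_ennreal_def less_top)
  moreover have "?I (\<lambda>\<omega>. X t \<omega> - X 0 \<omega>) = ?I (X t)"
    by (intro nn_integral_cong) (auto simp: X_0)
  ultimately show ?thesis by (auto simp: integrable_iff_bounded)
qed

lemma integrable_exp:
  assumes "0 \<le> t"
  shows "integrable M (\<lambda>\<omega>. exp (u * X t \<omega>))"
proof -
  have "\<forall>t. 0 \<le> t \<and> t \<le> real n \<longrightarrow> integrable M (\<lambda>\<omega>. exp (u * X t \<omega>))" for n
  proof (induction n)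
    case 0
    have "integrable M (\<lambda>\<omega>. exp (u * X 0 \<omega>)) \<longleftrightarrow> integrable M (\<lambda>\<omega>. exp (u * 0))"
      by (intro Bochner_Integration.integrable_cong) (auto simp: X_0)
    then show ?case by auto
  next
    case (Suc n)
    show ?case
    proof (intro allI impI)
      fix t assume t: "0 \<le> t \<and> t \<le> real (Suc n)"
      consider "t = 0" | "0 < t" "t < 1" | "t \<ge> 1" using t by linarith
      then show "integrable M (\<lambda>\<omega>. exp (u * X t \<omega>))"
      proof cases
        case 1 then show ?thesis using Suc by simp
      next
        case 2 then show ?thesis by (rule integrable_exp_unit)
      next
        case 3
        then have "integrable M (\<lambda>\<omega>. exp (u * X (t - 1) \<omega>))" using Suc t by auto
        then have "integrable M (\<lambda>\<omega>. exp (u * X 1 \<omega>) * exp (u * (X (1 + (t - 1)) \<omega> - X 1 \<omega>)))"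
          using 3 mgf_finite[of u] by (intro increments_integral_prod2(1)[of 1 "t - 1" "\<lambda>x. exp (u * x)" "\<lambda>x. exp (u * x)"]) auto
        then show ?thesis by (simp add: exp_add[symmetric] algebra_simps)
      qed
    qed
  qed
  then show ?thesis using assms real_arch_simple[of t] by blast
qed

text \<open>A complex exponent covers two objects with one multiplicativity law: the moment
  generating function for real \<open>z\<close>, and tilted characteristic functions for
  \<open>z = p + i w\<close>.\<close>

definition cmgf :: "complex \<Rightarrow> real \<Rightarrow> complex" where
  "cmgf z t = (\<integral>\<omega>. exp (z * of_real (X t \<omega>)) \<partial>M)"

lemma integrable_cexp:
  assumes "0 \<le> t"
  shows "integrable M (\<lambda>\<omega>. exp (z * complex_of_real (X t \<omega>)))"
proof (rule Bochner_Integration.integrable_bound[OF integrable_exp[OF assms, of "Re z"]])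
  have [measurable]: "X t \<in> borel_measurable M" using assms by (rule X_meas)
  show "(\<lambda>\<omega>. exp (z * complex_of_real (X t \<omega>))) \<in> borel_measurable M" by measurable
qed auto

lemma cmgf_add:
  assumes "0 \<le> s" "0 \<le> t"
  shows "cmgf z (s + t) = cmgf z s * cmgf z t"
proof -
  have "cmgf z s * cmgf z t = (\<integral>\<omega>. exp (z * of_real (X s \<omega>)) * exp (z * of_real (X (s + t) \<omega> - X s \<omega>)) \<partial>M)"
    unfolding cmgf_def using assms
    by (intro increments_integral_prod2(2)[symmetric, where f = "\<lambda>x. exp (z * of_real x)" and g = "\<lambda>x. exp (z * of_real x)"] integrable_cexp) auto
  also have "\<dots> = cmgf z (s + t)"
    unfolding cmgf_def by (simp add: exp_add[symmetric] algebra_simps)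
  finally show ?thesis ..
qed

lemma cmgf_0: "cmgf z 0 = 1"
proof -
  have "cmgf z 0 = (\<integral>\<omega>. 1 \<partial>M)"
    unfolding cmgf_def by (intro Bochner_Integration.integral_cong) (auto simp: X_0)
  then show ?thesis by (simp add: prob_space)
qed

lemma cmgf_of_real:
  assumes "0 \<le> t"
  shows "cmgf (of_real u) t = of_real (\<integral>\<omega>. exp (u * X t \<omega>) \<partial>M)"
proof -
  have "cmgf (of_real u) t = (\<integral>\<omega>. of_real (exp (u * X t \<omega>)) \<partial>M)"
    unfolding cmgf_def by (simp add: exp_of_real[symmetric])
  then show ?thesis by simp
qed

lemma mgf_pos:
  assumes "0 \<le> t"
  shows "(\<integral>\<omega>. exp (u * X t \<omega>) \<partial>M) > 0"
proof -
  have "(\<integral>\<omega>. exp (u * X t \<omega>) \<partial>M) \<noteq> 0"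
  proof
    assume "(\<integral>\<omega>. exp (u * X t \<omega>) \<partial>M) = 0"
    then have "AE \<omega> in M. False"
      using integral_nonneg_eq_0_iff_AE[OF integrable_exp[OF assms]] by auto
    then show False by (simp add: AE_False emeasure_space_1)
  qed
  then show ?thesis by (simp add: order_less_le)
qed

definition psi :: "real \<Rightarrow> real" where
  "psi u = ln (\<integral>\<omega>. exp (u * X 1 \<omega>) \<partial>M)"

text \<open>Right-continuity at \<open>0\<close> gives convergence of the truncated exponentials
  \<open>min 1 (exp (u * X t))\<close> by bounded convergence. Truncation loses the upper bound, but
  a lower bound is all that linearity requires; \<open>exp (-1)\<close> stands for any constant
  strictly between \<open>0\<close> and \<open>1\<close>.\<close>

lemma mgf_lower_bound_near_0: "\<exists>\<delta>>0. \<forall>t. 0 \<le> t \<and> t \<le> \<delta> \<longrightarrow> exp (-1) \<le> (\<integral>\<omega>. exp (u * X t \<omega>) \<partial>M)"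
proof (rule ccontr)
  assume "\<not> ?thesis"
  then have neg: "\<exists>t. 0 \<le> t \<and> t \<le> \<delta> \<and> (\<integral>\<omega>. exp (u * X t \<omega>) \<partial>M) < exp (-1)" if "\<delta> > 0" for \<delta>
    using that by (auto simp: not_le)
  have "\<forall>n. \<exists>t. 0 \<le> t \<and> t \<le> inverse (real (Suc n)) \<and> (\<integral>\<omega>. exp (u * X t \<omega>) \<partial>M) < exp (-1)"
    using neg by simp
  then obtain t where t: "\<And>n. 0 \<le> t n" "\<And>n. t n \<le> inverse (real (Suc n))"
    "\<And>n. (\<integral>\<omega>. exp (u * X (t n) \<omega>) \<partial>M) < exp (-1)" by metis
  \<comment> \<open>At time \<open>0\<close> the moment is \<open>1 > exp (-1)\<close>, so the
    offending times are strictly positive and approach \<open>0\<close> from the right, where the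
    paths are continuous.\<close>
  have "(\<integral>\<omega>. exp (u * X 0 \<omega>) \<partial>M) = (\<integral>\<omega>. exp (u * 0) \<partial>M)"
    by (intro Bochner_Integration.integral_cong) (auto simp: X_0)
  then have t0: "t n \<noteq> 0" for n using t(3)[of n] by (auto simp: prob_space)
  have "t \<longlonglongrightarrow> 0"
    by (rule tendsto_sandwich[OF _ _ tendsto_const LIMSEQ_inverse_real_of_nat]) (use t in auto)
  then have t_lim: "filterlim t (at_right 0) sequentially"
    using t(1) t0 by (auto simp: filterlim_at order_less_le)
  have [measurable]: "X (t n) \<in> borel_measurable M" for n using t(1) by (rule X_meas)
  have lim: "(\<lambda>n. \<integral>\<omega>. min 1 (exp (u * X (t n) \<omega>)) \<partial>M) \<longlonglongrightarrow> (\<integral>\<omega>. 1 \<partial>M)"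
  proof (rule integral_dominated_convergence[where w = "\<lambda>_. 1"])
    show "AE \<omega> in M. (\<lambda>n. min 1 (exp (u * X (t n) \<omega>))) \<longlonglongrightarrow> 1"
    proof (rule AE_I2)
      fix \<omega> assume \<omega>: "\<omega> \<in> space M"
      have "continuous (at_right 0) (\<lambda>s. X s \<omega>)"
        using levy \<omega> by (simp add: levy_process_def)
      then have "((\<lambda>s. X s \<omega>) \<longlongrightarrow> 0) (at_right 0)"
        using X_0[OF \<omega>] by (simp add: continuous_within)
      from filterlim_compose[OF this t_lim] have "(\<lambda>n. X (t n) \<omega>) \<longlonglongrightarrow> 0" .
      then have "(\<lambda>n. min 1 (exp (u * X (t n) \<omega>))) \<longlonglongrightarrow> min 1 (exp (u * 0))"
        by (intro tendsto_intros)
      then show "(\<lambda>n. min 1 (exp (u * X (t n) \<omega>))) \<longlonglongrightarrow> 1" by simp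
    qed
  qed (auto simp: min_def)
  have "(\<integral>\<omega>. min 1 (exp (u * X (t n) \<omega>)) \<partial>M) \<le> exp (-1)" for n
  proof -
    have "(\<integral>\<omega>. min 1 (exp (u * X (t n) \<omega>)) \<partial>M) \<le> (\<integral>\<omega>. exp (u * X (t n) \<omega>) \<partial>M)"
      by (intro integral_mono' integrable_exp t) auto
    with t(3)[of n] show ?thesis by simp
  qed
  then have "(\<integral>\<omega>. 1 \<partial>M) \<le> exp (-1::real)"
    by (intro LIMSEQ_le_const2[OF lim]) auto
  then have "1 \<le> exp (-1::real)" by (simp add: prob_space)
  then show False by simp
qed

text \<open>Independent stationary increments make the logarithm of the moment additive in time; the
  bound near \<open>0\<close> then forces it to be linear.\<close>

lemma mgf_eq:
  assumes "0 \<le> t"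
  shows "(\<integral>\<omega>. exp (u * X t \<omega>) \<partial>M) = exp (t * psi u)"
proof -
  define L where "L t = ln (\<integral>\<omega>. exp (u * X t \<omega>) \<partial>M)" for t
  obtain \<delta> where \<delta>: "\<delta> > 0" "\<And>t. 0 \<le> t \<Longrightarrow> t \<le> \<delta> \<Longrightarrow> exp (-1) \<le> (\<integral>\<omega>. exp (u * X t \<omega>) \<partial>M)"
    using mgf_lower_bound_near_0[of u] by blast
  have "L t = t * L 1"
  proof (rule additive_linear_of_bounded_below[OF _ \<delta>(1) _ assms])
    show "L (s + t) = L s + L t" if "0 \<le> s" "0 \<le> t" for s t
    proof -
      have "(\<integral>\<omega>. exp (u * X (s + t) \<omega>) \<partial>M) = (\<integral>\<omega>. exp (u * X s \<omega>) \<partial>M) * (\<integral>\<omega>. exp (u * X t \<omega>) \<partial>M)"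
        using cmgf_add[OF that, of "of_real u"] that
        by (simp add: cmgf_of_real del: of_real_mult add: of_real_mult[symmetric])
      then show ?thesis
        using mgf_pos[OF that(1), of u] mgf_pos[OF that(2), of u] by (simp add: L_def ln_mult)
    qed
    show "- 1 \<le> L t" if "0 \<le> t" "t \<le> \<delta>" for t
      using \<delta>(2)[OF that] mgf_pos[OF that(1), of u] by (simp add: L_def ln_ge_iff)
  qed
  then have "exp (ln (\<integral>\<omega>. exp (u * X t \<omega>) \<partial>M)) = exp (t * psi u)"
    by (simp add: L_def psi_def)
  then show ?thesis using mgf_pos[OF assms, of u] by simp
qed

end

section \<open>Cumulants and remainders of the exponential\<close>

lemma norm_integral_le:
  fixes f :: "'a \<Rightarrow> 'b::{banach, second_countable_topology}"
  assumes "integrable M g" "\<And>x. x \<in> space M \<Longrightarrow> norm (f x) \<le> g x"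
  shows "norm (\<integral>x. f x \<partial>M) \<le> (\<integral>x. g x \<partial>M)"
proof -
  have "norm (\<integral>x. f x \<partial>M) \<le> (\<integral>x. norm (f x) \<partial>M)" by (rule integral_norm_bound)
  also have "\<dots> \<le> (\<integral>x. g x \<partial>M)"
    using assms by (intro integral_mono') (auto intro: order_trans[OF norm_ge_zero])
  finally show ?thesis .
qed

lemma power_le_fact_exp:
  assumes "0 \<le> (x::real)"
  shows "x ^ k \<le> fact k * exp x"
proof -
  have "(\<Sum>n\<in>{k}. x ^ n /\<^sub>R fact n) \<le> exp x"
    unfolding exp_def using assms by (intro sum_le_suminf summable_exp_generic) auto
  then show ?thesis by (simp add: field_simps)
qed

text \<open>The extra factor \<open>exp \<bar>X\<bar>\<close> dominates the second-order Taylor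
  remainder of \<open>exp (h * X)\<close> uniformly for \<open>\<bar>h\<bar> < 1\<close>. The power
  costs another such factor, and \<open>exp (2 * \<bar>x\<bar>)\<close> is at most
  \<open>exp (2 * x) + exp (- 2 * x)\<close>, which shifts \<open>u\<close> by two in either
  direction.\<close>

lemma integrable_power_exp_abs:
  fixes X :: "'a \<Rightarrow> real"
  assumes [measurable]: "X \<in> borel_measurable M"
    and int: "\<And>u. integrable M (\<lambda>\<omega>. exp (u * X \<omega>))"
  shows "integrable M (\<lambda>\<omega>. \<bar>X \<omega>\<bar> ^ k * exp (u * X \<omega> + \<bar>X \<omega>\<bar>))"
proof (rule Bochner_Integration.integrable_bound)
  show "integrable M (\<lambda>\<omega>. fact k * (exp ((u + 2) * X \<omega>) + exp ((u - 2) * X \<omega>)))"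
    by (intro integrable_mult_right Bochner_Integration.integrable_add int)
  show "AE \<omega> in M. norm (\<bar>X \<omega>\<bar> ^ k * exp (u * X \<omega> + \<bar>X \<omega>\<bar>))
      \<le> norm (fact k * (exp ((u + 2) * X \<omega>) + exp ((u - 2) * X \<omega>)) :: real)"
  proof (rule AE_I2)
    fix \<omega>
    have "\<bar>X \<omega>\<bar> ^ k * exp (u * X \<omega> + \<bar>X \<omega>\<bar>) \<le> (fact k * exp \<bar>X \<omega>\<bar>) * exp (u * X \<omega> + \<bar>X \<omega>\<bar>)"
      by (intro mult_right_mono power_le_fact_exp) auto
    also have "\<dots> = fact k * exp (u * X \<omega> + 2 * \<bar>X \<omega>\<bar>)"
      by (simp add: exp_add[symmetric] algebra_simps)
    also have "\<dots> \<le> fact k * (exp ((u + 2) * X \<omega>) + exp ((u - 2) * X \<omega>))"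
      by (cases "X \<omega> \<ge> 0") (auto simp: algebra_simps)
    finally show "norm (\<bar>X \<omega>\<bar> ^ k * exp (u * X \<omega> + \<bar>X \<omega>\<bar>))
      \<le> norm (fact k * (exp ((u + 2) * X \<omega>) + exp ((u - 2) * X \<omega>)) :: real)"
      by (simp add: abs_mult)
  qed
qed measurable

lemma integrable_power_exp:
  fixes X :: "'a \<Rightarrow> real"
  assumes [measurable]: "X \<in> borel_measurable M"
    and int: "\<And>u. integrable M (\<lambda>\<omega>. exp (u * X \<omega>))"
  shows "integrable M (\<lambda>\<omega>. X \<omega> ^ k * exp (u * X \<omega>))"
  by (rule Bochner_Integration.integrable_bound[OF integrable_power_exp_abs[OF assms, of k u]])
     (auto simp: abs_mult power_abs intro!: mult_left_mono)

section \<open>Differentiation of exponential moments and cumulants\<close>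

lemma abs_exp_minus_linear_le: "\<bar>exp y - 1 - y\<bar> \<le> y\<^sup>2 * exp \<bar>y\<bar>" for y :: real
  using Taylor_exp_field[of y 1] by (simp add: power2_eq_square mult.commute diff_diff_eq)

text \<open>Differentiation under the integral with an explicit rate: the second-order Taylor bound
  shows that the difference quotient misses its limit by at most \<open>K * \<bar>h\<bar>\<close>.
  Keeping the power \<open>k\<close> free lets the same statement yield both derivatives of the
  cumulant function.\<close>

lemma has_real_derivative_mgf:
  fixes X :: "'a \<Rightarrow> real"
  assumes [measurable]: "X \<in> borel_measurable M"
    and int: "\<And>u. integrable M (\<lambda>\<omega>. exp (u * X \<omega>))"
  shows "((\<lambda>u. \<integral>\<omega>. X \<omega> ^ k * exp (u * X \<omega>) \<partial>M) has_real_derivative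
    (\<integral>\<omega>. X \<omega> ^ Suc k * exp (u * X \<omega>) \<partial>M)) (at u)"
proof -
  let ?f = "\<lambda>k u. \<integral>\<omega>. X \<omega> ^ k * exp (u * X \<omega>) \<partial>M"
  define K where "K = (\<integral>\<omega>. \<bar>X \<omega>\<bar> ^ (k + 2) * exp (u * X \<omega> + \<bar>X \<omega>\<bar>) \<partial>M)"
  note I = integrable_power_exp[OF assms]
  have "\<bar>(?f k (u + h) - ?f k u) / h - ?f (Suc k) u\<bar> \<le> K * \<bar>h\<bar>" if h: "h \<noteq> 0" "\<bar>h\<bar> < 1" for h
  proof -
    have "\<bar>?f k (u + h) - ?f k u - h * ?f (Suc k) u\<bar> =
      \<bar>\<integral>\<omega>. X \<omega> ^ k * exp ((u + h) * X \<omega>) - X \<omega> ^ k * exp (u * X \<omega>) - h * (X \<omega> ^ Suc k * exp (u * X \<omega>)) \<partial>M\<bar>"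
      using I[of k "u + h"] I[of k u] I[of "Suc k" u] by simp
    also have "\<dots> \<le> (\<integral>\<omega>. h\<^sup>2 * (\<bar>X \<omega>\<bar> ^ (k + 2) * exp (u * X \<omega> + \<bar>X \<omega>\<bar>)) \<partial>M)"
    proof (rule norm_integral_le[where 'b=real, unfolded real_norm_def])
      fix \<omega>
      have "X \<omega> ^ k * exp ((u + h) * X \<omega>) - X \<omega> ^ k * exp (u * X \<omega>) - h * (X \<omega> ^ Suc k * exp (u * X \<omega>)) =
         X \<omega> ^ k * exp (u * X \<omega>) * (exp (h * X \<omega>) - 1 - h * X \<omega>)"
        by (simp add: exp_add algebra_simps)
      also have "\<bar>\<dots>\<bar> = \<bar>X \<omega>\<bar> ^ k * exp (u * X \<omega>) * \<bar>exp (h * X \<omega>) - 1 - h * X \<omega>\<bar>"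
        by (simp add: abs_mult power_abs)
      also have "\<dots> \<le> \<bar>X \<omega>\<bar> ^ k * exp (u * X \<omega>) * ((h * X \<omega>)\<^sup>2 * exp \<bar>X \<omega>\<bar>)"
      proof (intro mult_left_mono order_trans[OF abs_exp_minus_linear_le])
        have "\<bar>h * X \<omega>\<bar> \<le> \<bar>X \<omega>\<bar>"
          using h(2) mult_right_mono[of "\<bar>h\<bar>" 1 "\<bar>X \<omega>\<bar>"] by (simp add: abs_mult)
        then show "exp \<bar>h * X \<omega>\<bar> \<le> exp \<bar>X \<omega>\<bar>" by simp
      qed auto
      also have "\<dots> = h\<^sup>2 * (\<bar>X \<omega>\<bar> ^ (k + 2) * exp (u * X \<omega> + \<bar>X \<omega>\<bar>))"
        by (simp add: exp_add power_add power_mult_distrib power2_eq_square mult_ac)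
      finally show "\<bar>X \<omega> ^ k * exp ((u + h) * X \<omega>) - X \<omega> ^ k * exp (u * X \<omega>) - h * (X \<omega> ^ Suc k * exp (u * X \<omega>))\<bar>
        \<le> h\<^sup>2 * (\<bar>X \<omega>\<bar> ^ (k + 2) * exp (u * X \<omega> + \<bar>X \<omega>\<bar>))" .
    qed (intro integrable_mult_right integrable_power_exp_abs[OF assms])
    also have "\<dots> = h\<^sup>2 * K" by (simp add: K_def)
    finally have *: "\<bar>?f k (u + h) - ?f k u - h * ?f (Suc k) u\<bar> \<le> h\<^sup>2 * K" .
    have "\<bar>(?f k (u + h) - ?f k u) / h - ?f (Suc k) u\<bar> = \<bar>?f k (u + h) - ?f k u - h * ?f (Suc k) u\<bar> / \<bar>h\<bar>"
      using h(1) by (simp add: abs_divide[symmetric] diff_divide_distrib)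
    also have "\<dots> \<le> h\<^sup>2 * K / \<bar>h\<bar>" using * by (rule divide_right_mono) simp
    also have "\<dots> = K * \<bar>h\<bar>" using h(1) by (simp add: power2_eq_square field_simps abs_if)
    finally show ?thesis .
  qed
  then have "\<forall>\<^sub>F h in at 0. norm ((?f k (u + h) - ?f k u) / h - ?f (Suc k) u) \<le> K * \<bar>h\<bar>"
    by (auto simp: eventually_at intro!: exI[of _ 1])
  moreover have "((\<lambda>h::real. K * \<bar>h\<bar>) \<longlongrightarrow> 0) (at 0)"
    by (auto intro!: tendsto_eq_intros)
  ultimately have "((\<lambda>h. (?f k (u + h) - ?f k u) / h - ?f (Suc k) u) \<longlongrightarrow> 0) (at 0)"
    by (rule Lim_null_comparison)
  then show ?thesis
    unfolding DERIV_def by (rule Lim_null[THEN iffD2])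
qed

text \<open>\<open>exp (u * X - \<psi> u)\<close> is the density of the law tilted by
  \<open>exp (u * X)\<close>; the identities are its mean, variance and total mass. They come from
  the quotient rule applied to the first moment integral over the zeroth.\<close>

lemma (in prob_space) cumulant_derivs:
  fixes X :: "'a \<Rightarrow> real"
  assumes X[measurable]: "X \<in> borel_measurable M"
    and int: "\<And>u. integrable M (\<lambda>\<omega>. exp (u * X \<omega>))"
  defines "\<psi> \<equiv> \<lambda>u. ln (expectation (\<lambda>\<omega>. exp (u * X \<omega>)))"
  shows "deriv \<psi> u = expectation (\<lambda>\<omega>. X \<omega> * exp (u * X \<omega> - \<psi> u))" (is "_ = ?m")
    and "deriv (deriv \<psi>) u = expectation (\<lambda>\<omega>. (X \<omega> - deriv \<psi> u)\<^sup>2 * exp (u * X \<omega> - \<psi> u))"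
    and "expectation (\<lambda>\<omega>. exp (u * X \<omega> - \<psi> u)) = 1"
proof -
  let ?f = "\<lambda>k u. \<integral>\<omega>. X \<omega> ^ k * exp (u * X \<omega>) \<partial>M"
  have f0: "?f 0 = (\<lambda>u. expectation (\<lambda>\<omega>. exp (u * X \<omega>)))" by simp
  have pos: "?f 0 u > 0" for u
  proof -
    have "?f 0 u \<noteq> 0"
    proof
      assume "?f 0 u = 0"
      then have "AE \<omega> in M. False"
        using integral_nonneg_eq_0_iff_AE[OF int[of u]] by auto
      then show False by (simp add: AE_False emeasure_space_1)
    qed
    then show ?thesis by (simp add: order_less_le)
  qed
  note D = has_real_derivative_mgf[OF assms(1,2)]
  note I = integrable_power_exp[OF assms(1,2)]
  have \<psi>: "\<psi> = (\<lambda>u. ln (?f 0 u))" unfolding \<psi>_def f0 by simp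
  have D1: "(\<psi> has_real_derivative ?f 1 u / ?f 0 u) (at u)" for u
    unfolding \<psi> using D[of 0 u] pos[of u] by (auto intro!: derivative_eq_intros)
  have d1: "deriv \<psi> = (\<lambda>u. ?f 1 u / ?f 0 u)"
    using D1 by (auto intro!: ext DERIV_imp_deriv)
  have D2: "(deriv \<psi> has_real_derivative (?f 2 u * ?f 0 u - ?f 1 u * ?f 1 u) / (?f 0 u * ?f 0 u)) (at u)"
    unfolding d1 using D[of 0 u] D[of 1 u] pos[of u]
    by (intro DERIV_divide) (auto simp: numeral_2_eq_2)
  have d2: "deriv (deriv \<psi>) u = (?f 2 u * ?f 0 u - ?f 1 u * ?f 1 u) / (?f 0 u * ?f 0 u)"
    by (rule DERIV_imp_deriv[OF D2])
  have e: "exp (u * X \<omega> - \<psi> u) = exp (u * X \<omega>) / ?f 0 u" for \<omega>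
    unfolding \<psi> using pos[of u] by (simp add: exp_diff)
  show "deriv \<psi> u = ?m" unfolding d1 e by simp
  have i: "integrable M (\<lambda>\<omega>. X \<omega> ^ 2 * exp (u * X \<omega>))" "integrable M (\<lambda>\<omega>. X \<omega> * exp (u * X \<omega>))"
     "integrable M (\<lambda>\<omega>. exp (u * X \<omega>))"
    using I[of 2 u] I[of 1 u] I[of 0 u] by simp_all
  have "expectation (\<lambda>\<omega>. (X \<omega> - c)\<^sup>2 * exp (u * X \<omega> - \<psi> u)) =
      expectation (\<lambda>\<omega>. (X \<omega> ^ 2 * exp (u * X \<omega>) - 2 * c * (X \<omega> * exp (u * X \<omega>)) + c\<^sup>2 * exp (u * X \<omega>)) / ?f 0 u)" for c
    unfolding e by (intro Bochner_Integration.integral_cong) (auto simp: power2_eq_square algebra_simps add_divide_distrib diff_divide_distrib)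
  also have "\<dots> c = (?f 2 u - 2 * c * ?f 1 u + c\<^sup>2 * ?f 0 u) / ?f 0 u" for c
    using i by simp
  finally have v: "expectation (\<lambda>\<omega>. (X \<omega> - c)\<^sup>2 * exp (u * X \<omega> - \<psi> u)) = (?f 2 u - 2 * c * ?f 1 u + c\<^sup>2 * ?f 0 u) / ?f 0 u" for c .
  show "deriv (deriv \<psi>) u = expectation (\<lambda>\<omega>. (X \<omega> - deriv \<psi> u)\<^sup>2 * exp (u * X \<omega> - \<psi> u))"
    unfolding v d2 unfolding d1 using pos[of u] by (simp add: field_simps power2_eq_square)
  show "expectation (\<lambda>\<omega>. exp (u * X \<omega> - \<psi> u)) = 1"
    unfolding e using pos[of u] by simp
qed

text \<open>Comparison with \<open>(1 + c / k) ^ k\<close> avoids complex logarithms: for numbers in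
  the closed unit disc, the \<open>k\<close>-th powers differ by at most \<open>k\<close> times the
  difference of the bases. The sign of \<open>c\<close> keeps \<open>1 + c / k\<close> in the disc
  once \<open>k \<ge> - c\<close>.\<close>

lemma power_tendsto_exp:
  fixes \<phi> :: "nat \<Rightarrow> complex" and k :: "nat \<Rightarrow> nat" and c :: real
  assumes k: "filterlim k at_top sequentially" and "c \<le> 0"
    and le: "\<forall>\<^sub>F N in sequentially. norm (\<phi> N) \<le> 1"
    and lim: "(\<lambda>N. of_nat (k N) * (\<phi> N - 1)) \<longlonglongrightarrow> of_real c"
  shows "(\<lambda>N. \<phi> N ^ k N) \<longlonglongrightarrow> of_real (exp c)"
proof -
  define w where "w N = 1 + c / real (k N)" for N
  have wlim: "(\<lambda>N. of_real (w N ^ k N) :: complex) \<longlonglongrightarrow> of_real (exp c)"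
    unfolding w_def
    by (intro tendsto_of_real filterlim_compose[OF tendsto_exp_limit_sequentially k])
  have "\<forall>\<^sub>F N in sequentially. k N \<ge> nat \<lceil>- c\<rceil> + 1"
    using k by (simp add: filterlim_at_top)
  with le have "\<forall>\<^sub>F N in sequentially. norm (\<phi> N ^ k N - of_real (w N ^ k N)) \<le> norm (of_nat (k N) * (\<phi> N - 1) - of_real c)"
  proof eventually_elim
    case (elim N)
    have kpos: "real (k N) > 0" "real (k N) \<ge> - c" using elim by linarith+
    then have "\<bar>w N\<bar> \<le> 1" using \<open>c \<le> 0\<close> by (auto simp: w_def abs_le_iff field_simps)
    then have "norm (\<phi> N ^ k N - (of_real (w N)) ^ k N) \<le> k N * norm (\<phi> N - of_real (w N))"
      using elim by (intro norm_power_diff) auto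
    also have "\<dots> = norm (of_nat (k N) * (\<phi> N - of_real (w N)))"
      by (simp add: norm_mult)
    also have "of_nat (k N) * (\<phi> N - of_real (w N)) = of_nat (k N) * (\<phi> N - 1) - of_real c"
      using kpos by (simp add: w_def field_simps)
    finally show ?case by simp
  qed
  moreover have "(\<lambda>N. norm (of_nat (k N) * (\<phi> N - 1) - of_real c)) \<longlonglongrightarrow> 0"
    using lim by (simp add: tendsto_norm_zero_iff LIM_zero)
  ultimately have "(\<lambda>N. \<phi> N ^ k N - of_real (w N ^ k N)) \<longlonglongrightarrow> 0"
    by (rule Lim_null_comparison)
  from tendsto_add[OF this wlim] show ?thesis by simp
qed

text \<open>For centred variables this has the same expectation as \<open>iexp y - 1\<close>, but it
  is quadratic near \<open>0\<close> and only linear at infinity. The gap between these two growth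
  rates is what suppresses the large summands.\<close>

definition iexp_rem :: "real \<Rightarrow> complex" where
  "iexp_rem y = iexp y - 1 - \<i> * of_real y"

lemma iexp_rem_measurable [measurable]: "iexp_rem \<in> borel_measurable borel"
  unfolding iexp_rem_def by measurable

lemma iexp_rem_le1: "cmod (iexp_rem y) \<le> 2 * \<bar>y\<bar>"
  using iexp_approx2[of y 1] by (simp add: iexp_rem_def diff_diff_eq)

lemma iexp_rem_le2: "cmod (iexp_rem y) \<le> y\<^sup>2 / 2"
  using iexp_approx1[of y 1] by (simp add: iexp_rem_def diff_diff_eq power2_eq_square)

lemma iexp_rem_approx: "cmod (iexp_rem y + of_real (y\<^sup>2 / 2)) \<le> \<bar>y\<bar> ^ 3 / 6"
  using iexp_approx1[of y 2]
  by (simp add: iexp_rem_def diff_diff_eq numeral_2_eq_2 numeral_3_eq_3 algebra_simps)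

text \<open>With \<open>y = w + d\<close> the difference splits into
  \<open>iexp w * iexp_rem d\<close> and \<open>\<i> * d * (iexp w - 1)\<close>. The bound is of
  second order in \<open>y\<close> and \<open>w\<close> jointly, so after multiplication by
  \<open>N\<close> it is governed by second moments, with a small factor from
  \<open>y - w\<close>.\<close>

lemma iexp_rem_diff: "cmod (iexp_rem y - iexp_rem w) \<le> \<bar>y - w\<bar> * (\<bar>y - w\<bar> + \<bar>w\<bar>)"
proof -
  define d where "d = y - w"
  have "iexp_rem y - iexp_rem w = iexp w * iexp_rem d + \<i> * of_real d * (iexp w - 1)"
    by (simp add: iexp_rem_def d_def exp_diff exp_minus algebra_simps)
  then have "cmod (iexp_rem y - iexp_rem w) \<le> cmod (iexp w * iexp_rem d) + cmod (\<i> * of_real d * (iexp w - 1))"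
    by (simp only: norm_triangle_ineq)
  also have "\<dots> = cmod (iexp_rem d) + \<bar>d\<bar> * cmod (iexp w - 1)"
    by (simp add: norm_mult)
  also have "\<dots> \<le> d\<^sup>2 / 2 + \<bar>d\<bar> * \<bar>w\<bar>"
    using iexp_approx1[of w 0] by (intro add_mono mult_left_mono iexp_rem_le2) auto
  also have "\<dots> \<le> \<bar>d\<bar> * (\<bar>d\<bar> + \<bar>w\<bar>)"
    by (simp add: distrib_left power2_eq_square abs_mult[symmetric])
  finally show ?thesis by (simp add: d_def)
qed

section \<open>Exponential tilting and its central limit theorem\<close>

lemma isCont_cdf_std_normal: "isCont (cdf std_normal_distribution) x"
proof -
  interpret real_distribution std_normal_distribution by (rule real_dist_normal_dist)
  have "AE y in lborel. y \<in> {x} \<longrightarrow> ennreal (std_normal_density y) = 0"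
    using AE_lborel_singleton[of x] by eventually_elim simp
  then have "{x} \<in> null_sets std_normal_distribution"
    by (subst null_sets_density_iff) auto
  then have "measure std_normal_distribution {x} = 0"
    by (simp add: measure_def null_sets_def)
  then show ?thesis by (simp add: isCont_cdf)
qed

section \<open>Strict convexity of \<open>psi\<close> and characteristic functions under the
  tilt\<close>

context levy_mgf
begin

lemma X1_meas [measurable]: "X 1 \<in> borel_measurable M"
  by (rule X_meas) simp

lemmas psi_derivs = cumulant_derivs[OF X1_meas mgf_finite, folded psi_def]

lemma integrable_tilt_power: "integrable M (\<lambda>\<omega>. (X 1 \<omega> - c) ^ k * exp (p * X 1 \<omega> - d))"
proof -
  have "integrable M (\<lambda>\<omega>. exp (u * (X 1 \<omega> - c)))" for u
    using integrable_mult_right[OF mgf_finite[of u], of "exp (- u * c)"]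
    by (simp add: exp_add[symmetric] algebra_simps)
  then have I: "integrable M (\<lambda>\<omega>. exp (p * c - d) * ((X 1 \<omega> - c) ^ k * exp (p * (X 1 \<omega> - c))))"
    by (intro integrable_mult_right integrable_power_exp) auto
  have e: "exp (p * c - d) * exp (p * (x - c)) = exp (p * x - d)" for x
    by (simp add: exp_add[symmetric] algebra_simps)
  have "exp (p * c - d) * ((x - c) ^ k * exp (p * (x - c))) = (x - c) ^ k * exp (p * x - d)" for x
    unfolding e[of x, symmetric] by (rule mult.left_commute)
  with I show ?thesis by (simp only:)
qed

text \<open>The tilted density is strictly positive, so a vanishing tilted variance would make
  \<open>X 1\<close> constant under the original law as well.\<close>

lemma psi_deriv2_pos:
  assumes "\<not> (\<exists>c. AE \<omega> in M. X 1 \<omega> = c)"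
  shows "deriv (deriv psi) p > 0"
proof -
  let ?m = "deriv psi p"
  have "expectation (\<lambda>\<omega>. (X 1 \<omega> - ?m)\<^sup>2 * exp (p * X 1 \<omega> - psi p)) \<noteq> 0"
  proof
    assume "expectation (\<lambda>\<omega>. (X 1 \<omega> - ?m)\<^sup>2 * exp (p * X 1 \<omega> - psi p)) = 0"
    then have "AE \<omega> in M. (X 1 \<omega> - ?m)\<^sup>2 * exp (p * X 1 \<omega> - psi p) = 0"
      using integral_nonneg_eq_0_iff_AE[OF integrable_tilt_power[of ?m 2 p "psi p"]] by auto
    then have "AE \<omega> in M. X 1 \<omega> = ?m" by auto
    with assms show False by blast
  qed
  then show ?thesis unfolding psi_derivs(2) by (simp add: order_less_le)
qed

lemma exp_psi: "expectation (\<lambda>\<omega>. exp (u * X 1 \<omega>)) = exp (psi u)"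
  using mgf_eq[of 1 u] by simp

text \<open>The variance of \<open>exp (X 1)\<close> is
  \<open>exp (psi 2) - exp (2 * psi 1)\<close>, and it vanishes only for constant
  \<open>X 1\<close>.\<close>

lemma psi_strict:
  assumes "\<not> (\<exists>c. AE \<omega> in M. X 1 \<omega> = c)"
  shows "2 * psi 1 < psi 2"
proof -
  let ?c = "exp (psi 1)"
  have i: "integrable M (\<lambda>\<omega>. exp (2 * X 1 \<omega>))" "integrable M (\<lambda>\<omega>. exp (X 1 \<omega>))"
    using mgf_finite[of 2] mgf_finite[of 1] by auto
  have eq: "(\<lambda>\<omega>. (exp (X 1 \<omega>) - ?c)\<^sup>2) = (\<lambda>\<omega>. exp (2 * X 1 \<omega>) - 2 * ?c * exp (X 1 \<omega>) + ?c\<^sup>2)"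
    by (simp add: fun_eq_iff power2_diff exp_double mult_ac)
  have I: "integrable M (\<lambda>\<omega>. (exp (X 1 \<omega>) - ?c)\<^sup>2)"
    unfolding eq using i by auto
  have "expectation (\<lambda>\<omega>. (exp (X 1 \<omega>) - ?c)\<^sup>2) = exp (psi 2) - 2 * ?c * ?c + ?c\<^sup>2"
    unfolding eq using i exp_psi[of 2] exp_psi[of 1] by (simp add: prob_space)
  also have "\<dots> = exp (psi 2) - exp (2 * psi 1)"
    by (simp add: power2_eq_square exp_add[symmetric])
  finally have e: "expectation (\<lambda>\<omega>. (exp (X 1 \<omega>) - ?c)\<^sup>2) = exp (psi 2) - exp (2 * psi 1)" .
  have "expectation (\<lambda>\<omega>. (exp (X 1 \<omega>) - ?c)\<^sup>2) \<noteq> 0"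
  proof
    assume "expectation (\<lambda>\<omega>. (exp (X 1 \<omega>) - ?c)\<^sup>2) = 0"
    then have "AE \<omega> in M. (exp (X 1 \<omega>) - ?c)\<^sup>2 = 0"
      using integral_nonneg_eq_0_iff_AE[OF I] by auto
    then have "AE \<omega> in M. X 1 \<omega> = psi 1" by auto
    with assms show False by blast
  qed
  then have "expectation (\<lambda>\<omega>. (exp (X 1 \<omega>) - ?c)\<^sup>2) > 0"
    by (simp add: order_less_le)
  then show ?thesis unfolding e by simp
qed

text \<open>The characteristic function at \<open>w\<close> of \<open>X t\<close>, centred at its
  tilted mean, under the law tilted by \<open>exp (p * X t)\<close>.\<close>

definition tchar :: "real \<Rightarrow> real \<Rightarrow> real \<Rightarrow> complex" where
  "tchar p w t = (\<integral>\<omega>. of_real (exp (p * X t \<omega> - psi p * t)) * iexp (w * (X t \<omega> - deriv psi p * t)) \<partial>M)"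

lemma integrable_tilt: "0 \<le> t \<Longrightarrow> integrable M (\<lambda>\<omega>. exp (p * X t \<omega> - c))"
  using integrable_mult_right[OF integrable_exp[of t p], of "exp (- c)"]
  by (simp add: exp_add[symmetric] algebra_simps)

lemma expectation_tilt:
  assumes "0 \<le> t"
  shows "expectation (\<lambda>\<omega>. exp (q * X t \<omega> - c)) = exp (t * psi q - c)"
proof -
  have "expectation (\<lambda>\<omega>. exp (q * X t \<omega> - c)) = expectation (\<lambda>\<omega>. exp (- c) * exp (q * X t \<omega>))"
    by (simp add: exp_add[symmetric])
  also have "\<dots> = exp (- c) * exp (t * psi q)" by (simp add: mgf_eq[OF assms])
  finally show ?thesis by (simp add: exp_add[symmetric])
qed

text \<open>Tilting and centring only add a factor exponential in \<open>t\<close>, so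
  multiplicativity in time is inherited from \<open>cmgf\<close> and no independence under the
  tilted law has to be discussed.\<close>

lemma tchar_cmgf:
  assumes "0 \<le> t"
  shows "tchar p w t = cmgf (Complex p w) t * exp (- of_real t * (of_real (psi p) + \<i> * of_real (w * deriv psi p)))"
proof -
  have "of_real (exp (p * X t \<omega> - psi p * t)) * iexp (w * (X t \<omega> - deriv psi p * t)) =
     exp (Complex p w * of_real (X t \<omega>)) * exp (- of_real t * (of_real (psi p) + \<i> * of_real (w * deriv psi p)))" for \<omega>
    by (simp add: exp_of_real[symmetric] exp_add[symmetric] Complex_eq algebra_simps)
  then show ?thesis unfolding tchar_def cmgf_def by simp
qed

lemma tchar_add: "0 \<le> s \<Longrightarrow> 0 \<le> t \<Longrightarrow> tchar p w (s + t) = tchar p w s * tchar p w t"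
proof -
  assume st: "0 \<le> s" "0 \<le> t"
  have "exp (- of_real (s + t) * c) = exp (- of_real s * c) * exp (- of_real t * c)" for c :: complex
    by (simp only: exp_add[symmetric] of_real_add) (simp add: algebra_simps)
  with st show ?thesis by (simp only: tchar_cmgf cmgf_add add_nonneg_nonneg) (simp only: mult_ac)
qed

lemma tchar_nat: "tchar p w (real n) = tchar p w 1 ^ n"
proof (induction n)
  case 0
  then show ?case by (simp add: tchar_cmgf cmgf_0)
next
  case (Suc n)
  then show ?case using tchar_add[of "real n" 1 p w] by (simp add: add.commute)
qed

lemma cmod_tchar_le_1:
  assumes "0 \<le> t"
  shows "cmod (tchar p w t) \<le> 1"
proof -
  have "cmod (tchar p w t) \<le> expectation (\<lambda>\<omega>. exp (p * X t \<omega> - psi p * t))"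
    unfolding tchar_def
    by (intro norm_integral_le integrable_tilt assms) (simp add: norm_mult)
  then show ?thesis by (simp add: expectation_tilt[OF assms])
qed

text \<open>Third-order Taylor expansion under the tilt: the first moment is removed by the
  centring, the second is \<open>deriv (deriv psi) p\<close>, and the remainder is controlled by the
  third absolute tilted moment.\<close>

lemma tchar_1_approx:
  "\<exists>K\<ge>0. \<forall>w. cmod (tchar p w 1 - 1 + of_real (w\<^sup>2 * deriv (deriv psi) p / 2)) \<le> K * \<bar>w\<bar> ^ 3"
proof -
  let ?e = "\<lambda>\<omega>. exp (p * X 1 \<omega> - psi p)"
  let ?Y = "\<lambda>\<omega>. X 1 \<omega> - deriv psi p"
  define E3 where "E3 = expectation (\<lambda>\<omega>. \<bar>?Y \<omega> ^ 3 * ?e \<omega>\<bar>)"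
  define K where "K = E3 / 6"
  note T = integrable_tilt_power[of "deriv psi p" _ p "psi p"]
  have T0: "integrable M ?e" using T[of 0] by simp
  have T1: "integrable M (\<lambda>\<omega>. ?Y \<omega> * ?e \<omega>)" using T[of 1] by simp
  have T1': "integrable M (\<lambda>\<omega>. X 1 \<omega> * ?e \<omega>)" using integrable_tilt_power[of 0 1 p "psi p"] by simp
  have m0: "expectation (\<lambda>\<omega>. ?Y \<omega> * ?e \<omega>) = 0"
  proof -
    have "expectation (\<lambda>\<omega>. ?Y \<omega> * ?e \<omega>) = expectation (\<lambda>\<omega>. X 1 \<omega> * ?e \<omega>) - expectation (\<lambda>\<omega>. deriv psi p * ?e \<omega>)"
      unfolding left_diff_distrib by (intro Bochner_Integration.integral_diff T1' integrable_mult_right T0)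
    then show ?thesis by (simp only: integral_mult_right_zero psi_derivs(1)[symmetric] psi_derivs(3) mult_1_right diff_self)
  qed
  have K: "integrable M (\<lambda>\<omega>. \<bar>?Y \<omega> ^ 3 * ?e \<omega>\<bar>)"
    using T[of 3] by (rule integrable_abs)
  have "cmod (tchar p w 1 - 1 + of_real (w\<^sup>2 * deriv (deriv psi) p / 2)) \<le> K * \<bar>w\<bar> ^ 3" for w
  proof -
    have i1: "integrable M (\<lambda>\<omega>. of_real (?e \<omega>) * iexp (w * ?Y \<omega>))"
      by (rule Bochner_Integration.integrable_bound[OF T0]) (auto simp: norm_mult)
    have i2: "integrable M (\<lambda>\<omega>. complex_of_real (?e \<omega>))" using T0 by simp
    have i3: "integrable M (\<lambda>\<omega>. \<i> * of_real w * complex_of_real (?Y \<omega> * ?e \<omega>))"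
      using T1 by (intro integrable_mult_right integrable_of_real)
    have i4: "integrable M (\<lambda>\<omega>. of_real (w\<^sup>2 / 2) * complex_of_real ((?Y \<omega>)\<^sup>2 * ?e \<omega>))"
      using T[of 2] by (intro integrable_mult_right integrable_of_real)
    have pt: "of_real e * (iexp_rem (w * Y) + of_real ((w * Y)\<^sup>2 / 2)) =
        of_real e * iexp (w * Y) - of_real e - \<i> * of_real w * complex_of_real (Y * e)
        + of_real (w\<^sup>2 / 2) * complex_of_real (Y\<^sup>2 * e)" for e Y :: real
      by (simp add: iexp_rem_def power_mult_distrib algebra_simps)
    have "(\<integral>\<omega>. of_real (?e \<omega>) * (iexp_rem (w * ?Y \<omega>) + of_real ((w * ?Y \<omega>)\<^sup>2 / 2)) \<partial>M) =
      (\<integral>\<omega>. of_real (?e \<omega>) * iexp (w * ?Y \<omega>) - of_real (?e \<omega>) - \<i> * of_real w * complex_of_real (?Y \<omega> * ?e \<omega>)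
        + of_real (w\<^sup>2 / 2) * complex_of_real ((?Y \<omega>)\<^sup>2 * ?e \<omega>) \<partial>M)"
      by (intro Bochner_Integration.integral_cong refl pt)
    also have "\<dots> = tchar p w 1 - 1 - 0 + of_real (w\<^sup>2 / 2) * of_real (deriv (deriv psi) p)"
      using i1 i2 i3 i4 m0 unfolding tchar_def
      by (simp only: Bochner_Integration.integral_add Bochner_Integration.integral_diff Bochner_Integration.integrable_diff
          integral_mult_right_zero integral_complex_of_real psi_derivs(2,3) Bochner_Integration.integrable_add) simp
    finally have "tchar p w 1 - 1 + of_real (w\<^sup>2 * deriv (deriv psi) p / 2) =
       (\<integral>\<omega>. of_real (?e \<omega>) * (iexp_rem (w * ?Y \<omega>) + of_real ((w * ?Y \<omega>)\<^sup>2 / 2)) \<partial>M)"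
      by simp
    then have "cmod (tchar p w 1 - 1 + of_real (w\<^sup>2 * deriv (deriv psi) p / 2)) =
       cmod (\<integral>\<omega>. of_real (?e \<omega>) * (iexp_rem (w * ?Y \<omega>) + of_real ((w * ?Y \<omega>)\<^sup>2 / 2)) \<partial>M)"
      by (rule arg_cong)
    also have "\<dots> \<le> (\<integral>\<omega>. \<bar>w\<bar> ^ 3 / 6 * \<bar>?Y \<omega> ^ 3 * ?e \<omega>\<bar> \<partial>M)"
    proof (rule norm_integral_le)
      fix \<omega>
      have "cmod (of_real (?e \<omega>) * (iexp_rem (w * ?Y \<omega>) + of_real ((w * ?Y \<omega>)\<^sup>2 / 2))) \<le> ?e \<omega> * (\<bar>w * ?Y \<omega>\<bar> ^ 3 / 6)"
        unfolding norm_mult by (intro mult_mono iexp_rem_approx) auto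
      then show "cmod (of_real (?e \<omega>) * (iexp_rem (w * ?Y \<omega>) + of_real ((w * ?Y \<omega>)\<^sup>2 / 2))) \<le> \<bar>w\<bar> ^ 3 / 6 * \<bar>?Y \<omega> ^ 3 * ?e \<omega>\<bar>"
        by (simp add: abs_mult power_mult_distrib power_abs mult_ac)
    qed (use K in simp)
    also have "\<dots> = \<bar>w\<bar> ^ 3 / 6 * E3" unfolding E3_def by (rule integral_mult_right_zero)
    also have "\<dots> = K * \<bar>w\<bar> ^ 3" by (simp add: K_def)
    finally show ?thesis .
  qed
  moreover have "E3 \<ge> 0" unfolding E3_def by (rule Bochner_Integration.integral_nonneg) simp
  then have "K \<ge> 0" unfolding K_def by simp
  ultimately show ?thesis by blast
qed

text \<open>This handles the fractional part of a non-integer time, so the bound must be uniform in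
  \<open>r\<close>. Estimating \<open>\<bar>x\<bar>\<close> by \<open>exp x + exp (- x)\<close>
  merely shifts the tilt parameter by one, and the resulting moments are explicit exponentials in
  \<open>r\<close>.\<close>

lemma tchar_unit_approx:
  "\<exists>C\<ge>0. \<forall>r w. 0 \<le> r \<and> r \<le> 1 \<longrightarrow> cmod (tchar p w r - 1) \<le> C * \<bar>w\<bar>"
proof -
  have scale: "cmod (of_real (exp x) * z - of_real (exp x)) = exp x * cmod (z - 1)" for x :: real and z
  proof -
    have "complex_of_real (exp x) * z - of_real (exp x) = of_real (exp x) * (z - 1)"
      by (simp only: right_diff_distrib mult_1_right)
    then show ?thesis by (simp only: norm_mult norm_of_real abs_exp_cancel)
  qed
  have pull: "x * (y * (A + B + d)) = y * (x * A + x * B + d * x)" for x y A B d :: real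
    by (simp add: algebra_simps)
  define C where "C = exp \<bar>psi (p + 1) - psi p\<bar> + exp \<bar>psi (p - 1) - psi p\<bar> + \<bar>deriv psi p\<bar>"
  have "cmod (tchar p w r - 1) \<le> C * \<bar>w\<bar>" if r: "0 \<le> r" "r \<le> 1" for r w
  proof -
    let ?e = "\<lambda>\<omega>. exp (p * X r \<omega> - psi p * r)"
    let ?d = "\<lambda>\<omega>. X r \<omega> - deriv psi p * r"
    have [measurable]: "X r \<in> borel_measurable M" using r by (intro X_meas)
    note T = integrable_tilt[OF r(1)]
    have T0: "integrable M ?e" by (rule T)
    have I: "integrable M (\<lambda>\<omega>. \<bar>w\<bar> * (exp ((p + 1) * X r \<omega> - psi p * r) + exp ((p - 1) * X r \<omega> - psi p * r) + \<bar>deriv psi p\<bar> * ?e \<omega>))"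
      using T[of "p + 1" "psi p * r"] T[of "p - 1" "psi p * r"] T0
      by (intro integrable_mult_right Bochner_Integration.integrable_add)
    have i1: "integrable M (\<lambda>\<omega>. of_real (?e \<omega>) * iexp (w * ?d \<omega>))"
      by (rule Bochner_Integration.integrable_bound[OF T0]) (auto simp: norm_mult)
    have i2: "integrable M (\<lambda>\<omega>. complex_of_real (?e \<omega>))" using T0 by simp
    have "tchar p w r - 1 = (\<integral>\<omega>. of_real (?e \<omega>) * iexp (w * ?d \<omega>) - of_real (?e \<omega>) \<partial>M)"
      using i1 i2 r unfolding tchar_def
      by (simp only: Bochner_Integration.integral_diff integral_complex_of_real) (simp add: expectation_tilt)
    then have "cmod (tchar p w r - 1) = cmod (\<integral>\<omega>. of_real (?e \<omega>) * iexp (w * ?d \<omega>) - of_real (?e \<omega>) \<partial>M)"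
      by (rule arg_cong)
    also have "\<dots> \<le> (\<integral>\<omega>. \<bar>w\<bar> * (exp ((p + 1) * X r \<omega> - psi p * r) + exp ((p - 1) * X r \<omega> - psi p * r) + \<bar>deriv psi p\<bar> * ?e \<omega>) \<partial>M)"
    proof (rule norm_integral_le)
      fix \<omega>
      have "cmod (iexp (w * ?d \<omega>) - 1) \<le> \<bar>w * ?d \<omega>\<bar>"
        using iexp_approx1[of "w * ?d \<omega>" 0] by simp
      also have "\<dots> \<le> \<bar>w\<bar> * (\<bar>X r \<omega>\<bar> + \<bar>deriv psi p\<bar>)"
      proof -
        have "\<bar>deriv psi p * r\<bar> \<le> \<bar>deriv psi p\<bar>"
          using r mult_left_mono[of "\<bar>r\<bar>" 1 "\<bar>deriv psi p\<bar>"] by (simp add: abs_mult del: abs_mult_self_eq)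
        then show ?thesis by (subst abs_mult) (intro mult_left_mono; linarith)
      qed
      also have "\<dots> \<le> \<bar>w\<bar> * (exp (X r \<omega>) + exp (- X r \<omega>) + \<bar>deriv psi p\<bar>)"
      proof (intro mult_left_mono add_right_mono)
        show "\<bar>X r \<omega>\<bar> \<le> exp (X r \<omega>) + exp (- X r \<omega>)"
          using exp_ge_add_one_self[of "X r \<omega>"] exp_ge_add_one_self[of "- X r \<omega>"]
            exp_gt_zero[of "X r \<omega>"] exp_gt_zero[of "- X r \<omega>"] by linarith
      qed auto
      finally have "?e \<omega> * cmod (iexp (w * ?d \<omega>) - 1) \<le> ?e \<omega> * (\<bar>w\<bar> * (exp (X r \<omega>) + exp (- X r \<omega>) + \<bar>deriv psi p\<bar>))"
        by (rule mult_left_mono) simp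
      also have "\<dots> = \<bar>w\<bar> * (exp ((p + 1) * X r \<omega> - psi p * r) + exp ((p - 1) * X r \<omega> - psi p * r) + \<bar>deriv psi p\<bar> * ?e \<omega>)"
      proof -
        have "?e \<omega> * exp (X r \<omega>) = exp ((p + 1) * X r \<omega> - psi p * r)"
          "?e \<omega> * exp (- X r \<omega>) = exp ((p - 1) * X r \<omega> - psi p * r)"
          by (simp_all only: exp_add[symmetric]) (simp_all add: algebra_simps)
        then show ?thesis by (simp only: pull)
      qed
      finally show "cmod (of_real (?e \<omega>) * iexp (w * ?d \<omega>) - of_real (?e \<omega>)) \<le> \<bar>w\<bar> * (exp ((p + 1) * X r \<omega> - psi p * r) + exp ((p - 1) * X r \<omega> - psi p * r) + \<bar>deriv psi p\<bar> * ?e \<omega>)"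
        unfolding scale .
    qed (rule I)
    also have "\<dots> = \<bar>w\<bar> * (exp (r * psi (p + 1) - psi p * r) + exp (r * psi (p - 1) - psi p * r) + \<bar>deriv psi p\<bar> * exp (r * psi p - psi p * r))"
      by (simp only: integral_mult_right_zero Bochner_Integration.integral_add Bochner_Integration.integrable_add
          integrable_mult_right integrable_tilt[OF r(1)] expectation_tilt[OF r(1)])
    also have "\<dots> = \<bar>w\<bar> * (exp (r * (psi (p + 1) - psi p)) + exp (r * (psi (p - 1) - psi p)) + \<bar>deriv psi p\<bar>)"
      by (simp only: right_diff_distrib mult.commute[of "psi p" r]) simp
    also have "\<dots> \<le> \<bar>w\<bar> * C"
    proof -
      have "r * d \<le> \<bar>d\<bar>" for d
        using r mult_right_mono[of r 1 "\<bar>d\<bar>"] mult_left_mono[OF abs_ge_self[of d], of r] by linarith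
      then show ?thesis unfolding C_def by (intro mult_left_mono add_mono) auto
    qed
    finally show ?thesis by (simp add: mult.commute)
  qed
  moreover have "C \<ge> 0" unfolding C_def by (intro add_nonneg_nonneg) auto
  ultimately show ?thesis by blast
qed

text \<open>The time is split into its integer part, where multiplicativity gives the power of a
  unit-time characteristic function, and a rest in \<open>[0, 1]\<close>, whose factor tends to
  \<open>1\<close> because the frequency \<open>w N\<close> tends to \<open>0\<close>.\<close>

lemma tchar_clt:
  assumes a: "filterlim a at_top sequentially" and apos: "\<And>N. a N > 0"
    and var: "deriv (deriv psi) p > 0"
  shows "(\<lambda>N. tchar p (t / sqrt (deriv (deriv psi) p * a N)) (a N)) \<longlonglongrightarrow> of_real (exp (- (t\<^sup>2) / 2))"
proof -
  define v where "v = deriv (deriv psi) p"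
  define w where "w N = t / sqrt (v * a N)" for N
  define n where "n N = nat \<lfloor>a N\<rfloor>" for N
  have vpos: "v > 0" using var by (simp add: v_def)
  have n: "real (n N) \<le> a N" "a N < real (n N) + 1" for N
    using apos[of N] by (auto simp: n_def)
  have n_top: "filterlim n at_top sequentially"
  proof -
    have "filterlim (\<lambda>N. real (n N)) at_top sequentially"
      by (rule filterlim_at_top_mono[OF filterlim_tendsto_add_at_top[OF tendsto_const[of "-1"] a]])
         (use n(2) in \<open>auto intro!: always_eventually less_imp_le simp: algebra_simps\<close>)
    then show ?thesis by (simp add: filterlim_sequentially_iff_filterlim_real o_def)
  qed
  have w2: "(w N)\<^sup>2 * v * a N = t\<^sup>2" for N
    using apos[of N] vpos by (simp add: w_def power_divide)
  have inv0: "(\<lambda>N. inverse (a N)) \<longlonglongrightarrow> 0"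
    by (rule tendsto_inverse_0_at_top[OF a])
  have w0: "w \<longlonglongrightarrow> 0"
  proof -
    have "(\<lambda>N. t / sqrt v * sqrt (inverse (a N))) \<longlonglongrightarrow> t / sqrt v * sqrt 0"
      by (intro tendsto_intros inv0)
    then show ?thesis
      by (simp add: w_def[abs_def] real_sqrt_mult real_sqrt_inverse divide_inverse mult_ac)
  qed
  then have aw0: "(\<lambda>N. \<bar>w N\<bar>) \<longlonglongrightarrow> 0" by (rule tendsto_rabs_zero)
  obtain K where K: "K \<ge> 0" "\<And>w. cmod (tchar p w 1 - 1 + of_real (w\<^sup>2 * v / 2)) \<le> K * \<bar>w\<bar> ^ 3"
    using tchar_1_approx[of p] unfolding v_def by blast
  obtain C where C: "\<And>r w. 0 \<le> r \<Longrightarrow> r \<le> 1 \<Longrightarrow> cmod (tchar p w r - 1) \<le> C * \<bar>w\<bar>"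
    using tchar_unit_approx[of p] by blast
  have L1: "(\<lambda>N. tchar p (w N) 1 ^ n N) \<longlonglongrightarrow> of_real (exp (- (t\<^sup>2) / 2))"
  proof (rule power_tendsto_exp[OF n_top])
    have "(\<lambda>N. of_nat (n N) * (tchar p (w N) 1 - 1 + of_real ((w N)\<^sup>2 * v / 2))) \<longlonglongrightarrow> 0"
    proof (rule Lim_null_comparison)
      show "\<forall>\<^sub>F N in sequentially. norm (of_nat (n N) * (tchar p (w N) 1 - 1 + of_real ((w N)\<^sup>2 * v / 2))) \<le> K * t\<^sup>2 / v * \<bar>w N\<bar>"
      proof (intro always_eventually allI)
        fix N
        have "norm (of_nat (n N) * (tchar p (w N) 1 - 1 + of_real ((w N)\<^sup>2 * v / 2))) \<le> a N * (K * \<bar>w N\<bar> ^ 3)"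
          unfolding norm_mult using n(1)[of N] K apos[of N] by (intro mult_mono) (auto intro: less_imp_le)
        also have "\<dots> = K / v * ((w N)\<^sup>2 * v * a N) * \<bar>w N\<bar>"
          using vpos by (simp add: power3_eq_cube power2_eq_square field_simps)
        also have "\<dots> = K * t\<^sup>2 / v * \<bar>w N\<bar>" unfolding w2 by simp
        finally show "norm (of_nat (n N) * (tchar p (w N) 1 - 1 + of_real ((w N)\<^sup>2 * v / 2))) \<le> K * t\<^sup>2 / v * \<bar>w N\<bar>" .
      qed
      show "(\<lambda>N. K * t\<^sup>2 / v * \<bar>w N\<bar>) \<longlonglongrightarrow> 0"
        by (rule tendsto_mult_right_zero[OF aw0])
    qed
    moreover have "(\<lambda>N. real (n N) * ((w N)\<^sup>2 * v / 2)) \<longlonglongrightarrow> t\<^sup>2 / 2"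
    proof -
      have "(\<lambda>N. real (n N) / a N) \<longlonglongrightarrow> 1"
      proof (rule tendsto_sandwich)
        show "\<forall>\<^sub>F N in sequentially. 1 - inverse (a N) \<le> real (n N) / a N"
        proof (intro always_eventually allI)
          fix N
          have "1 - inverse (a N) = (a N - 1) / a N" using apos[of N] by (simp add: field_simps)
          also have "\<dots> \<le> real (n N) / a N"
            using n(2)[of N] apos[of N] by (intro divide_right_mono) auto
          finally show "1 - inverse (a N) \<le> real (n N) / a N" .
        qed
        show "\<forall>\<^sub>F N in sequentially. real (n N) / a N \<le> 1"
          using n(1) apos by (intro always_eventually allI) simp
        show "(\<lambda>N. 1 - inverse (a N)) \<longlonglongrightarrow> 1"
          using tendsto_diff[OF tendsto_const inv0, of 1] by simp
      qed simp
      then have "(\<lambda>N. real (n N) / a N * (t\<^sup>2 / 2)) \<longlonglongrightarrow> 1 * (t\<^sup>2 / 2)"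
        by (intro tendsto_intros)
      moreover have "real (n N) / a N * (t\<^sup>2 / 2) = real (n N) * ((w N)\<^sup>2 * v / 2)" for N
        using apos[of N] unfolding w2[of N, symmetric] by simp
      ultimately show ?thesis by (simp only: mult_1)
    qed
    then have "(\<lambda>N. complex_of_real (real (n N) * ((w N)\<^sup>2 * v / 2))) \<longlonglongrightarrow> of_real (t\<^sup>2 / 2)"
      by (rule tendsto_of_real)
    ultimately have "(\<lambda>N. of_nat (n N) * (tchar p (w N) 1 - 1 + of_real ((w N)\<^sup>2 * v / 2)) -
       complex_of_real (real (n N) * ((w N)\<^sup>2 * v / 2))) \<longlonglongrightarrow> 0 - of_real (t\<^sup>2 / 2)"
      by (rule tendsto_diff)
    then show "(\<lambda>N. of_nat (n N) * (tchar p (w N) 1 - 1)) \<longlonglongrightarrow> of_real (- (t\<^sup>2) / 2)"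
      by (simp add: algebra_simps)
  qed (auto simp: cmod_tchar_le_1)
  have "(\<lambda>N. tchar p (w N) (a N - real (n N)) - 1) \<longlonglongrightarrow> 0"
  proof (rule Lim_null_comparison)
    show "\<forall>\<^sub>F N in sequentially. norm (tchar p (w N) (a N - real (n N)) - 1) \<le> C * \<bar>w N\<bar>"
      using n by (intro always_eventually allI C) (auto simp: less_imp_le algebra_simps)
    show "(\<lambda>N. C * \<bar>w N\<bar>) \<longlonglongrightarrow> 0" by (rule tendsto_mult_right_zero[OF aw0])
  qed
  then have L2: "(\<lambda>N. tchar p (w N) (a N - real (n N))) \<longlonglongrightarrow> 1"
    by (simp add: LIM_zero_iff)
  have "tchar p (w N) (a N) = tchar p (w N) 1 ^ n N * tchar p (w N) (a N - real (n N))" for N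
    using tchar_add[of "real (n N)" "a N - real (n N)" p "w N"] n[of N] by (simp add: tchar_nat)
  with tendsto_mult[OF L1 L2] show ?thesis by (simp add: w_def v_def)
qed

text \<open>The moving threshold is moved into the random variable: \<open>\<zeta> N\<close>
  subtracts \<open>y N - \<theta>\<close>, which multiplies the characteristic function by a phase
  tending to \<open>1\<close>, and distribution functions are then evaluated at the fixed point
  \<open>\<theta>\<close>. The tilted law becomes a genuine measure \<open>Q N\<close> so that the
  continuity theorem applies.\<close>

lemma tilted_clt:
  assumes a: "filterlim a at_top sequentially" and apos: "\<And>N. a N > 0"
    and var: "deriv (deriv psi) p > 0" and y: "y \<longlonglongrightarrow> \<theta>"
  shows "(\<lambda>N. expectation (\<lambda>\<omega>. exp (p * X (a N) \<omega> - psi p * a N) *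
      indicator {z. z \<le> deriv psi p * a N + sqrt (deriv (deriv psi) p * a N) * y N} (X (a N) \<omega>))) \<longlonglongrightarrow> std_normal_cdf \<theta>"
proof -
  define m where "m = deriv psi p"
  define v where "v = deriv (deriv psi) p"
  define e where "e N \<omega> = exp (p * X (a N) \<omega> - psi p * a N)" for N \<omega>
  define \<zeta> where "\<zeta> N \<omega> = (X (a N) \<omega> - m * a N) / sqrt (v * a N) - (y N - \<theta>)" for N \<omega>
  define Q where "Q N = density M (\<lambda>\<omega>. ennreal (e N \<omega>))" for N
  have vpos: "v > 0" using var by (simp add: v_def)
  have sq: "sqrt (v * a N) > 0" for N using vpos apos[of N] by simp
  have Xm[measurable]: "X (a N) \<in> borel_measurable M" for N using apos[of N] by (intro X_meas) simp
  have em[measurable]: "e N \<in> borel_measurable M" for N unfolding e_def by measurable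
  have \<zeta>m[measurable]: "\<zeta> N \<in> borel_measurable M" for N unfolding \<zeta>_def by measurable
  have ei: "integrable M (e N)" "expectation (e N) = 1" for N
    using apos[of N] integrable_tilt[of "a N"] expectation_tilt[of "a N" p] unfolding e_def by auto
  have Q: "prob_space (Q N)" for N
  proof
    have "emeasure (Q N) (space (Q N)) = (\<integral>\<^sup>+\<omega>. ennreal (e N \<omega>) \<partial>M)"
      unfolding Q_def by (simp add: emeasure_density cong: nn_integral_cong)
    also have "\<dots> = ennreal (expectation (e N))"
      by (rule nn_integral_eq_integral[OF ei(1)]) (simp add: e_def)
    finally show "emeasure (Q N) (space (Q N)) = 1" by (simp add: ei)
  qed
  have Qm: "\<zeta> N \<in> borel_measurable (Q N)" for N unfolding Q_def by simp
  have rd: "real_distribution (distr (Q N) borel (\<zeta> N))" for N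
    using prob_space.real_distribution_distr[OF Q Qm] .
  have "weak_conv_m (\<lambda>N. distr (Q N) borel (\<zeta> N)) std_normal_distribution"
  proof (rule levy_continuity[OF rd real_dist_normal_dist])
    fix t
    have "char (distr (Q N) borel (\<zeta> N)) t = tchar p (t / sqrt (v * a N)) (a N) * iexp (- t * (y N - \<theta>))" for N
    proof -
      have "char (distr (Q N) borel (\<zeta> N)) t = (\<integral>\<omega>. iexp (t * \<zeta> N \<omega>) \<partial>Q N)"
        unfolding char_def by (subst integral_distr[OF Qm]) auto
      also have "\<dots> = (\<integral>\<omega>. e N \<omega> *\<^sub>R iexp (t * \<zeta> N \<omega>) \<partial>M)"
        unfolding Q_def by (subst integral_density) (auto simp: e_def)
      also have "\<dots> = (\<integral>\<omega>. (of_real (e N \<omega>) * iexp (t / sqrt (v * a N) * (X (a N) \<omega> - m * a N))) * iexp (- t * (y N - \<theta>)) \<partial>M)"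
      proof (intro Bochner_Integration.integral_cong refl)
        fix \<omega>
        have "iexp (t * \<zeta> N \<omega>) = exp (\<i> * of_real (t / sqrt (v * a N) * (X (a N) \<omega> - m * a N)) + \<i> * of_real (- t * (y N - \<theta>)))"
          by (rule arg_cong[where f = exp]) (simp add: \<zeta>_def algebra_simps diff_divide_distrib)
        then show "e N \<omega> *\<^sub>R iexp (t * \<zeta> N \<omega>) = (of_real (e N \<omega>) * iexp (t / sqrt (v * a N) * (X (a N) \<omega> - m * a N))) * iexp (- t * (y N - \<theta>))"
          unfolding exp_add by (simp add: scaleR_conv_of_real)
      qed
      also have "\<dots> = tchar p (t / sqrt (v * a N)) (a N) * iexp (- t * (y N - \<theta>))"
        unfolding tchar_def e_def m_def by (rule integral_mult_left_zero)
      finally show ?thesis .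
    qed
    moreover have "(\<lambda>N. tchar p (t / sqrt (v * a N)) (a N) * iexp (- t * (y N - \<theta>))) \<longlonglongrightarrow> of_real (exp (- (t\<^sup>2) / 2)) * iexp (- t * (\<theta> - \<theta>))"
      unfolding v_def by (intro tendsto_intros tchar_clt a apos var y)
    ultimately show "(\<lambda>N. char (distr (Q N) borel (\<zeta> N)) t) \<longlonglongrightarrow> char std_normal_distribution t"
      by (simp add: char_std_normal_distribution)
  qed
  then have "(\<lambda>N. cdf (distr (Q N) borel (\<zeta> N)) \<theta>) \<longlonglongrightarrow> cdf std_normal_distribution \<theta>"
    using isCont_cdf_std_normal by (simp add: weak_conv_m_def weak_conv_def)
  moreover have "cdf (distr (Q N) borel (\<zeta> N)) \<theta> = expectation (\<lambda>\<omega>. e N \<omega> * indicator {z. z \<le> m * a N + sqrt (v * a N) * y N} (X (a N) \<omega>))" for N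
  proof -
    interpret Q: prob_space "Q N" by (rule Q)
    have "cdf (distr (Q N) borel (\<zeta> N)) \<theta> = measure (Q N) {\<omega>\<in>space M. \<zeta> N \<omega> \<le> \<theta>}"
      unfolding cdf_def by (subst measure_distr[OF Qm]) (auto simp: Q_def vimage_def Int_def conj_commute)
    also have "\<dots> = (\<integral>\<omega>. indicator {\<omega>\<in>space M. \<zeta> N \<omega> \<le> \<theta>} \<omega> \<partial>Q N)"
      by (simp add: Q_def Int_absorb2 subset_eq)
    also have "\<dots> = (\<integral>\<omega>. e N \<omega> *\<^sub>R indicator {\<omega>\<in>space M. \<zeta> N \<omega> \<le> \<theta>} \<omega> \<partial>M)"
      unfolding Q_def by (subst integral_density) (auto simp: e_def)
    also have "\<dots> = expectation (\<lambda>\<omega>. e N \<omega> * indicator {z. z \<le> m * a N + sqrt (v * a N) * y N} (X (a N) \<omega>))"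
      using sq[of N] by (intro Bochner_Integration.integral_cong refl) (auto simp: indicator_def \<zeta>_def field_simps)
    finally show ?thesis .
  qed
  ultimately show ?thesis
    by (simp add: std_normal_cdf_def cdf_def e_def m_def v_def)
qed

end

section \<open>Truncated moments at the critical scale\<close>

text \<open>\<open>a N\<close> stands for the earliest observation time and \<open>h k\<close> for
  the delay of the \<open>k\<close>-th. The last assumption measures the critical level
  \<open>(ln N + psi 2 * a N) / 2\<close> of \<open>X (a N)\<close> from its tilted mean in units of
  its tilted standard deviation.\<close>

locale critical_levy = levy_mgf M X
  for M :: "'a measure" and X :: "real \<Rightarrow> 'a \<Rightarrow> real" +
  fixes a :: "nat \<Rightarrow> real" and h :: "'n::finite \<Rightarrow> real" and \<theta> :: real
  assumes nonconst: "\<not> (\<exists>c. AE \<omega> in M. X 1 \<omega> = c)"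
    and a_top: "filterlim a at_top sequentially"
    and a_pos: "\<And>N. a N > 0"
    and h_nonneg: "\<And>k. h k \<ge> 0"
    and N_asymp: "(\<lambda>N. (ln (real N) / 2 + psi 2 * a N / 2 - deriv psi 2 * a N)
      / sqrt (deriv (deriv psi) 2 * a N)) \<longlonglongrightarrow> \<theta>"
begin

text \<open>The ratio of the mean of \<open>exp (X t)\<close> to the root of its second moment is
  \<open>exp (- \<kappa> * t)\<close>; the same rate governs the correlations.\<close>

definition \<kappa> :: real where "\<kappa> = psi 2 / 2 - psi 1"

text \<open>\<open>wt N (X (a N))\<close> is the density of the tilted law, and \<open>amp N (X (a N))\<close> is \<open>e^X(a N)\<close> divided by the standard
deviation of the sum of \<open>N\<close> copies, up to the factor \<open>\<rho>\<close> below, so that \<open>N * amp\<^sup>2 = wt\<close>.\<close>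

definition wt :: "nat \<Rightarrow> real \<Rightarrow> real" where
  "wt N z = exp (2 * z - psi 2 * a N)"

definition amp :: "nat \<Rightarrow> real \<Rightarrow> real" where
  "amp N z = exp (z - psi 2 * a N / 2) / sqrt (real N)"

definition low :: "nat \<Rightarrow> real \<Rightarrow> real \<Rightarrow> real" where
  "low N d z = indicator {z. amp N z \<le> d} z"

text \<open>The minimum of \<open>amp\<close> and \<open>1 / amp\<close>. It dominates both error terms below and tends to \<open>0\<close> under the tilted law,
because the tilted law of \<open>amp\<close> asymptotically sits at \<open>0\<close> and \<open>\<infinity>\<close> only.\<close>

definition damp :: "nat \<Rightarrow> real \<Rightarrow> real" where
  "damp N z = (if amp N z \<le> 1 then amp N z else 1 / amp N z)"

section \<open>The tilted law of the amplitude\<close>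

lemma kappa_pos: "\<kappa> > 0"
  using psi_strict[OF nonconst] by (simp add: \<kappa>_def)

lemma var_pos: "deriv (deriv psi) 2 > 0"
  by (rule psi_deriv2_pos[OF nonconst])

lemma Xa_meas [measurable]: "X (a N) \<in> borel_measurable M"
  using a_pos[of N] by (intro X_meas) simp

lemma Xah_meas [measurable]: "X (a N + h k) \<in> borel_measurable M"
  using a_pos[of N] h_nonneg[of k] by (intro X_meas) simp

lemma wt_meas [measurable]: "wt N \<in> borel_measurable borel"
  unfolding wt_def by measurable

lemma amp_meas [measurable]: "amp N \<in> borel_measurable borel"
  unfolding amp_def by measurable

lemma low_meas [measurable]: "low N d \<in> borel_measurable borel"
  unfolding low_def by measurable

lemma damp_meas [measurable]: "damp N \<in> borel_measurable borel"
  unfolding damp_def by measurable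

lemma wt_pos: "wt N z > 0" by (simp add: wt_def)

lemma amp_pos: "N > 0 \<Longrightarrow> amp N z > 0" by (simp add: amp_def)

lemma amp_nonneg: "amp N z \<ge> 0" by (simp add: amp_def)

lemma damp_bounds: "0 \<le> damp N z" "damp N z \<le> 1"
  using amp_nonneg[of N z] by (auto simp: damp_def)

lemma low_bounds: "0 \<le> low N d z" "low N d z \<le> 1"
  by (auto simp: low_def indicator_def)

lemma wt_amp:
  assumes "N > 0"
  shows "real N * (amp N z)\<^sup>2 = wt N z"
proof -
  have "(exp (z - psi 2 * a N / 2))\<^sup>2 = wt N z"
    by (simp add: wt_def exp_double[symmetric] algebra_simps)
  then show ?thesis using assms by (simp add: amp_def power_divide)
qed

lemma integrable_wt: "integrable M (\<lambda>\<omega>. wt N (X (a N) \<omega>))"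
  unfolding wt_def using a_pos[of N] by (intro integrable_tilt) simp

lemma expectation_wt: "expectation (\<lambda>\<omega>. wt N (X (a N) \<omega>)) = 1"
  unfolding wt_def using a_pos[of N] by (subst expectation_tilt) auto

lemma integrable_wt_mult:
  assumes [measurable]: "f \<in> borel_measurable borel" and "\<And>z. 0 \<le> f z" "\<And>z. f z \<le> 1"
  shows "integrable M (\<lambda>\<omega>. wt N (X (a N) \<omega>) * f (X (a N) \<omega>))"
  by (rule Bochner_Integration.integrable_bound[OF integrable_wt[of N]])
     (use assms in \<open>auto simp: abs_mult wt_pos less_imp_le intro!: mult_left_le\<close>)

text \<open>The level \<open>d\<close> enters the threshold for \<open>X (a N)\<close> only through
  the additive constant \<open>ln d\<close>, which vanishes after division by the tilted standard
  deviation. Hence the limit is the same for every \<open>d\<close>.\<close>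

lemma tilted_amp_cdf:
  assumes "d > 0"
  shows "(\<lambda>N. expectation (\<lambda>\<omega>. wt N (X (a N) \<omega>) * low N d (X (a N) \<omega>))) \<longlonglongrightarrow> std_normal_cdf \<theta>"
proof -
  let ?s = "\<lambda>N. sqrt (deriv (deriv psi) 2 * a N)"
  define y where "y N = (ln (real N) / 2 + psi 2 * a N / 2 - deriv psi 2 * a N) / ?s N + ln d / ?s N" for N
  have s_top: "filterlim ?s at_top sequentially"
    by (intro filterlim_compose[OF sqrt_at_top] filterlim_tendsto_pos_mult_at_top[OF tendsto_const var_pos a_top])
  have "(\<lambda>N. ln d / ?s N) \<longlonglongrightarrow> 0"
    by (rule real_tendsto_divide_at_top[OF tendsto_const s_top])
  from tendsto_add[OF N_asymp this] have y: "y \<longlonglongrightarrow> \<theta>" by (simp add: y_def[abs_def])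
  have lowE: "low N d z = indicator {z. z \<le> deriv psi 2 * a N + ?s N * y N} z" if "N > 0" for N z
  proof -
    have s: "?s N > 0" using var_pos a_pos[of N] by simp
    have "?s N * y N = (ln (real N) / 2 + psi 2 * a N / 2 - deriv psi 2 * a N) + ln d"
      unfolding y_def distrib_left using s var_pos a_pos[of N] by simp
    then have *: "deriv psi 2 * a N + ?s N * y N = ln (real N) / 2 + psi 2 * a N / 2 + ln d"
      by simp
    have "amp N z \<le> d \<longleftrightarrow> exp (z - psi 2 * a N / 2) \<le> d * sqrt (real N)"
      using that by (simp add: amp_def pos_divide_le_eq)
    also have "d * sqrt (real N) = exp (ln d + ln (real N) / 2)"
      using that assms by (simp add: exp_add ln_sqrt[symmetric])
    finally have "amp N z \<le> d \<longleftrightarrow> z \<le> ln (real N) / 2 + psi 2 * a N / 2 + ln d" by auto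
    then show ?thesis unfolding low_def * by (simp add: indicator_def)
  qed
  have eq: "\<forall>\<^sub>F N in sequentially. expectation (\<lambda>\<omega>. exp (2 * X (a N) \<omega> - psi 2 * a N) *
      indicator {z. z \<le> deriv psi 2 * a N + ?s N * y N} (X (a N) \<omega>))
     = expectation (\<lambda>\<omega>. wt N (X (a N) \<omega>) * low N d (X (a N) \<omega>))"
    using eventually_gt_at_top[of 0] by eventually_elim (simp add: wt_def lowE)
  show ?thesis
    using tilted_clt[OF a_top a_pos var_pos y] eq by (rule Lim_transform_eventually)
qed

text \<open>Equal limits at the levels \<open>d\<close> and \<open>1 / d\<close> leave no tilted
  mass in between, and outside that window \<open>damp\<close> is at most \<open>d\<close>.\<close>

lemma tilted_damp_tendsto_0:
  "(\<lambda>N. expectation (\<lambda>\<omega>. wt N (X (a N) \<omega>) * damp N (X (a N) \<omega>))) \<longlonglongrightarrow> 0"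
proof (rule tendstoI)
  fix r :: real assume "r > 0"
  let ?F = "\<lambda>d N. expectation (\<lambda>\<omega>. wt N (X (a N) \<omega>) * low N d (X (a N) \<omega>))"
  define d where "d = min (1/2) (r / 2)"
  have d: "0 < d" "d < 1" "d \<le> r / 2" using \<open>r > 0\<close> by (auto simp: d_def)
  have "(\<lambda>N. ?F (1 / d) N - ?F d N) \<longlonglongrightarrow> std_normal_cdf \<theta> - std_normal_cdf \<theta>"
    using d by (intro tendsto_diff tilted_amp_cdf) auto
  then have "\<forall>\<^sub>F N in sequentially. ?F (1 / d) N - ?F d N < r / 2"
    using \<open>r > 0\<close> by (intro order_tendstoD(2)) auto
  then show "\<forall>\<^sub>F N in sequentially. dist (expectation (\<lambda>\<omega>. wt N (X (a N) \<omega>) * damp N (X (a N) \<omega>))) 0 < r"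
  proof eventually_elim
    case (elim N)
    note iF = integrable_wt_mult[OF low_meas[of N "1 / d"] low_bounds] integrable_wt_mult[OF low_meas[of N d] low_bounds]
    have "damp N z \<le> d + (low N (1 / d) z - low N d z)" for z
    proof -
      have d1: "1 < 1 / d" using d by simp
      consider "amp N z \<le> d" | "d < amp N z" "amp N z \<le> 1 / d" | "1 / d < amp N z" by linarith
      then show ?thesis
      proof cases
        case 1
        then have "amp N z \<le> 1 / d" using d d1 by linarith
        then have "low N (1 / d) z = 1" unfolding low_def by (intro indicator_simps(1) CollectI)
        moreover have "low N d z = 1" using 1 unfolding low_def by (intro indicator_simps(1) CollectI)
        ultimately show ?thesis using 1 d by (simp add: damp_def)
      next
        case 2
        then show ?thesis using d damp_bounds[of N z] by (simp add: low_def)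
      next
        case 3
        then have "amp N z > 0" using d1 by linarith
        then have "1 / amp N z \<le> d" using 3 d by (simp add: field_simps)
        moreover have "\<not> amp N z \<le> d" "\<not> amp N z \<le> 1" using 3 d d1 by linarith+
        moreover have "low N (1 / d) z = 0" "low N d z = 0"
          unfolding low_def using 3 \<open>\<not> amp N z \<le> d\<close> by (intro indicator_simps(2); simp only: mem_Collect_eq not_le)+
        ultimately show ?thesis by (simp add: damp_def)
      qed
    qed
    then have le: "wt N z * damp N z \<le> d * wt N z + (wt N z * low N (1 / d) z - wt N z * low N d z)" for z
      using mult_left_mono[of "damp N z" "d + (low N (1 / d) z - low N d z)" "wt N z"] wt_pos[of N z]
      by (simp add: algebra_simps)
    have "expectation (\<lambda>\<omega>. wt N (X (a N) \<omega>) * damp N (X (a N) \<omega>)) \<le>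
      expectation (\<lambda>\<omega>. d * wt N (X (a N) \<omega>) + (wt N (X (a N) \<omega>) * low N (1 / d) (X (a N) \<omega>) - wt N (X (a N) \<omega>) * low N d (X (a N) \<omega>)))"
      by (rule integral_mono[OF integrable_wt_mult _ le])
         (use damp_bounds iF integrable_wt in auto)
    also have "\<dots> = d + (?F (1 / d) N - ?F d N)"
      using iF integrable_wt[of N] expectation_wt[of N] by simp
    also have "\<dots> < r" using d elim by simp
    finally have "expectation (\<lambda>\<omega>. wt N (X (a N) \<omega>) * damp N (X (a N) \<omega>)) < r" .
    moreover have "0 \<le> expectation (\<lambda>\<omega>. wt N (X (a N) \<omega>) * damp N (X (a N) \<omega>))"
      by (intro Bochner_Integration.integral_nonneg mult_nonneg_nonneg less_imp_le[OF wt_pos] damp_bounds)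
    ultimately show ?case by (simp add: dist_real_def)
  qed
qed

text \<open>The growth factor from the earliest to the \<open>k\<close>-th observation time,
  normalised to second moment one.\<close>

definition V :: "nat \<Rightarrow> 'n \<Rightarrow> 'a \<Rightarrow> real" where
  "V N k \<omega> = exp (X (a N + h k) \<omega> - X (a N) \<omega> - psi 2 * h k / 2)"

lemma V_pos: "V N k \<omega> > 0" by (simp add: V_def)

lemma V_meas [measurable]: "V N k \<in> borel_measurable M"
  unfolding V_def by measurable

lemma V_power_eq: "V N k \<omega> ^ q = exp (real q * (X (a N + h k) \<omega> - X (a N) \<omega>) - real q * (psi 2 * h k / 2))"
  by (simp add: V_def exp_of_nat_mult[symmetric] algebra_simps)

text \<open>The increment behind \<open>V N k\<close> is independent of \<open>X (a N)\<close> and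
  stationary, so each moment contributes a constant that does not depend on \<open>N\<close>. This
  reduces every estimate to the law of the amplitude.\<close>

lemma expectation_mult_V_power:
  assumes f[measurable]: "f \<in> borel_measurable borel" and int: "integrable M (\<lambda>\<omega>. f (X (a N) \<omega>))"
  shows "integrable M (\<lambda>\<omega>. f (X (a N) \<omega>) * V N k \<omega> ^ q)"
    and "expectation (\<lambda>\<omega>. f (X (a N) \<omega>) * V N k \<omega> ^ q) =
      expectation (\<lambda>\<omega>. f (X (a N) \<omega>)) * exp (h k * psi (real q) - real q * (psi 2 * h k / 2))"
proof -
  let ?g = "\<lambda>x. exp (real q * x - real q * (psi 2 * h k / 2))"
  note p = increments_integral_prod2[of "a N" "h k" f ?g, OF less_imp_le[OF a_pos] h_nonneg f _ int integrable_tilt[OF h_nonneg]]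
  show "integrable M (\<lambda>\<omega>. f (X (a N) \<omega>) * V N k \<omega> ^ q)"
    unfolding V_power_eq by (rule p(1)) measurable
  have "expectation (\<lambda>\<omega>. f (X (a N) \<omega>) * V N k \<omega> ^ q) = expectation (\<lambda>\<omega>. f (X (a N) \<omega>)) * expectation (\<lambda>\<omega>. ?g (X (h k) \<omega>))"
    unfolding V_power_eq by (rule p(2)) measurable
  then show "expectation (\<lambda>\<omega>. f (X (a N) \<omega>) * V N k \<omega> ^ q) =
      expectation (\<lambda>\<omega>. f (X (a N) \<omega>)) * exp (h k * psi (real q) - real q * (psi 2 * h k / 2))"
    by (simp only: expectation_tilt[OF h_nonneg])
qed

text \<open>The origin of the covariance. Up to the earlier time the two factors multiply to a
  squared growth factor of mean one; from there to the later time a single factor remains, with mean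
  \<open>exp (- \<kappa> * (h k - h j))\<close>.\<close>

lemma expectation_mult_V_V_aux:
  assumes f[measurable]: "f \<in> borel_measurable borel" and int: "integrable M (\<lambda>\<omega>. f (X (a N) \<omega>))"
    and le: "h j \<le> h k"
  shows "integrable M (\<lambda>\<omega>. f (X (a N) \<omega>) * (V N j \<omega> * V N k \<omega>))"
    and "expectation (\<lambda>\<omega>. f (X (a N) \<omega>) * (V N j \<omega> * V N k \<omega>)) =
      expectation (\<lambda>\<omega>. f (X (a N) \<omega>)) * exp (- \<kappa> * \<bar>h k - h j\<bar>)"
proof -
  let ?g = "\<lambda>x. exp (2 * x - psi 2 * h j)" and ?g' = "\<lambda>x. exp (1 * x - psi 2 * (h k - h j) / 2)"
  have d: "0 \<le> h k - h j" using le by simp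
  have r: "0 \<le> a N" using a_pos[of N] by simp
  note p = increments_integral_prod3[OF r h_nonneg[of j] d, of f ?g ?g', OF f _ _ int integrable_tilt[OF h_nonneg] integrable_tilt[OF d]]
  have eq: "V N j \<omega> * V N k \<omega> = ?g (X (a N + h j) \<omega> - X (a N) \<omega>) * ?g' (X (a N + h j + (h k - h j)) \<omega> - X (a N + h j) \<omega>)" for \<omega>
    unfolding V_def by (simp only: exp_add[symmetric]) (simp add: algebra_simps diff_divide_distrib)
  show "integrable M (\<lambda>\<omega>. f (X (a N) \<omega>) * (V N j \<omega> * V N k \<omega>))"
    unfolding eq mult.assoc[symmetric] by (rule p(1)) measurable
  have "expectation (\<lambda>\<omega>. f (X (a N) \<omega>) * (V N j \<omega> * V N k \<omega>)) =
     expectation (\<lambda>\<omega>. f (X (a N) \<omega>)) * expectation (\<lambda>\<omega>. ?g (X (h j) \<omega>)) * expectation (\<lambda>\<omega>. ?g' (X (h k - h j) \<omega>))"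
    unfolding eq mult.assoc[symmetric, of "f _"] by (rule p(2)) measurable
  also have "\<dots> = expectation (\<lambda>\<omega>. f (X (a N) \<omega>)) * exp (h j * psi 2 - psi 2 * h j) * exp ((h k - h j) * psi 1 - psi 2 * (h k - h j) / 2)"
    by (simp only: expectation_tilt[OF h_nonneg] expectation_tilt[OF d])
  also have "(h k - h j) * psi 1 - psi 2 * (h k - h j) / 2 = - \<kappa> * \<bar>h k - h j\<bar>"
    using d by (simp add: \<kappa>_def algebra_simps)
  finally show "expectation (\<lambda>\<omega>. f (X (a N) \<omega>) * (V N j \<omega> * V N k \<omega>)) =
      expectation (\<lambda>\<omega>. f (X (a N) \<omega>)) * exp (- \<kappa> * \<bar>h k - h j\<bar>)" by (simp add: mult.commute)
qed

lemma expectation_mult_V_V: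
  assumes "f \<in> borel_measurable borel" and "integrable M (\<lambda>\<omega>. f (X (a N) \<omega>))"
  shows "integrable M (\<lambda>\<omega>. f (X (a N) \<omega>) * (V N j \<omega> * V N k \<omega>))"
    and "expectation (\<lambda>\<omega>. f (X (a N) \<omega>) * (V N j \<omega> * V N k \<omega>)) =
      expectation (\<lambda>\<omega>. f (X (a N) \<omega>)) * exp (- \<kappa> * \<bar>h k - h j\<bar>)"
  using expectation_mult_V_V_aux[OF assms, of j k] expectation_mult_V_V_aux[OF assms, of k j]
  by (cases "h j \<le> h k"; simp add: mult.commute[of "V N j _"] abs_minus_commute)+

end

section \<open>The limit for one uncentred summand\<close>

context critical_levy
begin

text \<open>By \<open>A_eq\<close> this is \<open>exp (X t)\<close> at \<open>t = a N + h k\<close>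
  divided by the root of \<open>N\<close> times its second moment. The product form separates the
  amplitude, which decides between the regimes, from a growth factor independent of it.\<close>

definition A :: "nat \<Rightarrow> 'n \<Rightarrow> 'a \<Rightarrow> real" where
  "A N k \<omega> = amp N (X (a N) \<omega>) * V N k \<omega>"

definition W :: "('n \<Rightarrow> real) \<Rightarrow> nat \<Rightarrow> 'a \<Rightarrow> real" where
  "W u N \<omega> = (\<Sum>k\<in>UNIV. u k * A N k \<omega>)"

definition covq :: "('n \<Rightarrow> real) \<Rightarrow> real" where
  "covq u = (\<Sum>j\<in>UNIV. \<Sum>k\<in>UNIV. u j * exp (- \<kappa> * \<bar>h k - h j\<bar>) * u k)"

lemma A_meas [measurable]: "A N k \<in> borel_measurable M"
  unfolding A_def by measurable

lemma W_meas [measurable]: "W u N \<in> borel_measurable M"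
  unfolding W_def by measurable

lemma A_nonneg: "0 \<le> A N k \<omega>"
  unfolding A_def using amp_nonneg V_pos by (intro mult_nonneg_nonneg) (auto intro: less_imp_le)

lemma A_eq: "A N k \<omega> = exp (1 * X (a N + h k) \<omega> - psi 2 * (a N + h k) / 2) / sqrt (real N)"
  unfolding A_def amp_def V_def times_divide_eq_left
  by (simp only: exp_add[symmetric]) (simp add: algebra_simps add_divide_distrib)

lemma A_power2: "N > 0 \<Longrightarrow> real N * (A N k \<omega>)\<^sup>2 = exp (2 * X (a N + h k) \<omega> - psi 2 * (a N + h k))"
  unfolding A_eq by (simp add: power_divide exp_double[symmetric] algebra_simps)

lemma ah_nonneg: "0 \<le> a N + h k"
  using a_pos[of N] h_nonneg[of k] by simp

lemma integrable_A: "integrable M (A N k)"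
  unfolding A_eq[abs_def] by (intro integrable_divide integrable_tilt ah_nonneg)

lemma expectation_A: "expectation (A N k) = exp (- \<kappa> * (a N + h k)) / sqrt (real N)"
proof -
  have "expectation (A N k) = exp ((a N + h k) * psi 1 - psi 2 * (a N + h k) / 2) / sqrt (real N)"
    unfolding A_eq[abs_def] by (simp only: integral_divide_zero expectation_tilt[OF ah_nonneg])
  also have "(a N + h k) * psi 1 - psi 2 * (a N + h k) / 2 = - \<kappa> * (a N + h k)"
    by (simp add: \<kappa>_def algebra_simps)
  finally show ?thesis .
qed

lemma integrable_A2: "integrable M (\<lambda>\<omega>. real N * (A N k \<omega>)\<^sup>2)"
  by (cases "N > 0") (simp_all add: A_power2 integrable_tilt[OF ah_nonneg])

lemma expectation_A2: "N > 0 \<Longrightarrow> expectation (\<lambda>\<omega>. real N * (A N k \<omega>)\<^sup>2) = 1"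
  by (simp only: A_power2 expectation_tilt[OF ah_nonneg]) (simp add: mult.commute)

lemma integrable_iexp_rem:
  assumes "integrable M f"
  shows "integrable M (\<lambda>\<omega>. iexp_rem (f \<omega>))"
proof (rule Bochner_Integration.integrable_bound)
  show "integrable M (\<lambda>\<omega>. 2 * f \<omega>)" using assms by simp
  show "AE \<omega> in M. norm (iexp_rem (f \<omega>)) \<le> norm (2 * f \<omega>)"
    using iexp_rem_le1 by (auto simp: abs_mult)
qed (use assms in measurable)

text \<open>The sum is bounded by the largest \<open>v k\<close> times the total weight, and the
  power of that largest value is one of the terms on the right. It is applied with
  \<open>q = 3\<close> and \<open>q = 1\<close>.\<close>

lemma abs_weighted_sum_power_le:
  fixes u v :: "'n \<Rightarrow> real"
  assumes "\<And>k. 0 \<le> v k"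
  shows "\<bar>\<Sum>k\<in>UNIV. u k * v k\<bar> ^ q \<le> (\<Sum>k\<in>UNIV. \<bar>u k\<bar>) ^ q * (\<Sum>k\<in>UNIV. v k ^ q)"
proof -
  have "Max (range v) \<in> range v" by (rule Max_in) auto
  then obtain k0 where k0: "Max (range v) = v k0" by blast
  have le: "v k \<le> v k0" for k unfolding k0[symmetric] by (rule Max_ge) auto
  have "\<bar>\<Sum>k\<in>UNIV. u k * v k\<bar> \<le> (\<Sum>k\<in>UNIV. \<bar>u k * v k\<bar>)" by (rule sum_abs)
  also have "\<dots> \<le> (\<Sum>k\<in>UNIV. \<bar>u k\<bar> * v k0)"
    using le assms by (intro sum_mono) (auto simp: abs_mult intro!: mult_left_mono)
  also have "\<dots> = (\<Sum>k\<in>UNIV. \<bar>u k\<bar>) * v k0" by (rule sum_distrib_right[symmetric])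
  finally have "\<bar>\<Sum>k\<in>UNIV. u k * v k\<bar> ^ q \<le> ((\<Sum>k\<in>UNIV. \<bar>u k\<bar>) * v k0) ^ q"
    by (rule power_mono) simp
  also have "\<dots> = (\<Sum>k\<in>UNIV. \<bar>u k\<bar>) ^ q * v k0 ^ q" by (rule power_mult_distrib)
  also have "\<dots> \<le> (\<Sum>k\<in>UNIV. \<bar>u k\<bar>) ^ q * (\<Sum>k\<in>UNIV. v k ^ q)"
    using assms by (intro mult_left_mono member_le_sum zero_le_power sum_nonneg) auto
  finally show ?thesis .
qed

text \<open>Write \<open>W = x * r\<close> with \<open>x\<close> the amplitude, so that
  \<open>N = w / x^2\<close> with the tilted density \<open>w\<close>. For \<open>x \<le> 1\<close>,
  replacing the remainder by \<open>- w * r^2 / 2\<close> costs at most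
  \<open>w * x * \<bar>r\<bar>^3 / 6\<close>; for \<open>x > 1\<close> the remainder itself is at
  most \<open>2 * w * \<bar>r\<bar> / x\<close>. Both costs carry \<open>w * damp\<close>, whose
  mean vanishes, while the replacement has mean exactly \<open>F N * covq u / 2\<close> up to
  sign.\<close>

lemma iexp_rem_W_limit:
  "(\<lambda>N. of_nat N * (\<integral>\<omega>. iexp_rem (W u N \<omega>) \<partial>M)) \<longlonglongrightarrow> of_real (- (std_normal_cdf \<theta> * covq u) / 2)"
proof -
  define U where "U = (\<Sum>k\<in>UNIV. \<bar>u k\<bar>)"
  have U0: "U \<ge> 0" unfolding U_def by (simp add: sum_nonneg)
  define R where "R N \<omega> = (\<Sum>k\<in>UNIV. u k * V N k \<omega>)" for N \<omega>
  define w where "w N \<omega> = wt N (X (a N) \<omega>)" for N \<omega>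
  define l where "l N \<omega> = low N 1 (X (a N) \<omega>)" for N \<omega>
  define d where "d N \<omega> = damp N (X (a N) \<omega>)" for N \<omega>
  define F where "F N = expectation (\<lambda>\<omega>. w N \<omega> * l N \<omega>)" for N
  define D where "D N = expectation (\<lambda>\<omega>. w N \<omega> * d N \<omega>)" for N
  define c where "c q k = exp (h k * psi (real q) - real q * (psi 2 * h k / 2))" for q k
  \<comment> \<open>\<open>C\<close> gathers the third moments of the growth factors from the
    small-amplitude regime and the first moments from the large one.\<close>
  define C where "C = (\<Sum>k\<in>UNIV. U ^ 3 * c 3 k + 2 * U * c 1 k)"
  have WR: "W u N \<omega> = amp N (X (a N) \<omega>) * R N \<omega>" for N \<omega>
    unfolding W_def A_def R_def by (simp add: sum_distrib_left mult_ac)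
  have pt: "cmod (of_nat N * iexp_rem (W u N \<omega>) + of_real (w N \<omega> * l N \<omega> * (R N \<omega>)\<^sup>2 / 2))
      \<le> (\<Sum>k\<in>UNIV. U ^ 3 * (w N \<omega> * d N \<omega> * V N k \<omega> ^ 3) + 2 * U * (w N \<omega> * d N \<omega> * V N k \<omega> ^ 1))" if "N > 0" for N \<omega>
  proof -
    let ?x = "amp N (X (a N) \<omega>)" and ?r = "R N \<omega>"
    have x: "?x > 0" "real N * ?x\<^sup>2 = w N \<omega>" using amp_pos wt_amp that by (auto simp: w_def)
    have w0: "w N \<omega> > 0" "d N \<omega> \<ge> 0" unfolding w_def d_def using wt_pos damp_bounds by auto
    have R3: "\<bar>?r\<bar> ^ 3 \<le> U ^ 3 * (\<Sum>k\<in>UNIV. V N k \<omega> ^ 3)" and R1: "\<bar>?r\<bar> ^ 1 \<le> U ^ 1 * (\<Sum>k\<in>UNIV. V N k \<omega> ^ 1)"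
      unfolding R_def U_def by (rule abs_weighted_sum_power_le, simp add: V_pos less_imp_le)+
    have "cmod (of_nat N * iexp_rem (W u N \<omega>) + of_real (w N \<omega> * l N \<omega> * ?r\<^sup>2 / 2))
      \<le> w N \<omega> * d N \<omega> * (\<bar>?r\<bar> ^ 3 + 2 * \<bar>?r\<bar>)"
    proof (cases "?x \<le> 1")
      case True
      then have l1: "l N \<omega> = 1" and dx: "d N \<omega> = ?x" by (simp_all add: l_def low_def d_def damp_def)
      have "w N \<omega> * l N \<omega> * ?r\<^sup>2 / 2 = real N * ((W u N \<omega>)\<^sup>2 / 2)"
        unfolding l1 x(2)[symmetric] WR by (simp add: power_mult_distrib)
      then have "of_nat N * iexp_rem (W u N \<omega>) + of_real (w N \<omega> * l N \<omega> * ?r\<^sup>2 / 2)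
        = of_nat N * (iexp_rem (W u N \<omega>) + of_real ((W u N \<omega>)\<^sup>2 / 2))"
        by (simp add: distrib_left)
      then have "cmod (of_nat N * iexp_rem (W u N \<omega>) + of_real (w N \<omega> * l N \<omega> * ?r\<^sup>2 / 2)) =
         real N * cmod (iexp_rem (W u N \<omega>) + of_real ((W u N \<omega>)\<^sup>2 / 2))"
        by (simp add: norm_mult)
      also have "\<dots> \<le> real N * (\<bar>W u N \<omega>\<bar> ^ 3 / 6)"
        by (intro mult_left_mono iexp_rem_approx) auto
      also have "\<dots> = (real N * ?x\<^sup>2) * ?x * (\<bar>?r\<bar> ^ 3 / 6)"
        unfolding WR using x(1) by (simp add: abs_mult power_mult_distrib power3_eq_cube power2_eq_square)
      also have "\<dots> = w N \<omega> * d N \<omega> * (\<bar>?r\<bar> ^ 3 / 6)" unfolding x(2) dx ..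
      also have "\<dots> \<le> w N \<omega> * d N \<omega> * (\<bar>?r\<bar> ^ 3 + 2 * \<bar>?r\<bar>)"
        using w0 by (intro mult_left_mono) auto
      finally show ?thesis .
    next
      case False
      then have l1: "l N \<omega> = 0" and dx: "d N \<omega> = 1 / ?x" by (simp_all add: l_def low_def d_def damp_def)
      have "cmod (of_nat N * iexp_rem (W u N \<omega>) + of_real (w N \<omega> * l N \<omega> * ?r\<^sup>2 / 2)) = real N * cmod (iexp_rem (W u N \<omega>))"
        by (simp add: l1 norm_mult)
      also have "\<dots> \<le> real N * (2 * \<bar>W u N \<omega>\<bar>)"
        by (intro mult_left_mono iexp_rem_le1) auto
      also have "\<dots> = (real N * ?x\<^sup>2) * (1 / ?x) * (2 * \<bar>?r\<bar>)"
        unfolding WR using x(1) by (simp add: abs_mult power2_eq_square)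
      also have "\<dots> = w N \<omega> * d N \<omega> * (2 * \<bar>?r\<bar>)" unfolding x(2) dx ..
      also have "\<dots> \<le> w N \<omega> * d N \<omega> * (\<bar>?r\<bar> ^ 3 + 2 * \<bar>?r\<bar>)"
        using w0 by (intro mult_left_mono) auto
      finally show ?thesis .
    qed
    also have "\<dots> \<le> w N \<omega> * d N \<omega> * (U ^ 3 * (\<Sum>k\<in>UNIV. V N k \<omega> ^ 3) + 2 * (U * (\<Sum>k\<in>UNIV. V N k \<omega> ^ 1)))"
      using R3 R1 w0 by (intro mult_left_mono add_mono) auto
    also have "\<dots> = (\<Sum>k\<in>UNIV. U ^ 3 * (w N \<omega> * d N \<omega> * V N k \<omega> ^ 3) + 2 * U * (w N \<omega> * d N \<omega> * V N k \<omega> ^ 1))"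
      unfolding sum.distrib sum_distrib_left[symmetric] by (simp add: algebra_simps)
    finally show ?thesis .
  qed
  have wd_meas: "(\<lambda>z. wt N z * damp N z) \<in> borel_measurable borel" "(\<lambda>z. wt N z * low N 1 z) \<in> borel_measurable borel" for N
    by measurable
  have wd_int: "integrable M (\<lambda>\<omega>. wt N (X (a N) \<omega>) * damp N (X (a N) \<omega>))" "integrable M (\<lambda>\<omega>. wt N (X (a N) \<omega>) * low N 1 (X (a N) \<omega>))" for N
    by (intro integrable_wt_mult damp_bounds low_bounds; measurable)+
  have IV: "integrable M (\<lambda>\<omega>. w N \<omega> * d N \<omega> * V N k \<omega> ^ q)"
     "expectation (\<lambda>\<omega>. w N \<omega> * d N \<omega> * V N k \<omega> ^ q) = D N * c q k" for N k q
    using expectation_mult_V_power[OF wd_meas(1) wd_int(1), of N k q] unfolding w_def d_def D_def c_def by auto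
  have IVV: "integrable M (\<lambda>\<omega>. w N \<omega> * l N \<omega> * (V N j \<omega> * V N k \<omega>))"
     "expectation (\<lambda>\<omega>. w N \<omega> * l N \<omega> * (V N j \<omega> * V N k \<omega>)) = F N * exp (- \<kappa> * \<bar>h k - h j\<bar>)" for N j k
    using expectation_mult_V_V[OF wd_meas(2) wd_int(2), of N j k] unfolding w_def l_def F_def by auto
  have R2: "w N \<omega> * l N \<omega> * (R N \<omega>)\<^sup>2 / 2 = (\<Sum>j\<in>UNIV. \<Sum>k\<in>UNIV. u j * u k / 2 * (w N \<omega> * l N \<omega> * (V N j \<omega> * V N k \<omega>)))" for N \<omega>
    unfolding R_def power2_eq_square sum_product
    unfolding sum_distrib_left sum_divide_distrib
    by (intro sum.cong refl) (simp add: mult_ac)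
  have R2int: "integrable M (\<lambda>\<omega>. w N \<omega> * l N \<omega> * (R N \<omega>)\<^sup>2 / 2)" for N
    unfolding R2 by (intro Bochner_Integration.integrable_sum integrable_mult_right IVV)
  have R2exp: "expectation (\<lambda>\<omega>. w N \<omega> * l N \<omega> * (R N \<omega>)\<^sup>2 / 2) = F N * covq u / 2" for N
  proof -
    have "expectation (\<lambda>\<omega>. w N \<omega> * l N \<omega> * (R N \<omega>)\<^sup>2 / 2) =
        (\<Sum>j\<in>UNIV. \<Sum>k\<in>UNIV. u j * u k / 2 * (F N * exp (- \<kappa> * \<bar>h k - h j\<bar>)))"
      unfolding R2 by (simp add: IVV)
    also have "\<dots> = F N * covq u / 2"
      unfolding covq_def sum_distrib_left sum_divide_distrib by (intro sum.cong refl) (simp add: mult_ac)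
    finally show ?thesis .
  qed
  have gint: "integrable M (\<lambda>\<omega>. iexp_rem (W u N \<omega>))" for N
    unfolding W_def by (intro integrable_iexp_rem Bochner_Integration.integrable_sum integrable_mult_right integrable_A)
  have bound: "cmod (of_nat N * (\<integral>\<omega>. iexp_rem (W u N \<omega>) \<partial>M) + of_real (F N * covq u / 2)) \<le> D N * C" if "N > 0" for N
  proof -
    have "of_nat N * (\<integral>\<omega>. iexp_rem (W u N \<omega>) \<partial>M) + of_real (F N * covq u / 2) =
      (\<integral>\<omega>. of_nat N * iexp_rem (W u N \<omega>) \<partial>M) + (\<integral>\<omega>. of_real (w N \<omega> * l N \<omega> * (R N \<omega>)\<^sup>2 / 2) \<partial>M)"
      by (simp only: integral_mult_right_zero integral_complex_of_real R2exp)
    also have "\<dots> = (\<integral>\<omega>. of_nat N * iexp_rem (W u N \<omega>) + of_real (w N \<omega> * l N \<omega> * (R N \<omega>)\<^sup>2 / 2) \<partial>M)"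
      by (rule Bochner_Integration.integral_add[symmetric]) (intro integrable_mult_right gint integrable_of_real R2int)+
    finally have eq: "of_nat N * (\<integral>\<omega>. iexp_rem (W u N \<omega>) \<partial>M) + of_real (F N * covq u / 2) =
      (\<integral>\<omega>. of_nat N * iexp_rem (W u N \<omega>) + of_real (w N \<omega> * l N \<omega> * (R N \<omega>)\<^sup>2 / 2) \<partial>M)" .
    have "cmod (\<integral>\<omega>. of_nat N * iexp_rem (W u N \<omega>) + of_real (w N \<omega> * l N \<omega> * (R N \<omega>)\<^sup>2 / 2) \<partial>M) \<le>
      (\<integral>\<omega>. (\<Sum>k\<in>UNIV. U ^ 3 * (w N \<omega> * d N \<omega> * V N k \<omega> ^ 3) + 2 * U * (w N \<omega> * d N \<omega> * V N k \<omega> ^ 1)) \<partial>M)"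
      by (rule norm_integral_le[OF _ pt[OF that]])
         (intro Bochner_Integration.integrable_sum Bochner_Integration.integrable_add integrable_mult_right IV)
    also have "\<dots> = (\<Sum>k\<in>UNIV. U ^ 3 * (D N * c 3 k) + 2 * U * (D N * c 1 k))"
      by (simp only: Bochner_Integration.integral_sum Bochner_Integration.integral_add Bochner_Integration.integrable_add
          integrable_mult_right integral_mult_right_zero IV)
    also have "\<dots> = D N * C"
      unfolding C_def sum_distrib_left by (intro sum.cong refl) (simp add: algebra_simps)
    finally show ?thesis unfolding eq .
  qed
  have D0: "D \<longlonglongrightarrow> 0"
    using tilted_damp_tendsto_0 unfolding D_def w_def d_def .
  have F0: "F \<longlonglongrightarrow> std_normal_cdf \<theta>"
    using tilted_amp_cdf[of 1] unfolding F_def w_def l_def by simp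
  have "(\<lambda>N. of_nat N * (\<integral>\<omega>. iexp_rem (W u N \<omega>) \<partial>M) + of_real (F N * covq u / 2)) \<longlonglongrightarrow> 0"
  proof (rule Lim_null_comparison)
    show "\<forall>\<^sub>F N in sequentially. cmod (of_nat N * (\<integral>\<omega>. iexp_rem (W u N \<omega>) \<partial>M) + of_real (F N * covq u / 2)) \<le> D N * C"
      using eventually_gt_at_top[of "0::nat"] by eventually_elim (rule bound)
    show "(\<lambda>N. D N * C) \<longlonglongrightarrow> 0" by (rule tendsto_mult_left_zero[OF D0])
  qed
  moreover have "(\<lambda>N. complex_of_real (F N * covq u / 2)) \<longlonglongrightarrow> of_real (std_normal_cdf \<theta> * covq u / 2)"
    by (intro tendsto_of_real tendsto_intros F0) simp
  ultimately have "(\<lambda>N. of_nat N * (\<integral>\<omega>. iexp_rem (W u N \<omega>) \<partial>M) + of_real (F N * covq u / 2) - of_real (F N * covq u / 2))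
    \<longlonglongrightarrow> 0 - of_real (std_normal_cdf \<theta> * covq u / 2)"
    by (rule tendsto_diff)
  then show ?thesis by simp
qed

section \<open>Exact centring and normalisation of one summand\<close>

definition Y :: "('n \<Rightarrow> real) \<Rightarrow> nat \<Rightarrow> 'a \<Rightarrow> real" where
  "Y u N \<omega> = (\<Sum>k\<in>UNIV. u k * ((exp (X (a N + h k) \<omega>) - expectation (\<lambda>\<omega>. exp (X (a N + h k) \<omega>)))
      / sqrt (real N * variance (\<lambda>\<omega>. exp (X (a N + h k) \<omega>)))))"

text \<open>The factored form shows the variance as the second moment reduced by the relative amount
  \<open>exp (- 2 * \<kappa> * t)\<close>.\<close>

lemma variance_exp:
  assumes "0 \<le> t"
  shows "variance (\<lambda>\<omega>. exp (X t \<omega>)) = exp (t * psi 2) * (1 - exp (- 2 * \<kappa> * t))"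
proof -
  have [measurable]: "X t \<in> borel_measurable M" using assms by (rule X_meas)
  have i: "integrable M (\<lambda>\<omega>. exp (X t \<omega>))" using integrable_exp[OF assms, of 1] by simp
  have sq: "(exp (X t \<omega>))\<^sup>2 = exp (2 * X t \<omega>)" for \<omega> by (simp add: exp_double)
  have i2: "integrable M (\<lambda>\<omega>. (exp (X t \<omega>))\<^sup>2)" unfolding sq by (rule integrable_exp[OF assms])
  have "variance (\<lambda>\<omega>. exp (X t \<omega>)) = expectation (\<lambda>\<omega>. exp (2 * X t \<omega>)) - (expectation (\<lambda>\<omega>. exp (1 * X t \<omega>)))\<^sup>2"
    using variance_eq[OF i i2] unfolding sq by simp
  also have "\<dots> = exp (t * psi 2) - exp (2 * (t * psi 1))"
    by (simp only: mgf_eq[OF assms] exp_double[of "t * psi 1"])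
  also have "\<dots> = exp (t * psi 2) - exp (t * psi 2) * exp (- 2 * \<kappa> * t)"
    by (simp only: exp_add[symmetric]) (simp add: \<kappa>_def algebra_simps)
  finally show ?thesis by (simp add: right_diff_distrib)
qed

text \<open>\<open>\<rho>\<close> is the root second moment of \<open>exp (X t)\<close> over its
  standard deviation at \<open>t = a N + h k\<close>, and \<open>\<epsilon>\<close> is its mean over
  the root second moment. They measure the normalising and centring corrections separating
  \<open>A\<close> from the true summand.\<close>

definition \<rho> :: "nat \<Rightarrow> 'n \<Rightarrow> real" where
  "\<rho> N k = 1 / sqrt (1 - exp (- 2 * \<kappa> * (a N + h k)))"

definition \<epsilon> :: "nat \<Rightarrow> 'n \<Rightarrow> real" where
  "\<epsilon> N k = exp (- \<kappa> * (a N + h k))"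

lemma Y_eq:
  assumes "N > 0"
  shows "Y u N \<omega> = (\<Sum>k\<in>UNIV. u k * (\<rho> N k * (A N k \<omega> - \<epsilon> N k / sqrt (real N))))"
  unfolding Y_def
proof (intro sum.cong refl)
  fix k :: 'n
  let ?t = "a N + h k"
  have e: "expectation (\<lambda>\<omega>. exp (X ?t \<omega>)) = exp (?t * psi 1)"
    using mgf_eq[OF ah_nonneg[of N k], of 1] by simp
  have s: "sqrt (real N * variance (\<lambda>\<omega>. exp (X ?t \<omega>))) = sqrt (real N) * (exp (psi 2 * ?t / 2) * sqrt (1 - exp (- 2 * \<kappa> * ?t)))"
  proof -
    have "exp (?t * psi 2) = (exp (psi 2 * ?t / 2))\<^sup>2" by (simp add: exp_double[symmetric] mult.commute)
    then have "sqrt (exp (?t * psi 2)) = exp (psi 2 * ?t / 2)" by simp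
    then show ?thesis unfolding variance_exp[OF ah_nonneg] by (simp only: real_sqrt_mult)
  qed
  have p1: "exp (X ?t \<omega>) / exp (psi 2 * ?t / 2) / sqrt (real N) = A N k \<omega>"
    unfolding A_eq by (simp only: exp_diff mult_1)
  have p2: "exp (?t * psi 1) / exp (psi 2 * ?t / 2) = \<epsilon> N k"
    unfolding \<epsilon>_def exp_diff[symmetric] by (simp add: \<kappa>_def algebra_simps)
  have "(exp (X ?t \<omega>) - exp (?t * psi 1)) / (sqrt (real N) * (exp (psi 2 * ?t / 2) * sqrt (1 - exp (- 2 * \<kappa> * ?t))))
     = \<rho> N k * (exp (X ?t \<omega>) / exp (psi 2 * ?t / 2) / sqrt (real N) - exp (?t * psi 1) / exp (psi 2 * ?t / 2) / sqrt (real N))"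
    unfolding \<rho>_def by (simp add: diff_divide_distrib mult_ac)
  then have eq: "(exp (X ?t \<omega>) - exp (?t * psi 1)) / (sqrt (real N) * (exp (psi 2 * ?t / 2) * sqrt (1 - exp (- 2 * \<kappa> * ?t))))
     = \<rho> N k * (A N k \<omega> - \<epsilon> N k / sqrt (real N))"
    unfolding p1 p2 .
  show "u k * ((exp (X ?t \<omega>) - expectation (\<lambda>\<omega>. exp (X ?t \<omega>))) / sqrt (real N * variance (\<lambda>\<omega>. exp (X ?t \<omega>)))) =
    u k * (\<rho> N k * (A N k \<omega> - \<epsilon> N k / sqrt (real N)))"
    by (subst s, subst e, subst eq, rule refl)
qed

lemma Y_fun_eq:
  "N > 0 \<Longrightarrow> Y u N = (\<lambda>\<omega>. \<Sum>k\<in>UNIV. u k * (\<rho> N k * (A N k \<omega> - \<epsilon> N k / sqrt (real N))))"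
  by (rule ext) (rule Y_eq)

lemma integrable_Y: "N > 0 \<Longrightarrow> integrable M (Y u N)"
  by (simp only: Y_fun_eq)
     (intro Bochner_Integration.integrable_sum integrable_mult_right Bochner_Integration.integrable_diff integrable_A, simp)

lemma expectation_Y: "N > 0 \<Longrightarrow> expectation (Y u N) = 0"
  by (simp add: Y_fun_eq integrable_A expectation_A \<epsilon>_def prob_space)

lemma epsilon_lim: "(\<lambda>N. \<epsilon> N k) \<longlonglongrightarrow> 0"
proof -
  have "filterlim (\<lambda>N. h k + a N) at_top sequentially"
    by (rule filterlim_tendsto_add_at_top[OF tendsto_const a_top])
  then have "filterlim (\<lambda>N. \<kappa> * (h k + a N)) at_top sequentially"
    by (rule filterlim_tendsto_pos_mult_at_top[OF tendsto_const kappa_pos])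
  then have "filterlim (\<lambda>N. - (\<kappa> * (h k + a N))) at_bot sequentially"
    by (simp add: filterlim_uminus_at_bot)
  from filterlim_compose[OF exp_at_bot this] show ?thesis
    by (simp add: \<epsilon>_def add.commute)
qed

lemma rho_eq: "\<rho> N k = 1 / sqrt (1 - (\<epsilon> N k)\<^sup>2)"
  unfolding \<rho>_def \<epsilon>_def by (simp add: exp_double[symmetric] mult.assoc)

lemma rho_lim: "(\<lambda>N. \<rho> N k) \<longlonglongrightarrow> 1"
proof -
  have "(\<lambda>N. 1 / sqrt (1 - (\<epsilon> N k)\<^sup>2)) \<longlonglongrightarrow> 1 / sqrt (1 - 0\<^sup>2)"
    by (intro tendsto_intros epsilon_lim) simp
  then show ?thesis by (simp add: rho_eq)
qed

text \<open>\<open>Y - W\<close> is at most \<open>\<delta> N\<close> times a multiple of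
  \<open>S N\<close>, so \<open>iexp_rem_diff\<close> bounds the difference by
  \<open>\<delta> * (\<delta> + 1)\<close> times \<open>S^2\<close> up to a constant. Since
  \<open>N * A^2\<close> has mean one, \<open>N * S^2\<close> has bounded mean, and
  \<open>\<delta>\<close> tends to \<open>0\<close>.\<close>

lemma iexp_rem_Y_W_limit:
  "(\<lambda>N. of_nat N * (\<integral>\<omega>. iexp_rem (Y u N \<omega>) \<partial>M) - of_nat N * (\<integral>\<omega>. iexp_rem (W u N \<omega>) \<partial>M)) \<longlonglongrightarrow> 0"
proof -
  define U where "U = (\<Sum>k\<in>UNIV. \<bar>u k\<bar>)"
  define n where "n = real CARD('n)"
  define \<delta> where "\<delta> N = (\<Sum>k\<in>UNIV. \<bar>\<rho> N k - 1\<bar> + \<bar>\<rho> N k * \<epsilon> N k\<bar>)" for N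
  \<comment> \<open>The added \<open>1 / sqrt N\<close> lets \<open>S\<close> dominate the
    deterministic centring term as well as the amplitudes.\<close>
  define S where "S N \<omega> = (\<Sum>k\<in>UNIV. A N k \<omega> + 1 / sqrt (real N))" for N \<omega>
  have U0: "U \<ge> 0" "\<And>k. \<bar>u k\<bar> \<le> U" unfolding U_def by (auto intro!: sum_nonneg member_le_sum)
  have \<delta>0: "\<delta> N \<ge> 0" "\<bar>\<rho> N k - 1\<bar> + \<bar>\<rho> N k * \<epsilon> N k\<bar> \<le> \<delta> N" for N k
    unfolding \<delta>_def by (auto intro!: sum_nonneg member_le_sum)
  have S0: "S N \<omega> \<ge> 0" for N \<omega> unfolding S_def using A_nonneg by (intro sum_nonneg add_nonneg_nonneg) auto
  have bnd: "cmod (iexp_rem (Y u N \<omega>) - iexp_rem (W u N \<omega>)) \<le> \<delta> N * (\<delta> N + 1) * U\<^sup>2 * (S N \<omega>)\<^sup>2" if "N > 0" for N \<omega>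
  proof -
    have "Y u N \<omega> - W u N \<omega> = (\<Sum>k\<in>UNIV. u k * ((\<rho> N k - 1) * A N k \<omega> - \<rho> N k * \<epsilon> N k * (1 / sqrt (real N))))"
      unfolding Y_eq[OF that] W_def sum_subtractf[symmetric] by (intro sum.cong refl) (simp add: algebra_simps)
    then have "\<bar>Y u N \<omega> - W u N \<omega>\<bar> = \<bar>\<Sum>k\<in>UNIV. u k * ((\<rho> N k - 1) * A N k \<omega> - \<rho> N k * \<epsilon> N k * (1 / sqrt (real N)))\<bar>"
      by (rule arg_cong)
    also have "\<dots> \<le> (\<Sum>k\<in>UNIV. \<bar>u k * ((\<rho> N k - 1) * A N k \<omega> - \<rho> N k * \<epsilon> N k * (1 / sqrt (real N)))\<bar>)"
      by (rule sum_abs)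
    also have "\<dots> \<le> (\<Sum>k\<in>UNIV. U * (\<delta> N * (A N k \<omega> + 1 / sqrt (real N))))"
    proof (intro sum_mono)
      fix k
      have "\<bar>(\<rho> N k - 1) * A N k \<omega> - \<rho> N k * \<epsilon> N k * (1 / sqrt (real N))\<bar> \<le> \<bar>(\<rho> N k - 1) * A N k \<omega>\<bar> + \<bar>\<rho> N k * \<epsilon> N k * (1 / sqrt (real N))\<bar>"
        by (rule abs_triangle_ineq4)
      also have "\<dots> = \<bar>\<rho> N k - 1\<bar> * A N k \<omega> + \<bar>\<rho> N k * \<epsilon> N k\<bar> * (1 / sqrt (real N))"
        using A_nonneg[of N k \<omega>] unfolding abs_mult by simp
      also have "\<dots> \<le> \<delta> N * A N k \<omega> + \<delta> N * (1 / sqrt (real N))"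
        using \<delta>0(2)[of N k] A_nonneg[of N k \<omega>] by (intro add_mono mult_right_mono) auto
      also have "\<dots> = \<delta> N * (A N k \<omega> + 1 / sqrt (real N))" by (simp only: distrib_left)
      finally show "\<bar>u k * ((\<rho> N k - 1) * A N k \<omega> - \<rho> N k * \<epsilon> N k * (1 / sqrt (real N)))\<bar> \<le> U * (\<delta> N * (A N k \<omega> + 1 / sqrt (real N)))"
        unfolding abs_mult[of "u k"] using U0 by (intro mult_mono) auto
    qed
    also have "\<dots> = \<delta> N * (U * S N \<omega>)" unfolding S_def sum_distrib_left by (simp add: mult_ac)
    finally have YW: "\<bar>Y u N \<omega> - W u N \<omega>\<bar> \<le> \<delta> N * (U * S N \<omega>)" .
    have "\<bar>W u N \<omega>\<bar> \<le> (\<Sum>k\<in>UNIV. \<bar>u k * A N k \<omega>\<bar>)" unfolding W_def by (rule sum_abs)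
    also have "\<dots> \<le> (\<Sum>k\<in>UNIV. U * (A N k \<omega> + 1 / sqrt (real N)))"
      using U0 A_nonneg by (intro sum_mono) (auto simp: abs_mult intro!: mult_mono)
    also have "\<dots> = U * S N \<omega>" unfolding S_def sum_distrib_left ..
    finally have Wb: "\<bar>W u N \<omega>\<bar> \<le> U * S N \<omega>" .
    have "cmod (iexp_rem (Y u N \<omega>) - iexp_rem (W u N \<omega>)) \<le> \<bar>Y u N \<omega> - W u N \<omega>\<bar> * (\<bar>Y u N \<omega> - W u N \<omega>\<bar> + \<bar>W u N \<omega>\<bar>)"
      by (rule iexp_rem_diff)
    also have "\<dots> \<le> (\<delta> N * (U * S N \<omega>)) * (\<delta> N * (U * S N \<omega>) + U * S N \<omega>)"
      using YW Wb \<delta>0 U0 S0 by (intro mult_mono add_mono) auto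
    also have "\<dots> = \<delta> N * (\<delta> N + 1) * U\<^sup>2 * (S N \<omega>)\<^sup>2"
      by (simp add: power2_eq_square algebra_simps)
    finally show ?thesis .
  qed
  have S2: "real N * (S N \<omega>)\<^sup>2 \<le> (\<Sum>k\<in>UNIV. n * (2 * (real N * (A N k \<omega>)\<^sup>2) + 2))" if "N > 0" for N \<omega>
  proof -
    have "(S N \<omega>)\<^sup>2 \<le> (\<Sum>k\<in>UNIV. (A N k \<omega> + 1 / sqrt (real N))\<^sup>2) * n"
      unfolding S_def n_def by (rule sum_squared_le_sum_of_squares)
    also have "\<dots> \<le> (\<Sum>k\<in>UNIV. 2 * (A N k \<omega>)\<^sup>2 + 2 * (1 / sqrt (real N))\<^sup>2) * n"
    proof (intro mult_right_mono sum_mono)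
      show "(x + y)\<^sup>2 \<le> 2 * x\<^sup>2 + 2 * y\<^sup>2" for x y :: real
        using zero_le_power2[of "x - y"] by (simp add: power2_eq_square algebra_simps)
    qed (simp add: n_def)
    finally have "real N * (S N \<omega>)\<^sup>2 \<le> real N * ((\<Sum>k\<in>UNIV. 2 * (A N k \<omega>)\<^sup>2 + 2 * (1 / sqrt (real N))\<^sup>2) * n)"
      by (rule mult_left_mono) simp
    also have "\<dots> = (\<Sum>k\<in>UNIV. n * (2 * (real N * (A N k \<omega>)\<^sup>2) + 2))"
      unfolding sum_distrib_left sum_distrib_right
      using that by (intro sum.cong refl) (simp add: power_divide algebra_simps)
    finally show ?thesis .
  qed
  have I: "integrable M (\<lambda>\<omega>. \<delta> N * (\<delta> N + 1) * U\<^sup>2 * (\<Sum>k\<in>UNIV. n * (2 * (real N * (A N k \<omega>)\<^sup>2) + 2)))" for N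
    by (intro integrable_mult_right Bochner_Integration.integrable_sum Bochner_Integration.integrable_add integrable_A2) simp
  have bound: "cmod (of_nat N * (\<integral>\<omega>. iexp_rem (Y u N \<omega>) \<partial>M) - of_nat N * (\<integral>\<omega>. iexp_rem (W u N \<omega>) \<partial>M))
     \<le> \<delta> N * (\<delta> N + 1) * U\<^sup>2 * (n * n * 4)" if "N > 0" for N
  proof -
    have iY: "integrable M (\<lambda>\<omega>. of_nat N * iexp_rem (Y u N \<omega>))"
      by (intro integrable_mult_right integrable_iexp_rem integrable_Y that)
    have iW: "integrable M (\<lambda>\<omega>. of_nat N * iexp_rem (W u N \<omega>))"
      unfolding W_def by (intro integrable_mult_right integrable_iexp_rem Bochner_Integration.integrable_sum integrable_A)
    have eq: "of_nat N * (\<integral>\<omega>. iexp_rem (Y u N \<omega>) \<partial>M) - of_nat N * (\<integral>\<omega>. iexp_rem (W u N \<omega>) \<partial>M) =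
      (\<integral>\<omega>. of_nat N * iexp_rem (Y u N \<omega>) - of_nat N * iexp_rem (W u N \<omega>) \<partial>M)"
      unfolding Bochner_Integration.integral_diff[OF iY iW] by simp
    have "cmod (\<integral>\<omega>. of_nat N * iexp_rem (Y u N \<omega>) - of_nat N * iexp_rem (W u N \<omega>) \<partial>M)
       \<le> (\<integral>\<omega>. \<delta> N * (\<delta> N + 1) * U\<^sup>2 * (\<Sum>k\<in>UNIV. n * (2 * (real N * (A N k \<omega>)\<^sup>2) + 2)) \<partial>M)"
    proof (rule norm_integral_le[OF I])
      fix \<omega>
      have "cmod (of_nat N * iexp_rem (Y u N \<omega>) - of_nat N * iexp_rem (W u N \<omega>)) = real N * cmod (iexp_rem (Y u N \<omega>) - iexp_rem (W u N \<omega>))"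
        unfolding right_diff_distrib[symmetric] norm_mult by simp
      also have "\<dots> \<le> real N * (\<delta> N * (\<delta> N + 1) * U\<^sup>2 * (S N \<omega>)\<^sup>2)"
        by (intro mult_left_mono bnd that) simp
      also have "\<dots> = \<delta> N * (\<delta> N + 1) * U\<^sup>2 * (real N * (S N \<omega>)\<^sup>2)" by simp
      also have "\<dots> \<le> \<delta> N * (\<delta> N + 1) * U\<^sup>2 * (\<Sum>k\<in>UNIV. n * (2 * (real N * (A N k \<omega>)\<^sup>2) + 2))"
        using \<delta>0(1)[of N] by (intro mult_left_mono S2 that mult_nonneg_nonneg) auto
      finally show "cmod (of_nat N * iexp_rem (Y u N \<omega>) - of_nat N * iexp_rem (W u N \<omega>)) \<le> \<delta> N * (\<delta> N + 1) * U\<^sup>2 * (\<Sum>k\<in>UNIV. n * (2 * (real N * (A N k \<omega>)\<^sup>2) + 2))" .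
    qed
    also have "\<dots> = \<delta> N * (\<delta> N + 1) * U\<^sup>2 * (\<Sum>k\<in>(UNIV :: 'n set). n * (2 * 1 + 2))"
    proof -
      have E4: "expectation (\<lambda>\<omega>. n * (2 * (real N * (A N k \<omega>)\<^sup>2) + 2)) = n * (2 * 1 + 2)" for k
      proof -
        have "expectation (\<lambda>\<omega>. n * (2 * (real N * (A N k \<omega>)\<^sup>2) + 2)) = n * (2 * expectation (\<lambda>\<omega>. real N * (A N k \<omega>)\<^sup>2) + 2)"
          using integrable_A2[of N k] by (subst integral_mult_right_zero, subst Bochner_Integration.integral_add) (auto simp: prob_space)
        then show ?thesis unfolding expectation_A2[OF that] .
      qed
      have I4: "integrable M (\<lambda>\<omega>. n * (2 * (real N * (A N k \<omega>)\<^sup>2) + 2))" for k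
        by (intro integrable_mult_right Bochner_Integration.integrable_add integrable_A2) simp
      show ?thesis
        by (subst integral_mult_right_zero, subst Bochner_Integration.integral_sum[OF I4]) (simp only: E4)
    qed
    also have "\<dots> = \<delta> N * (\<delta> N + 1) * U\<^sup>2 * (n * n * 4)" by (simp add: n_def)
    finally show ?thesis unfolding eq .
  qed
  have \<delta>lim: "\<delta> \<longlonglongrightarrow> 0"
  proof -
    have "\<delta> \<longlonglongrightarrow> (\<Sum>k\<in>(UNIV::'n set). \<bar>1 - 1\<bar> + \<bar>1 * 0\<bar>)"
      unfolding \<delta>_def by (intro tendsto_intros rho_lim epsilon_lim)
    then show ?thesis by simp
  qed
  show ?thesis
  proof (rule Lim_null_comparison)
    show "\<forall>\<^sub>F N in sequentially. cmod (of_nat N * (\<integral>\<omega>. iexp_rem (Y u N \<omega>) \<partial>M) - of_nat N * (\<integral>\<omega>. iexp_rem (W u N \<omega>) \<partial>M))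
       \<le> \<delta> N * (\<delta> N + 1) * U\<^sup>2 * (n * n * 4)"
      using eventually_gt_at_top[of "0::nat"] by eventually_elim (rule bound)
    have "(\<lambda>N. \<delta> N * (\<delta> N + 1) * U\<^sup>2 * (n * n * 4)) \<longlonglongrightarrow> 0 * (0 + 1) * U\<^sup>2 * (n * n * 4)"
      by (intro tendsto_intros \<delta>lim)
    then show "(\<lambda>N. \<delta> N * (\<delta> N + 1) * U\<^sup>2 * (n * n * 4)) \<longlonglongrightarrow> 0" by simp
  qed
qed

text \<open>The exact centring enters here: because \<open>Y\<close> has mean zero, the linear term
  of the remainder contributes nothing and the limit for \<open>iexp_rem\<close> is that for
  \<open>iexp - 1\<close>.\<close>

lemma char_Y_limit:
  "(\<lambda>N. of_nat N * ((\<integral>\<omega>. iexp (Y u N \<omega>) \<partial>M) - 1)) \<longlonglongrightarrow> of_real (- (std_normal_cdf \<theta> * covq u) / 2)"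
proof -
  have "(\<lambda>N. of_nat N * (\<integral>\<omega>. iexp_rem (Y u N \<omega>) \<partial>M)) \<longlonglongrightarrow> of_real (- (std_normal_cdf \<theta> * covq u) / 2)"
    using tendsto_add[OF iexp_rem_Y_W_limit[of u] iexp_rem_W_limit[of u]] by simp
  moreover have "\<forall>\<^sub>F N in sequentially. of_nat N * (\<integral>\<omega>. iexp_rem (Y u N \<omega>) \<partial>M) = of_nat N * ((\<integral>\<omega>. iexp (Y u N \<omega>) \<partial>M) - 1)"
    using eventually_gt_at_top[of "0::nat"]
  proof eventually_elim
    case (elim N)
    have Ym[measurable]: "Y u N \<in> borel_measurable M" using integrable_Y[OF elim] by simp
    have i1: "integrable M (\<lambda>\<omega>. iexp (Y u N \<omega>))" by (rule integrable_iexp) auto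
    have i3: "integrable M (\<lambda>\<omega>. \<i> * of_real (Y u N \<omega>))"
      by (intro integrable_mult_right integrable_of_real integrable_Y elim)
    have i2: "integrable M (\<lambda>\<omega>. 1 :: complex)" by simp
    have "(\<integral>\<omega>. iexp_rem (Y u N \<omega>) \<partial>M) = (\<integral>\<omega>. iexp (Y u N \<omega>) \<partial>M) - (\<integral>\<omega>. 1 \<partial>M) - \<i> * of_real (expectation (Y u N))"
      unfolding iexp_rem_def Bochner_Integration.integral_diff[OF Bochner_Integration.integrable_diff[OF i1 i2] i3]
        Bochner_Integration.integral_diff[OF i1 i2]
      by simp
    then show ?case by (simp add: expectation_Y[OF elim] prob_space)
  qed
  ultimately show ?thesis by (rule Lim_transform_eventually)
qed

end

section \<open>Sums of independent copies\<close>

lemma (in prob_space) variance_sum_indep: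
  fixes X :: "'i \<Rightarrow> 'a \<Rightarrow> real"
  assumes fin: "finite I" and ind: "indep_vars (\<lambda>_. borel) X I"
    and int: "\<And>i. i \<in> I \<Longrightarrow> integrable M (X i)"
    and int2: "\<And>i. i \<in> I \<Longrightarrow> integrable M (\<lambda>\<omega>. (X i \<omega>)\<^sup>2)"
  shows "variance (\<lambda>\<omega>. \<Sum>i\<in>I. X i \<omega>) = (\<Sum>i\<in>I. variance (X i))"
proof -
  define D where "D i \<omega> = X i \<omega> - expectation (X i)" for i \<omega>
  have D2: "(D i \<omega>)\<^sup>2 = (X i \<omega>)\<^sup>2 - 2 * expectation (X i) * X i \<omega> + (expectation (X i))\<^sup>2" for i \<omega>
    by (simp add: D_def power2_eq_square algebra_simps)
  have iD: "integrable M (D i)" "expectation (D i) = 0" if "i \<in> I" for i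
    using int[OF that] by (simp_all add: D_def[abs_def] prob_space)
  have iD2: "integrable M (\<lambda>\<omega>. (D i \<omega>)\<^sup>2)" if "i \<in> I" for i
    unfolding D2 using int[OF that] int2[OF that] by auto
  have indD: "indep_vars (\<lambda>_. borel) D I"
    unfolding D_def[abs_def] by (rule indep_vars_compose2[OF ind]) auto
  have DD: "integrable M (\<lambda>\<omega>. D i \<omega> * D j \<omega>) \<and> expectation (\<lambda>\<omega>. D i \<omega> * D j \<omega>) = (if i = j then variance (X i) else 0)"
    if ij: "i \<in> I" "j \<in> I" for i j
  proof (cases "i = j")
    case True
    then show ?thesis using iD2[OF ij(1)] by (simp add: power2_eq_square[symmetric] D_def)
  next
    case False
    have *: "indep_vars (\<lambda>_. borel) D {i, j}"
      by (rule indep_vars_subset[OF indD]) (use ij in auto)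
    have **: "integrable M (D k)" if "k \<in> {i, j}" for k using that ij iD by auto
    show ?thesis
      using indep_vars_integrable[OF _ * **] indep_vars_lebesgue_integral[OF _ * **] False iD(2)[OF ij(1)] by simp
  qed
  have "expectation (\<lambda>\<omega>. \<Sum>i\<in>I. X i \<omega>) = (\<Sum>i\<in>I. expectation (X i))"
    using int by (intro Bochner_Integration.integral_sum)
  then have "variance (\<lambda>\<omega>. \<Sum>i\<in>I. X i \<omega>) = expectation (\<lambda>\<omega>. \<Sum>i\<in>I. \<Sum>j\<in>I. D i \<omega> * D j \<omega>)"
    by (simp add: D_def sum_subtractf power2_eq_square sum_product[symmetric])
  also have "\<dots> = (\<Sum>i\<in>I. \<Sum>j\<in>I. expectation (\<lambda>\<omega>. D i \<omega> * D j \<omega>))"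
    using DD by (simp add: Bochner_Integration.integral_sum)
  also have "\<dots> = (\<Sum>i\<in>I. \<Sum>j\<in>I. if i = j then variance (X i) else 0)"
    by (intro sum.cong refl) (simp add: DD)
  also have "\<dots> = (\<Sum>i\<in>I. variance (X i))" using fin by simp
  finally show ?thesis .
qed

text \<open>Every standardised coordinate has second moment at most one, so Markov's inequality for
  the squared norm gives a bound uniform in the underlying law.\<close>

lemma (in prob_space) standardized_tight:
  fixes Z :: "'n::finite \<Rightarrow> 'a \<Rightarrow> real"
  assumes Zm[measurable]: "\<And>k. Z k \<in> borel_measurable M" and "L > 0"
  shows "measure (distr M borel (\<lambda>\<omega>. \<chi> k. (Z k \<omega> - expectation (Z k)) / sqrt (variance (Z k)))) {x. norm x > L}
    \<le> real CARD('n) / L\<^sup>2"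
proof -
  define T where "T k \<omega> = (Z k \<omega> - expectation (Z k)) / sqrt (variance (Z k))" for k \<omega>
  have Tm[measurable]: "T k \<in> borel_measurable M" for k unfolding T_def by measurable
  have T2: "integrable M (\<lambda>\<omega>. (T k \<omega>)\<^sup>2) \<and> expectation (\<lambda>\<omega>. (T k \<omega>)\<^sup>2) \<le> 1" for k
  \<comment> \<open>A zero variance integral, whether from an almost surely constant variable or
    from a non-integrable square, makes the quotient \<open>0\<close>, since division by
    \<open>0\<close> yields \<open>0\<close>. A nonzero integral certifies integrability.\<close>
  proof (cases "variance (Z k) = 0")
    case True
    then have "T k \<omega> = 0" for \<omega> unfolding T_def by (simp only: real_sqrt_zero div_by_0)
    then show ?thesis by simp
  next
    case False
    have eq: "(T k \<omega>)\<^sup>2 = (Z k \<omega> - expectation (Z k))\<^sup>2 / variance (Z k)" for \<omega>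
      unfolding T_def power_divide by (simp only: real_sqrt_pow2[OF variance_positive])
    have "integrable M (\<lambda>\<omega>. (Z k \<omega> - expectation (Z k))\<^sup>2)"
      using False not_integrable_integral_eq by blast
    then show ?thesis unfolding eq using False by simp
  qed
  have nrm: "(norm (\<chi> k. T k \<omega>))\<^sup>2 = (\<Sum>k\<in>UNIV. (T k \<omega>)\<^sup>2)" for \<omega>
    by (simp add: norm_vec_def L2_set_def sum_nonneg)
  have int: "integrable M (\<lambda>\<omega>. \<Sum>k\<in>UNIV. (T k \<omega>)\<^sup>2)" using T2 by auto
  have vm: "(\<lambda>\<omega>. \<chi> k. T k \<omega>) \<in> borel_measurable M"
    by (intro borel_measurable_vec_lambda) measurable
  have "measure (distr M borel (\<lambda>\<omega>. \<chi> k. T k \<omega>)) {x. norm x > L} = measure M {\<omega>\<in>space M. norm (\<chi> k. T k \<omega>) > L}"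
    by (subst measure_distr[OF vm]) (auto intro!: arg_cong[where f = "measure M"])
  also have "\<dots> \<le> measure M {\<omega>\<in>space M. (\<Sum>k\<in>UNIV. (T k \<omega>)\<^sup>2) \<ge> L\<^sup>2}"
  proof (rule finite_measure_mono)
    show "{\<omega>\<in>space M. norm (\<chi> k. T k \<omega>) > L} \<subseteq> {\<omega>\<in>space M. (\<Sum>k\<in>UNIV. (T k \<omega>)\<^sup>2) \<ge> L\<^sup>2}"
    proof clarify
      fix \<omega> assume "L < norm (\<chi> k. T k \<omega>)"
      then have "L\<^sup>2 \<le> (norm (\<chi> k. T k \<omega>))\<^sup>2" using \<open>L > 0\<close> by (intro power_mono) linarith+
      then show "L\<^sup>2 \<le> (\<Sum>k\<in>UNIV. (T k \<omega>)\<^sup>2)" unfolding nrm .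
    qed
  qed measurable
  also have "\<dots> \<le> expectation (\<lambda>\<omega>. \<Sum>k\<in>UNIV. (T k \<omega>)\<^sup>2) / L\<^sup>2"
    by (rule integral_Markov_inequality_measure[OF int, of "{}"]) (use \<open>L > 0\<close> in \<open>auto intro!: sum_nonneg\<close>)
  also have "\<dots> \<le> real CARD('n) / L\<^sup>2"
  proof (rule divide_right_mono)
    have "expectation (\<lambda>\<omega>. \<Sum>k\<in>UNIV. (T k \<omega>)\<^sup>2) = (\<Sum>k\<in>UNIV. expectation (\<lambda>\<omega>. (T k \<omega>)\<^sup>2))"
      using T2 by (intro Bochner_Integration.integral_sum) auto
    also have "\<dots> \<le> (\<Sum>k\<in>(UNIV::'n set). 1)" using T2 by (intro sum_mono) auto
    finally show "expectation (\<lambda>\<omega>. \<Sum>k\<in>UNIV. (T k \<omega>)\<^sup>2) \<le> real CARD('n)" by simp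
  qed simp
  finally show ?thesis by (simp only: T_def)
qed

text \<open>Moving the reference time by the constant \<open>\<tau>\<close> changes the balance by a
  constant, negligible against \<open>sqrt (s N)\<close>. Here \<open>p\<close>, \<open>m\<close>
  and \<open>v\<close> stand for \<open>\<psi>\<close> and its first two derivatives at
  \<open>2\<close>; half of \<open>2 * \<theta>\<close> is what remains because the threshold
  involves \<open>ln N / 2\<close>.\<close>

lemma critical_asymp_shift:
  fixes s a :: "nat \<Rightarrow> real" and m p v \<theta> \<tau> :: real
  assumes v: "v > 0" and s_lim: "filterlim s at_top sequentially"
    and a: "\<forall>\<^sub>F N in sequentially. a N = s N + \<tau>"
    and asymp: "(\<lambda>N. ln (real N) - (2 * m - p) * s N - 2 * \<theta> * sqrt (v * s N)) \<in> o[sequentially](\<lambda>N. sqrt (s N))"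
  shows "(\<lambda>N. (ln (real N) / 2 + p * a N / 2 - m * a N) / sqrt (v * a N)) \<longlonglongrightarrow> \<theta>"
proof -
  define f where "f N = ln (real N) - (2 * m - p) * s N - 2 * \<theta> * sqrt (v * s N)" for N
  define b where "b N = s N + \<tau>" for N
  have b_top: "filterlim b at_top sequentially"
    unfolding b_def add.commute[of _ \<tau>] by (rule filterlim_tendsto_add_at_top[OF tendsto_const s_lim])
  have f0: "(\<lambda>N. f N / sqrt (s N)) \<longlonglongrightarrow> 0"
    unfolding f_def by (rule smalloD_tendsto[OF asymp])
  have ib: "(\<lambda>N. inverse (b N)) \<longlonglongrightarrow> 0" by (rule tendsto_inverse_0_at_top[OF b_top])
  have sb: "filterlim (\<lambda>N. sqrt (b N)) at_top sequentially"
    by (rule filterlim_compose[OF sqrt_at_top b_top])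
  have isb: "(\<lambda>N. inverse (sqrt (b N))) \<longlonglongrightarrow> 0" by (rule tendsto_inverse_0_at_top[OF sb])
  \<comment> \<open>The three terms are the error \<open>f\<close>, the main term and the effect of
    the shift, each divided by \<open>sqrt (v * b N)\<close>. The ratio
    \<open>sqrt (s N) / sqrt (b N)\<close> appears as
    \<open>sqrt (1 - \<tau> * inverse (b N))\<close>, whose limit is immediate.\<close>
  have "(\<lambda>N. f N / sqrt (s N) * sqrt (1 - \<tau> * inverse (b N)) / (2 * sqrt v) + \<theta> * sqrt (1 - \<tau> * inverse (b N))
      - (2 * m - p) * \<tau> / (2 * sqrt v) * inverse (sqrt (b N))) \<longlonglongrightarrow>
     0 * sqrt (1 - \<tau> * 0) / (2 * sqrt v) + \<theta> * sqrt (1 - \<tau> * 0) - (2 * m - p) * \<tau> / (2 * sqrt v) * 0"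
    using v by (intro tendsto_intros f0 ib isb) auto
  moreover have "\<forall>\<^sub>F N in sequentially. f N / sqrt (s N) * sqrt (1 - \<tau> * inverse (b N)) / (2 * sqrt v) + \<theta> * sqrt (1 - \<tau> * inverse (b N))
      - (2 * m - p) * \<tau> / (2 * sqrt v) * inverse (sqrt (b N)) = (ln (real N) / 2 + p * a N / 2 - m * a N) / sqrt (v * a N)"
    using a filterlim_at_top_dense[THEN iffD1, OF s_lim, rule_format, of 0]
      filterlim_at_top_dense[THEN iffD1, OF b_top, rule_format, of 0]
  proof eventually_elim
    case (elim N)
    have ab: "a N = b N" "s N = b N - \<tau>" using elim by (simp_all add: b_def)
    have r: "sqrt (1 - \<tau> * inverse (b N)) = sqrt (s N) / sqrt (b N)"
    proof -
      have "1 - \<tau> * inverse (b N) = s N / b N" using elim ab(2) by (simp add: field_simps)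
      then show ?thesis by (simp add: real_sqrt_divide)
    qed
    define S where "S = sqrt (s N)"
    define B where "B = sqrt (b N)"
    define w where "w = sqrt v"
    have pos: "S > 0" "B > 0" "w > 0" using elim v by (auto simp: S_def B_def w_def)
    have eqn: "ln (real N) / 2 + p * b N / 2 - m * b N = (f N + 2 * \<theta> * (w * S) - (2 * m - p) * \<tau>) / 2"
    proof -
      have "f N = ln (real N) - (2 * m - p) * s N - 2 * \<theta> * (w * S)"
        unfolding f_def S_def w_def real_sqrt_mult ..
      also have "(2 * m - p) * s N = (2 * m - p) * b N - (2 * m - p) * \<tau>"
        unfolding ab(2) by (rule right_diff_distrib)
      finally show ?thesis by (simp add: algebra_simps add_divide_distrib diff_divide_distrib)
    qed
    show ?case
      unfolding ab(1) eqn r real_sqrt_mult S_def[symmetric] B_def[symmetric] w_def[symmetric]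
      using pos by (simp add: field_simps)
  qed
  ultimately show ?thesis by (simp add: Lim_transform_eventually)
qed

section \<open>Finite-dimensional limits of the normalised sums\<close>

theorem theorem1p3:
  fixes M :: "'a measure"
    and \<xi> :: "nat \<Rightarrow> real \<Rightarrow> 'a \<Rightarrow> real"
    and \<psi> :: "real \<Rightarrow> real"
    and s :: "nat \<Rightarrow> real"
    and \<theta> :: real
    and ts :: "'n::finite \<Rightarrow> real"
  assumes levy: "\<And>i. levy_process M (\<xi> i)"
    and indep: "prob_space.indep_vars M (\<lambda>_. path_space) (\<lambda>i. path_of (\<xi> i)) UNIV"
    and ident: "\<And>i. distr M path_space (path_of (\<xi> i)) = distr M path_space (path_of (\<xi> 0))"
    and mgf_finite: "\<And>u. integrable M (\<lambda>\<omega>. exp (u * \<xi> 0 1 \<omega>))"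
    and psi_def: "\<And>u. \<psi> u = ln (integral\<^sup>L M (\<lambda>\<omega>. exp (u * \<xi> 0 1 \<omega>)))"
    and nonconst: "\<not> (\<exists>c. AE \<omega> in M. \<xi> 0 1 \<omega> = c)"
    and s_nonneg: "\<And>N. s N \<ge> 0"
    and s_lim: "filterlim s at_top sequentially"
    and asymp: "(\<lambda>N. ln (real N) - (2 * deriv \<psi> 2 - \<psi> 2) * s N
                   - 2 * \<theta> * sqrt (deriv (deriv \<psi>) 2 * s N))
                \<in> o[sequentially](\<lambda>N. sqrt (s N))"
  shows "\<exists>G. centered_gaussian G
              (\<lambda>i j. std_normal_cdf \<theta> * exp ((\<psi> 1 - \<psi> 2 / 2) * \<bar>ts j - ts i\<bar>))
           \<and> weak_conv_metric
              (\<lambda>N. distr M borel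
                 (\<lambda>\<omega>. \<chi> k. let Z = (\<lambda>t \<omega>'. \<Sum>i<N. exp (\<xi> i (s N + t) \<omega>')) in
                    (Z (ts k) \<omega> - integral\<^sup>L M (Z (ts k)))
                    / sqrt (prob_space.variance M (Z (ts k)))))
              G"
proof -
  interpret L: levy_mgf M "\<xi> 0"
    by unfold_locales (use levy mgf_finite in auto)
  have psi: "\<psi> = L.psi" by (rule ext) (simp add: psi_def L.psi_def)
  \<comment> \<open>The earliest observation offset, possibly negative, becomes the reference point
    so that all delays \<open>h k\<close> are non-negative. The cap at \<open>1\<close> below keeps
    \<open>a N\<close> positive for every \<open>N\<close> and is eventually inactive.\<close>
  define \<tau> where "\<tau> = Min (range ts)"
  define h where "h k = ts k - \<tau>" for k
  define a where "a N = max 1 (s N + \<tau>)" for N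
  have h0: "h k \<ge> 0" for k by (simp add: h_def \<tau>_def)
  have s\<tau>: "filterlim (\<lambda>N. \<tau> + s N) at_top sequentially"
    by (rule filterlim_tendsto_add_at_top[OF tendsto_const s_lim])
  have a_ev: "\<forall>\<^sub>F N in sequentially. a N = s N + \<tau>"
    using filterlim_at_top[THEN iffD1, OF s\<tau>, rule_format, of 1] by eventually_elim (simp add: a_def)
  have a_top: "filterlim a at_top sequentially"
    by (rule filterlim_at_top_mono[OF s\<tau>]) (simp add: a_def add.commute le_max_iff_disj)
  have v: "deriv (deriv L.psi) 2 > 0" by (rule L.psi_deriv2_pos[OF nonconst])
  interpret C: critical_levy M "\<xi> 0" a h \<theta>
  proof
    show "(\<lambda>N. (ln (real N) / 2 + L.psi 2 * a N / 2 - deriv L.psi 2 * a N) / sqrt (deriv (deriv L.psi) 2 * a N)) \<longlonglongrightarrow> \<theta>"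
      using asymp unfolding psi by (rule critical_asymp_shift[OF v s_lim a_ev])
  qed (use nonconst a_top h0 in \<open>auto simp: a_def\<close>)
  define c where "c = std_normal_cdf \<theta>"
  have c0: "c \<ge> 0" by (simp add: c_def std_normal_cdf_def)
  \<comment> \<open>Multiplying the process by \<open>sqrt c\<close> multiplies its covariance by
    \<open>c\<close>, so the random limit is built directly with the scaled covariance.\<close>
  let ?C = "\<lambda>i j. c * exp (- C.\<kappa> * \<bar>ts j - ts i\<bar>)"
  obtain D :: "real set" and B where DB: "finite D" "\<And>i j. ?C i j = (\<Sum>d\<in>D. B d i * B d j)"
    using ornstein_uhlenbeck_gram[of c C.\<kappa> ts] c0 C.kappa_pos by auto
  obtain G where G: "centered_gaussian G ?C"
    unfolding DB(2) using exists_centered_gaussian_gram[OF DB(1), of B] by blast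
  have q: "(\<Sum>i\<in>UNIV. \<Sum>j\<in>UNIV. u$i * ?C i j * u$j) \<ge> 0" for u :: "real^'n"
    unfolding DB(2) gram_quadratic_form by (simp add: sum_nonneg)
  have covq: "(\<Sum>i\<in>UNIV. \<Sum>j\<in>UNIV. u$i * ?C i j * u$j) = c * C.covq (\<lambda>k. u$k)" for u :: "real^'n"
    unfolding C.covq_def sum_distrib_left h_def by (intro sum.cong refl) (simp add: mult_ac)
  define Z where "Z N k \<omega> = (\<Sum>i<N. exp (\<xi> i (s N + ts k) \<omega>))" for N k \<omega>
  define T where "T N \<omega> = (\<chi> k. (Z N k \<omega> - integral\<^sup>L M (Z N k)) / sqrt (L.variance (Z N k)))" for N \<omega>
  \<comment> \<open>For small \<open>N\<close> some \<open>s N + ts k\<close> may be negative, where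
    the process carries no information; all statements about \<open>T N\<close> are therefore
    restricted to large \<open>N\<close>.\<close>
  define good where "good N \<longleftrightarrow> N > 0 \<and> a N = s N + \<tau>" for N
  have good_ev: "\<forall>\<^sub>F N in sequentially. good N"
    using a_ev eventually_gt_at_top[of "0::nat"] by eventually_elim (simp add: good_def)
  have t_eq: "s N + ts k = a N + h k" if "good N" for N k
    using that by (simp add: good_def h_def)
  have t0: "0 \<le> s N + ts k" if "good N" for N k
    unfolding t_eq[OF that] by (rule C.ah_nonneg)
  have pm: "path_of (\<xi> i) \<in> measurable M path_space" for i
    using indep by (simp add: L.indep_vars_def)
  have coord: "(\<lambda>p. p t) \<in> borel_measurable path_space" if "0 \<le> t" for t :: real
    unfolding path_space_def using that by (intro measurable_component_singleton) auto
  have path: "path_of (\<xi> i) \<omega> t = \<xi> i t \<omega>" if "0 \<le> t" for i t \<omega>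
    using that by (simp add: path_of_def)
  \<comment> \<open>Every one-copy quantity is a measurable functional of the path, so equality of
    the path laws transfers its expectation from copy \<open>i\<close> to copy
    \<open>0\<close>.\<close>
  have same: "(\<integral>\<omega>. F (path_of (\<xi> i) \<omega>) \<partial>M) = (\<integral>\<omega>. F (path_of (\<xi> 0) \<omega>) \<partial>M)"
    if "F \<in> borel_measurable path_space" for F :: "(real \<Rightarrow> real) \<Rightarrow> 'b::{banach, second_countable_topology}" and i
    using integral_distr[OF pm that, of i] integral_distr[OF pm that, of 0] ident[of i] by simp
  have xim: "\<xi> i t \<in> borel_measurable M" if "0 \<le> t" for i t
    using levy[of i] that by (simp add: levy_process_def)
  have Zm: "Z N k \<in> borel_measurable M" if "good N" for N k
    unfolding Z_def using xim[OF t0[OF that]] by measurable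
  have ZV: "integral\<^sup>L M (Z N k) = real N * L.expectation (\<lambda>\<omega>. exp (\<xi> 0 (s N + ts k) \<omega>)) \<and>
     L.variance (Z N k) = real N * L.variance (\<lambda>\<omega>. exp (\<xi> 0 (s N + ts k) \<omega>))" if g: "good N" for N k
  proof -
    let ?t = "s N + ts k"
    let ?E = "\<lambda>i \<omega>. exp (\<xi> i ?t \<omega>)"
    have tm[measurable]: "(\<lambda>p. p ?t) \<in> borel_measurable path_space" by (rule coord[OF t0[OF g]])
    have ind: "L.indep_vars (\<lambda>_. borel) ?E {..<N}"
    proof -
      have "L.indep_vars (\<lambda>_. borel) (\<lambda>i \<omega>. exp (path_of (\<xi> i) \<omega> ?t)) {..<N}"
        by (rule L.indep_vars_compose2[OF L.indep_vars_subset[OF indep]]) auto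
      then show ?thesis by (simp only: path[OF t0[OF g]])
    qed
    have tr: "integrable M (\<lambda>\<omega>. exp (u * \<xi> i ?t \<omega>))" for u i
    proof -
      have "integrable (distr M path_space (path_of (\<xi> i))) (\<lambda>p. exp (u * p ?t))"
        unfolding ident[of i] using L.integrable_exp[OF t0[OF g], of u k]
        by (subst integrable_distr_eq[OF pm]) (auto simp: path[OF t0[OF g]])
      then show ?thesis by (subst (asm) integrable_distr_eq[OF pm]) (auto simp: path[OF t0[OF g]])
    qed
    have i1: "integrable M (?E i)" for i using tr[of 1 i] by simp
    have i2: "integrable M (\<lambda>\<omega>. (?E i \<omega>)\<^sup>2)" for i using tr[of 2 i] by (simp add: exp_double)
    have e: "L.expectation (?E i) = L.expectation (?E 0)" for i
      using same[of "\<lambda>p. exp (p ?t)" i] by (simp add: path[OF t0[OF g]])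
    have var: "L.variance (?E i) = L.variance (?E 0)" for i
      using same[of "\<lambda>p. (exp (p ?t) - L.expectation (?E 0))\<^sup>2" i] by (simp add: path[OF t0[OF g]] e[of i])
    have "L.expectation (Z N k) = (\<Sum>i<N. L.expectation (?E i))"
      unfolding Z_def by (intro Bochner_Integration.integral_sum i1)
    moreover have "L.variance (Z N k) = (\<Sum>i<N. L.variance (?E i))"
      unfolding Z_def by (intro L.variance_sum_indep ind i1 i2) simp
    moreover have "(\<Sum>i<N. L.expectation (?E i)) = real N * L.expectation (?E 0)"
    proof -
      have "(\<Sum>i<N. L.expectation (?E i)) = (\<Sum>i<N. L.expectation (?E 0))" by (intro sum.cong refl e)
      then show ?thesis by (simp only: sum_constant card_lessThan)
    qed
    moreover have "(\<Sum>i<N. L.variance (?E i)) = real N * L.variance (?E 0)"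
    proof -
      have "(\<Sum>i<N. L.variance (?E i)) = (\<Sum>i<N. L.variance (?E 0))" by (intro sum.cong refl var)
      then show ?thesis by (simp only: sum_constant card_lessThan)
    qed
    ultimately show ?thesis by (simp only:)
  qed
  have charT: "(\<integral>\<omega>. iexp (u \<bullet> T N \<omega>) \<partial>M) = (\<integral>\<omega>. iexp (C.Y (\<lambda>k. u$k) N \<omega>) \<partial>M) ^ N"
    if g: "good N" for u :: "real^'n" and N
  proof -
    define m where "m k = L.expectation (\<lambda>\<omega>. exp (\<xi> 0 (s N + ts k) \<omega>))" for k
    define w where "w k = sqrt (real N * L.variance (\<lambda>\<omega>. exp (\<xi> 0 (s N + ts k) \<omega>)))" for k
    \<comment> \<open>\<open>F\<close> is the share of one path in \<open>u \<bullet> T N\<close>.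
      Interchanging the sums over times and copies writes \<open>u \<bullet> T N\<close> as a sum of
      \<open>F\<close> over independent paths, and its characteristic function becomes an
      \<open>N\<close>-th power.\<close>
    define F where "F p = (\<Sum>k\<in>UNIV. u$k * ((exp (p (s N + ts k)) - m k) / w k))" for p
    have Fm[measurable]: "F \<in> borel_measurable path_space"
      unfolding F_def using coord[OF t0[OF g]] by measurable
    have "T N \<omega> $ k = (\<Sum>i<N. (exp (\<xi> i (s N + ts k) \<omega>) - m k) / w k)" for \<omega> k
    proof -
      have "T N \<omega> $ k = (Z N k \<omega> - real N * m k) / w k"
        unfolding T_def m_def w_def
        by (simp only: vec_lambda_beta, simp only: ZV[OF g, THEN conjunct2], simp only: ZV[OF g, THEN conjunct1])
      also have "\<dots> = (\<Sum>i<N. exp (\<xi> i (s N + ts k) \<omega>) - m k) / w k"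
        unfolding Z_def by (simp only: sum_subtractf sum_constant card_lessThan)
      finally show ?thesis by (simp only: sum_divide_distrib)
    qed
    then have "u \<bullet> T N \<omega> = (\<Sum>k\<in>UNIV. \<Sum>i<N. u$k * ((exp (\<xi> i (s N + ts k) \<omega>) - m k) / w k))" for \<omega>
      by (simp add: inner_vec_def sum_distrib_left)
    then have uT: "u \<bullet> T N \<omega> = (\<Sum>i<N. F (path_of (\<xi> i) \<omega>))" for \<omega>
      unfolding F_def path[OF t0[OF g]] by (subst sum.swap) simp
    have FY: "F (path_of (\<xi> 0) \<omega>) = C.Y (\<lambda>k. u$k) N \<omega>" for \<omega>
      unfolding F_def path[OF t0[OF g]]
      unfolding C.Y_def m_def w_def t_eq[OF g] ..
    have ind: "L.indep_vars (\<lambda>_. borel) (\<lambda>i \<omega>. iexp (F (path_of (\<xi> i) \<omega>))) {..<N}"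
      by (rule L.indep_vars_compose2[OF L.indep_vars_subset[OF indep]]) auto
    have int: "integrable M (\<lambda>\<omega>. iexp (F (path_of (\<xi> i) \<omega>)))" for i
      using measurable_compose[OF pm Fm, of i] by (intro L.integrable_iexp) auto
    have "(\<integral>\<omega>. iexp (u \<bullet> T N \<omega>) \<partial>M) = (\<integral>\<omega>. (\<Prod>i<N. iexp (F (path_of (\<xi> i) \<omega>))) \<partial>M)"
      unfolding uT by (simp add: exp_sum[symmetric] sum_distrib_left)
    also have "\<dots> = (\<Prod>i<N. \<integral>\<omega>. iexp (F (path_of (\<xi> i) \<omega>)) \<partial>M)"
      by (rule L.indep_vars_lebesgue_integral[OF _ ind int]) simp
    also have "\<dots> = (\<Prod>i<N. \<integral>\<omega>. iexp (F (path_of (\<xi> 0) \<omega>)) \<partial>M)"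
      by (intro prod.cong refl same) measurable
    also have "\<dots> = (\<integral>\<omega>. iexp (F (path_of (\<xi> 0) \<omega>)) \<partial>M) ^ N" by simp
    finally show ?thesis unfolding FY .
  qed
  have Tm: "T N \<in> borel_measurable M" if "good N" for N
    unfolding T_def
    by (intro borel_measurable_vec_lambda borel_measurable_divide borel_measurable_diff borel_measurable_const Zm that)
  have Gp: "prob_space G" "sets G = sets borel" using G by (auto simp: centered_gaussian_def)
  have "weak_conv_metric (\<lambda>N. distr M borel (T N)) G"
  proof (rule weak_conv_metric_iexpI[OF _ Gp])
    show "\<forall>\<^sub>F N in sequentially. prob_space (distr M borel (T N)) \<and> sets (distr M borel (T N)) = sets borel"
      using good_ev by eventually_elim (simp add: L.prob_space_distr Tm)
  next
    fix u :: "real^'n"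
    have "(\<lambda>N. (\<integral>\<omega>. iexp (C.Y (\<lambda>k. u$k) N \<omega>) \<partial>M) ^ N) \<longlonglongrightarrow> of_real (exp (- (c * C.covq (\<lambda>k. u$k)) / 2))"
    proof (rule power_tendsto_exp[OF filterlim_ident])
      show "- (c * C.covq (\<lambda>k. u$k)) / 2 \<le> 0" using q[of u] unfolding covq by simp
      have "cmod (\<integral>\<omega>. iexp (C.Y (\<lambda>k. u$k) N \<omega>) \<partial>M) \<le> L.expectation (\<lambda>_. 1)" for N
        by (rule norm_integral_le) auto
      then show "\<forall>\<^sub>F N in sequentially. cmod (\<integral>\<omega>. iexp (C.Y (\<lambda>k. u$k) N \<omega>) \<partial>M) \<le> 1"
        by (simp add: L.prob_space)
      show "(\<lambda>N. of_nat N * ((\<integral>\<omega>. iexp (C.Y (\<lambda>k. u$k) N \<omega>) \<partial>M) - 1)) \<longlonglongrightarrow> of_real (- (c * C.covq (\<lambda>k. u$k)) / 2)"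
        unfolding c_def by (rule C.char_Y_limit)
    qed
    moreover have "\<forall>\<^sub>F N in sequentially. (\<integral>\<omega>. iexp (C.Y (\<lambda>k. u$k) N \<omega>) \<partial>M) ^ N = (\<integral>x. iexp (u \<bullet> x) \<partial>distr M borel (T N))"
      using good_ev
    proof eventually_elim
      case (elim N)
      have "(\<integral>x. iexp (u \<bullet> x) \<partial>distr M borel (T N)) = (\<integral>\<omega>. iexp (u \<bullet> T N \<omega>) \<partial>M)"
        by (rule integral_distr[OF Tm[OF elim]]) measurable
      then show ?case unfolding charT[OF elim] ..
    qed
    moreover have "(\<integral>x. iexp (u \<bullet> x) \<partial>G) = of_real (exp (- (c * C.covq (\<lambda>k. u$k)) / 2))"
      using centered_gaussian_char[OF G q, of u] unfolding covq .
    ultimately show "(\<lambda>N. \<integral>x. iexp (u \<bullet> x) \<partial>distr M borel (T N)) \<longlonglongrightarrow> (\<integral>x. iexp (u \<bullet> x) \<partial>G)"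
      by (simp add: Lim_transform_eventually)
  next
    fix e :: real assume e: "e > 0"
    define K where "K = sqrt (real CARD('n) / e)"
    have K: "K > 0" "real CARD('n) / K\<^sup>2 = e" using e by (auto simp: K_def)
    have "\<forall>\<^sub>F N in sequentially. measure (distr M borel (T N)) {x. norm x > K} \<le> e"
      using good_ev
    proof eventually_elim
      case (elim N)
      show ?case using L.standardized_tight[of "Z N", OF Zm[OF elim] K(1)] unfolding K(2) T_def .
    qed
    then show "\<exists>L>0. \<forall>\<^sub>F N in sequentially. measure (distr M borel (T N)) {x. norm x > L} \<le> e"
      using K(1) by blast
  qed
  moreover have "C.\<kappa> = - (\<psi> 1 - \<psi> 2 / 2)" by (simp add: C.\<kappa>_def psi)
  ultimately show ?thesis
    using G by (intro exI[of _ G]) (simp add: c_def T_def[abs_def] Z_def[abs_def] Let_def)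
qed

end
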